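(* Let $n\ge 3$ be an integer and let $\phi : U_n(\mathbb{C}) \to U_n(\mathbb{C})$ be a map. The following assertions are equivalent. (1) $\phi$ is a local automorphism of the group $U_n(\mathbb C)$. (2) There exist $T \in U_n(\mathbb{C})$ and a function $f\in \mathcal{LM}_u$ such that either $$\phi(A) = f(\det A)\, T A T^{-1}\quad\text{for all } A \in U_n(\mathbb{C}),$$ or $$\phi(A) = f(\det \overline{A})\, T\overline{A} T^{-1}\quad\text{for all } A \in U_n(\mathbb{C}).$$
   Context: A map $\phi: G\to G$ on a group $G$ (no algebraic property or bijectivity assumed) is called a local automorphism of $G$ if for every pair $a,b\in G$ there exists a group automorphism $\phi_{a,b}:G\to G$ (depending on $a,b$) such that $\phi(a)=\phi_{a,b}(a)$ and $\phi(b)=\phi_{a,b}(b)$. Automorphisms are abstract group automorphisms (no continuity assumed). $U_n(\mathbb C)$ is the group of $n\times n$ complex unitary matrices; $\overline A$ is the entrywise complex conjugate of $A$. $\mathbb S^1=\{z\in\mathbb C : |z|=1\}$ is viewed as a multiplicative group. $\mathcal M_u$ is the set of all multiplicative functions $g:\mathbb S^1\to\mathbb S^1$ (that is, $g(\lambda\mu)=g(\lambda)g(\mu)$ for all $\lambda,\mu\in\mathbb S^1$) such that $\lambda\mapsto g(\lambda)^n\lambda$ is an automorphism of the group $\mathbb S^1$. $\mathcal{LM}_u$ is the set of all functions $f:\mathbb S^1\to\mathbb S^1$ such that for all $\lambda,\mu\in\mathbb S^1$ there exists $g\in\mathcal M_u$ with $f(\lambda)=g(\lambda)$ and $f(\mu)=g(\mu)$.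 *)

theory Defs
  imports "HOL-Analysis.Analysis" "HOL-Algebra.Group"
begin

definition conj_matrix :: "complex^'n^'m \<Rightarrow> complex^'n^'m" where
  "conj_matrix A = map_matrix cnj A"

definition conj_transpose :: "complex^'n^'m \<Rightarrow> complex^'m^'n" where
  "conj_transpose A = transpose (conj_matrix A)"

definition scale_matrix :: "complex \<Rightarrow> complex^'n^'m \<Rightarrow> complex^'n^'m"  (infixr \<open>*\<^sub>M\<close> 75) where
  "c *\<^sub>M A = map_matrix (\<lambda>z. c * z) A"

definition unitary_matrix :: "complex^'n^'n \<Rightarrow> bool" where
  "unitary_matrix U \<longleftrightarrow> conj_transpose U ** U = mat 1 \<and> U ** conj_transpose U = mat 1"

definition unitary_group :: "(complex^'n^'n) monoid" where
  "unitary_group = \<lparr>carrier = {U. unitary_matrix U}, mult = (**), one = mat 1\<rparr>"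

definition circle_group :: "complex monoid" where
  "circle_group = \<lparr>carrier = {z. cmod z = 1}, mult = (*), one = 1\<rparr>"

text \<open>
  Maps on a group are total functions on the underlying type of which only the values on the
  carrier matter. An automorphism of \<open>G\<close> is an element of \<^term>\<open>iso G G\<close>; unlike
  \<open>auto G\<close> of HOL-Algebra, this does not require extensionality.
\<close>

definition local_automorphism :: "('a, 'b) monoid_scheme \<Rightarrow> ('a \<Rightarrow> 'a) \<Rightarrow> bool" where
  "local_automorphism G \<phi> \<longleftrightarrow>
     \<phi> \<in> carrier G \<rightarrow> carrier G \<and>
     (\<forall>a \<in> carrier G. \<forall>b \<in> carrier G. \<exists>\<psi> \<in> iso G G. \<phi> a = \<psi> a \<and> \<phi> b = \<psi> b)"

definition M_u :: "nat \<Rightarrow> (complex \<Rightarrow> complex) set" where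
  "M_u n = {g \<in> hom circle_group circle_group.
              (\<lambda>z. g z ^ n * z) \<in> iso circle_group circle_group}"

definition LM_u :: "nat \<Rightarrow> (complex \<Rightarrow> complex) set" where
  "LM_u n = {f \<in> carrier circle_group \<rightarrow> carrier circle_group.
               \<forall>z \<in> carrier circle_group. \<forall>w \<in> carrier circle_group.
                 \<exists>g \<in> M_u n. f z = g z \<and> f w = g w}"

lemma conj_transpose_mult: "conj_transpose (A ** B) = conj_transpose B ** conj_transpose A"
  by (simp add: conj_transpose_def conj_matrix_def vec_eq_iff transpose_def matrix_matrix_mult_def
      mult.commute)

lemma conj_transpose_conj_transpose [simp]: "conj_transpose (conj_transpose A) = A"
  by (simp add: conj_transpose_def conj_matrix_def vec_eq_iff transpose_def)

lemma conj_transpose_mat_1 [simp]: "conj_transpose (mat 1) = mat 1"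
  by (simp add: conj_transpose_def conj_matrix_def vec_eq_iff transpose_def mat_def)

lemma unitary_matrix_mult:
  assumes "unitary_matrix A" "unitary_matrix B"
  shows "unitary_matrix (A ** B)"
proof -
  have "conj_transpose B ** conj_transpose A ** (A ** B)
      = conj_transpose B ** (conj_transpose A ** A) ** B"
    by (simp add: matrix_mul_assoc)
  moreover have "A ** B ** (conj_transpose B ** conj_transpose A)
      = A ** (B ** conj_transpose B) ** conj_transpose A"
    by (simp add: matrix_mul_assoc)
  ultimately show ?thesis
    using assms by (simp add: unitary_matrix_def conj_transpose_mult)
qed

lemma group_unitary_group: "group unitary_group"
proof (rule groupI)
  fix A :: "complex^'n^'n" assume "A \<in> carrier unitary_group"
  then show "\<exists>B \<in> carrier unitary_group. B \<otimes>\<^bsub>unitary_group\<^esub> A = \<one>\<^bsub>unitary_group\<^esub>"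
    by (intro bexI[of _ "conj_transpose A"]) (auto simp: unitary_group_def unitary_matrix_def)
qed (auto simp: unitary_group_def unitary_matrix_mult matrix_mul_assoc, simp add: unitary_matrix_def)

lemma group_circle_group: "group circle_group"
proof (rule groupI)
  fix z assume "z \<in> carrier circle_group"
  then show "\<exists>w \<in> carrier circle_group. w \<otimes>\<^bsub>circle_group\<^esub> z = \<one>\<^bsub>circle_group\<^esub>"
    by (intro bexI[of _ "inverse z"]) (auto simp: circle_group_def norm_inverse intro!: left_inverse)
qed (auto simp: circle_group_def norm_mult)

end

theory Submission
  imports Defs
begin

text \<open>
  Let \<open>n = CARD('n)\<close>. An automorphism \<open>\<psi>\<close> of the unitary group sends a reflection in a
  line to plus or minus a reflection in a line: if an involution \<open>S\<close> has two orthogonal eigenvectors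
  for each of \<open>1\<close> and \<open>-1\<close>, then \<open>S\<close> has two commuting conjugates \<open>S'\<close>, \<open>S''\<close> such that
  \<open>S S'\<close> and \<open>S S''\<close> have traces \<open>n - 4\<close> and \<open>n - 8\<close>, whereas products of a reflection with
  different commuting reflections are all conjugate. The induced map on lines preserves
  orthogonality, and, by equivariance, \<open>|<hx,hy>|\<^sup>2\<close> is a function \<open>Q\<close> of \<open>|<x,y>|\<^sup>2\<close>. In
  dimension at least three \<open>Q\<close> is multiplicative and \<open>Q (1 - p) = 1 - Q p\<close>, so \<open>Q\<close> is additive,
  nonnegative, and hence the identity. Wigner's theorem then gives the matrix \<open>T\<close>, and \<open>\<psi> A\<close> is a
  scalar multiple of \<open>T A T\<^sup>*\<close> or of \<open>T (conj A) T\<^sup>*\<close>; the scalar is a function of the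
  determinant because the group is generated by quasi-reflections.

  For a local automorphism \<open>\<phi>\<close>, pair a given \<open>A\<close> with \<open>r R\<close>, where \<open>R\<close> is the quasi-reflection
  with eigenvalue \<open>\<i>\<close> on a line \<open>x\<close> and \<open>r\<close> is chosen such that \<open>det (r R) = det A\<close>. The spectrum of \<open>R\<close>
  is not a multiple of its conjugate, so the image of \<open>r R\<close> reveals whether conjugation is
  involved, the scalar \<open>f (det A)\<close> and the image of the line \<open>x\<close>. Wigner's theorem applies to
  these lines, and comparing the quadratic forms of \<open>A\<close> and \<open>\<phi> A\<close> gives \<open>\<phi> A = f (det A) T A T\<^sup>*\<close> or
  the same with the transpose of \<open>A\<close>. A pair of matrices whose commutator has a non-real trace
  excludes the transpose.
\<close>

section \<open>The Hermitian form and unit vectors\<close>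

text \<open>The inner product \<open>x \<bullet> y\<close> on this type is real and equals only the
  real part of \<open>herm x y\<close>; phases and complex orthogonality need the full complex
  form.\<close>

definition herm :: "complex^'n \<Rightarrow> complex^'n \<Rightarrow> complex" where
  "herm x y = (\<Sum>i\<in>UNIV. x $ i * cnj (y $ i))"

definition cnj_vec :: "complex^'n \<Rightarrow> complex^'n" where
  "cnj_vec x = (\<chi> i. cnj (x $ i))"

lemma cmod_eq_1_iff: "cmod c = 1 \<longleftrightarrow> c * cnj c = 1"
proof -
  have "c * cnj c = 1 \<longleftrightarrow> (cmod c)\<^sup>2 = 1"
    by (metis complex_norm_square of_real_1 of_real_eq_iff)
  then show ?thesis
    by (simp add: power2_eq_1_iff) (use norm_ge_zero[of c] in linarith)
qed

lemma mult_cnj_unit: "cmod c = 1 \<Longrightarrow> c * cnj c = 1" "cmod c = 1 \<Longrightarrow> cnj c * c = 1"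
  by (simp_all add: cmod_eq_1_iff mult.commute)

lemma cnj_vec_nth [simp]: "cnj_vec x $ i = cnj (x $ i)"
  by (simp add: cnj_vec_def)

lemma cnj_vec_cnj_vec [simp]: "cnj_vec (cnj_vec x) = x"
  by (simp add: vec_eq_iff)

lemma herm_add_left: "herm (x + y) z = herm x z + herm y z"
  by (simp add: herm_def distrib_right sum.distrib)

lemma herm_add_right: "herm z (x + y) = herm z x + herm z y"
  by (simp add: herm_def distrib_left sum.distrib)

lemma herm_diff_left: "herm (x - y) z = herm x z - herm y z"
  by (simp add: herm_def left_diff_distrib sum_subtractf)

lemma herm_diff_right: "herm z (x - y) = herm z x - herm z y"
  by (simp add: herm_def right_diff_distrib sum_subtractf)

lemma herm_scale_left: "herm (c *s x) y = c * herm x y"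
  by (simp add: herm_def sum_distrib_left mult_ac)

lemma herm_scale_right: "herm x (c *s y) = cnj c * herm x y"
  by (simp add: herm_def sum_distrib_left mult_ac)

lemma herm_zero_left [simp]: "herm 0 x = 0" and herm_zero_right [simp]: "herm x 0 = 0"
  by (simp_all add: herm_def)

lemma herm_minus_left: "herm (- x) y = - herm x y" and herm_minus_right: "herm x (- y) = - herm x y"
  by (simp_all add: herm_def sum_negf)

lemmas herm_linear = herm_add_left herm_add_right herm_diff_left herm_diff_right
  herm_scale_left herm_scale_right herm_minus_left herm_minus_right

lemma herm_commute: "herm y x = cnj (herm x y)"
  by (simp add: herm_def cnj_sum mult.commute)

lemma cmod_herm_commute: "cmod (herm y x) = cmod (herm x y)"
  by (metis complex_mod_cnj herm_commute)

lemma herm_eq_0_commute: "herm y x = 0 \<longleftrightarrow> herm x y = 0"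
  by (metis cmod_herm_commute norm_eq_zero)

lemma herm_cnj_vec: "herm (cnj_vec x) (cnj_vec y) = cnj (herm x y)"
  by (simp add: herm_def cnj_sum)

lemma herm_same: "herm x x = of_real ((norm x)\<^sup>2)"
  by (simp add: herm_def norm_vec_def L2_set_def sum_nonneg flip: complex_norm_square)

lemma Re_herm: "Re (herm x y) = x \<bullet> y"
  by (simp add: herm_def inner_vec_def inner_complex_def)

lemma herm_same_unit [simp]: "norm x = 1 \<Longrightarrow> herm x x = 1"
  by (simp add: herm_same)

lemma norm_eq_1_herm: "norm x = 1 \<longleftrightarrow> herm x x = 1"
  unfolding herm_same norm_eq_1 dot_square_norm by (simp flip: of_real_power)

lemma herm_self_eq_0 [simp]: "herm x x = 0 \<longleftrightarrow> x = 0"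
  by (simp add: herm_same)

lemma norm_eq_herm: "norm x = norm y \<longleftrightarrow> herm x x = herm y y"
  by (simp add: herm_same flip: of_real_power)

lemma norm_cscale: "norm (c *s x) = cmod c * norm x" for x :: "complex^'n"
proof -
  have "of_real ((norm (c *s x))\<^sup>2) = herm (c *s x) (c *s x)"
    by (simp add: herm_same)
  also have "\<dots> = (c * cnj c) * herm x x"
    by (simp add: herm_linear)
  also have "\<dots> = of_real ((cmod c * norm x)\<^sup>2)"
    by (simp add: herm_same power_mult_distrib flip: complex_norm_square)
  finally have "(norm (c *s x))\<^sup>2 = (cmod c * norm x)\<^sup>2"
    using of_real_eq_iff by blast
  then show ?thesis
    by simp
qed

lemma norm_cnj_vec [simp]: "norm (cnj_vec x) = norm x"
  by (simp add: norm_eq_herm herm_cnj_vec) (simp add: herm_same)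

lemma herm_axis_right: "herm x (axis k 1) = x $ k"
proof -
  have "herm x (axis k 1) = (\<Sum>i\<in>UNIV. if i = k then x $ i else 0)"
    unfolding herm_def by (rule sum.cong) (auto simp: axis_def)
  then show ?thesis by simp
qed

lemma norm_axis_cart [simp]: "norm (axis k 1 :: complex^'n) = 1"
  by (simp only: norm_eq_1_herm herm_axis_right) (simp add: axis_def)

lemma herm_axis_axis: "j \<noteq> k \<Longrightarrow> herm (axis j 1) (axis k 1) = 0"
  by (simp only: herm_axis_right) (simp add: axis_def)

lemma exists_unit_multiple:
  fixes x :: "complex^'n"
  assumes "x \<noteq> 0"
  obtains c where "c \<noteq> 0" "norm (c *s x) = 1"
  by (rule that[of "of_real (inverse (norm x))"]) (use assms in \<open>simp_all add: norm_cscale norm_inverse\<close>)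

text \<open>The real span of \<open>x\<close>, \<open>\<i> *s x\<close>, \<open>y\<close>,
  \<open>\<i> *s y\<close> has dimension at most 4, below the real dimension 2n \<ge> 6. Real
  orthogonality to both \<open>u\<close> and \<open>\<i> *s u\<close> kills the real and the
  imaginary part of \<open>herm z u\<close>.\<close>

lemma exists_orthogonal_unit:
  fixes x y :: "complex^'n"
  assumes "CARD('n) \<ge> 3"
  obtains z where "norm z = 1" "herm z x = 0" "herm z y = 0"
proof -
  let ?S = "{x, \<i> *s x, y, \<i> *s y}"
  have "card ?S \<le> 4"
    by (simp add: card_insert_if)
  have "dim ?S \<le> card ?S"
    by (rule dim_le_card') simp
  also have "\<dots> \<le> 4" by fact
  also have "4 < DIM(complex^'n)"
    using assms by simp
  finally obtain z where z: "z \<noteq> 0" "\<And>u. u \<in> span ?S \<Longrightarrow> orthogonal z u"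
    using orthogonal_to_subspace_exists[of ?S] by blast
  have orth: "herm z u = 0" if "u \<in> ?S" "\<i> *s u \<in> ?S" for u
  proof -
    have "z \<bullet> u = 0" "z \<bullet> (\<i> *s u) = 0"
      using z(2)[OF span_base] that by (simp_all only: orthogonal_def)
    then have "Re (herm z u) = 0" "Re (herm z (\<i> *s u)) = 0"
      by (simp_all add: Re_herm)
    then show ?thesis
      by (simp add: herm_linear complex_eq_iff)
  qed
  obtain c where "norm (c *s z) = 1"
    using exists_unit_multiple[OF z(1)] by blast
  then show ?thesis
    using that[of "c *s z"] orth[of x] orth[of y] by (simp add: herm_linear)
qed

section \<open>Rank-one projections\<close>

text \<open>For a unit vector this is the orthogonal projection onto its line. The equation
  \<open>outer x = outer y\<close> says that the vectors agree up to a unimodular factor, and so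
  replaces a quotient by phases throughout.\<close>

definition outer :: "complex^'n \<Rightarrow> complex^'n^'n" where
  "outer x = (\<chi> i j. x $ i * cnj (x $ j))"

lemma outer_nth: "outer x $ i $ j = x $ i * cnj (x $ j)"
  by (simp add: outer_def)

lemma outer_mult_vec: "outer x *v y = herm y x *s x"
  by (simp add: vec_eq_iff outer_def matrix_vector_mult_def herm_def sum_distrib_left sum_distrib_right mult_ac)

lemma outer_scale: "cmod c = 1 \<Longrightarrow> outer (c *s x) = outer x"
proof -
  assume "cmod c = 1"
  then have "c * x $ i * cnj (c * x $ j) = x $ i * cnj (x $ j)" for i j
    using mult_cnj_unit(1)[of c] by (simp add: mult_ac)
  then show ?thesis
    by (simp add: outer_def vec_eq_iff)
qed

lemma outer_eqE:
  assumes "outer x = outer y"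
  obtains c where "cmod c = 1" "x = c *s y"
proof (cases "y = 0")
  case True
  then have "herm x x *s x = 0"
    by (metis assms outer_mult_vec herm_zero_right vector_smult_lzero)
  then show ?thesis
    using True that[of 1] by auto
next
  case False
  have yy: "herm y x *s x = herm y y *s y"
    by (metis assms outer_mult_vec)
  have xx: "herm x x *s x = herm x y *s y"
    by (metis assms outer_mult_vec)
  have ne: "herm y x \<noteq> 0"
    using yy False by auto
  define c where "c = herm y y / herm y x"
  have x: "x = c *s y"
  proof -
    have "herm y x *s x = herm y x *s (c *s y)"
      using yy ne by (simp add: c_def vector_smult_assoc)
    then show ?thesis using ne by (simp only: vector_mul_lcancel) simp
  qed
  have "herm y x * cnj (herm y x) = herm y y * herm y y"
  proof -
    have "herm (herm y x *s x) y = herm (herm y y *s y) y"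
      using yy by simp
    then show ?thesis
      by (simp add: herm_linear herm_commute[of y x])
  qed
  then have "(cmod (herm y x))\<^sup>2 = (cmod (herm y y))\<^sup>2"
    by (metis complex_mod_cnj norm_mult power2_eq_square)
  then have "cmod (herm y x) = cmod (herm y y)"
    by simp
  then have "cmod c = 1"
    using ne False by (simp add: c_def norm_divide)
  with x that show ?thesis by blast
qed

text \<open>The equality case of the Cauchy-Schwarz inequality: for nonzero \<open>b\<close>, the
  residue of \<open>a\<close> after projection onto the line of \<open>b\<close> has norm
  zero.\<close>

lemma outer_eq_parallel:
  assumes "norm a = norm b" "cmod (herm a b) = (norm b)\<^sup>2"
  shows "outer a = outer b"
proof (cases "b = 0")
  case True
  then show ?thesis using assms by simp
next
  case False
  define c where "c = herm a b / herm b b"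
  have c1: "cmod c = 1"
    using False assms(2) by (simp add: c_def norm_divide herm_same norm_power)
  have bb: "herm b b \<noteq> 0" using False by simp
  have "herm (a - c *s b) (a - c *s b) = herm a a - cnj c * herm a b - c * cnj (herm a b) + c * cnj c * herm b b"
    by (simp add: herm_linear herm_commute[of a b] algebra_simps)
  moreover have "herm a b = c * herm b b"
    using bb by (simp add: c_def)
  moreover have "cnj (herm b b) = herm b b"
    by (simp add: herm_same)
  moreover have "c * cnj c = 1" "c * (cnj c * z) = z" for z
    using mult_cnj_unit(1)[OF c1] by (simp_all flip: mult.assoc)
  moreover have "herm a a = herm b b"
    using assms(1) by (simp add: norm_eq_herm)
  ultimately have "herm (a - c *s b) (a - c *s b) = 0"
    by (simp add: algebra_simps)
  then have "a = c *s b" by simp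
  then show ?thesis
    using c1 outer_scale by blast
qed

lemma outer_eq_cmod_herm: "outer x = outer y \<Longrightarrow> cmod (herm a x) = cmod (herm a y)"
  by (erule outer_eqE) (simp add: herm_linear norm_mult)

lemma outer_eq_cmod_herm2:
  "outer x = outer y \<Longrightarrow> outer a = outer b \<Longrightarrow> cmod (herm a x) = cmod (herm b y)"
  by (metis outer_eq_cmod_herm cmod_herm_commute)

lemma outer_cscale_cong: "outer x = outer y \<Longrightarrow> outer (c *s x) = outer (c *s y)"
  by (erule outer_eqE) (use outer_scale[of _ "c *s y"] in \<open>simp add: vector_smult_assoc mult.commute\<close>)

lemma outer_cnj_vec_cong: "outer x = outer y \<Longrightarrow> outer (cnj_vec x) = outer (cnj_vec y)"
proof (erule outer_eqE)
  fix c assume c: "cmod c = 1" "x = c *s y"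
  then have "cnj_vec x = cnj c *s cnj_vec y" by (simp add: vec_eq_iff)
  then show ?thesis using c outer_scale by (metis complex_mod_cnj)
qed

lemma trace_outer: "trace (outer x) = herm x x"
  by (simp add: trace_def outer_def herm_def)

section \<open>Scalar multiples, adjoints and unitary matrices\<close>

lemma scale_nth: "(c *\<^sub>M A) $ i $ j = c * A $ i $ j"
  by (simp add: scale_matrix_def)

lemma scale_mult_left: "(c *\<^sub>M A) ** B = c *\<^sub>M (A ** B)"
  by (simp add: vec_eq_iff scale_nth matrix_matrix_mult_def sum_distrib_left mult_ac)

lemma scale_mult_right: "A ** (c *\<^sub>M B) = c *\<^sub>M (A ** B)"
  by (simp add: vec_eq_iff scale_nth matrix_matrix_mult_def sum_distrib_left mult_ac)

lemma scale_mult_vec: "(c *\<^sub>M A) *v x = c *s (A *v x)"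
  by (simp add: vec_eq_iff scale_nth matrix_vector_mult_def sum_distrib_left mult_ac)

lemma scale_scale: "a *\<^sub>M b *\<^sub>M A = (a * b) *\<^sub>M A"
  by (simp add: vec_eq_iff scale_nth mult_ac)

lemma scale_one [simp]: "1 *\<^sub>M A = A"
  by (simp add: vec_eq_iff scale_nth)

lemmas scale_simps = scale_mult_left scale_mult_right scale_scale

lemma trace_scale: "trace (c *\<^sub>M A) = c * trace A"
  by (simp add: trace_def scale_nth sum_distrib_left)

lemma conj_transpose_scale: "conj_transpose (c *\<^sub>M A) = cnj c *\<^sub>M conj_transpose A"
  by (simp add: vec_eq_iff scale_nth conj_transpose_def conj_matrix_def transpose_def)

lemma conj_matrix_nth: "conj_matrix A $ i $ j = cnj (A $ i $ j)"
  by (simp add: conj_matrix_def)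

lemma conj_matrix_conj_matrix [simp]: "conj_matrix (conj_matrix A) = A"
  by (simp add: vec_eq_iff conj_matrix_nth)

lemma conj_matrix_scale: "conj_matrix (c *\<^sub>M A) = cnj c *\<^sub>M conj_matrix A"
  by (simp add: vec_eq_iff scale_nth conj_matrix_nth)

lemma conj_matrix_mult: "conj_matrix (A ** B) = conj_matrix A ** conj_matrix B"
  by (simp add: vec_eq_iff conj_matrix_nth matrix_matrix_mult_def cnj_sum)

lemma conj_matrix_mult_vec: "conj_matrix A *v x = cnj_vec (A *v cnj_vec x)"
  by (simp add: vec_eq_iff conj_matrix_nth matrix_vector_mult_def cnj_sum)

lemma conj_matrix_one [simp]: "conj_matrix (mat 1) = mat 1"
  by (simp add: vec_eq_iff conj_matrix_nth mat_def)

lemma conj_transpose_conj_matrix: "conj_transpose (conj_matrix A) = conj_matrix (conj_transpose A)"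
  by (simp add: vec_eq_iff conj_matrix_nth conj_transpose_def transpose_def)

lemma trace_conj_matrix: "trace (conj_matrix A) = cnj (trace A)"
  by (simp add: trace_def conj_matrix_nth cnj_sum)

lemma trace_conj_transpose: "trace (conj_transpose A) = cnj (trace A)"
  by (simp add: trace_def conj_transpose_def transpose_def conj_matrix_nth cnj_sum)

lemma trace_transpose: "trace (transpose A) = trace A"
  by (simp add: trace_def transpose_def)

lemma det_conj_matrix: "det (conj_matrix A) = cnj (det A)"
  by (simp add: det_def conj_matrix_nth cnj_sum cnj_prod)

lemma det_scale: "det (c *\<^sub>M A) = c ^ CARD('n) * det A" for A :: "complex^'n^'n"
proof -
  have "c *\<^sub>M A = (\<chi> i. c *s A $ i)"
    by (simp add: vec_eq_iff scale_nth)
  then show ?thesis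
    using det_rows_mul[of "\<lambda>_. c" "\<lambda>i. A $ i"] by (simp add: vec_lambda_eta)
qed

lemma herm_adjoint: "herm (A *v x) y = herm x (conj_transpose A *v y)"
proof -
  have "herm (A *v x) y = (\<Sum>i\<in>UNIV. \<Sum>j\<in>UNIV. A $ i $ j * x $ j * cnj (y $ i))"
    by (simp add: herm_def matrix_vector_mult_def sum_distrib_right)
  also have "\<dots> = (\<Sum>j\<in>UNIV. \<Sum>i\<in>UNIV. A $ i $ j * x $ j * cnj (y $ i))"
    by (rule sum.swap)
  also have "\<dots> = herm x (conj_transpose A *v y)"
    by (simp add: herm_def matrix_vector_mult_def conj_transpose_def transpose_def conj_matrix_nth
        cnj_sum sum_distrib_left mult_ac)
  finally show ?thesis .
qed

lemma unitary_left: "unitary_matrix A \<Longrightarrow> conj_transpose A ** A = mat 1"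
  and unitary_right: "unitary_matrix A \<Longrightarrow> A ** conj_transpose A = mat 1"
  by (simp_all add: unitary_matrix_def)

lemma unitary_conj_transpose: "unitary_matrix A \<Longrightarrow> unitary_matrix (conj_transpose A)"
  by (simp add: unitary_matrix_def)

lemma unitary_one [simp]: "unitary_matrix (mat 1)"
  by (simp add: unitary_matrix_def)

lemma unitary_scale: "unitary_matrix A \<Longrightarrow> cmod c = 1 \<Longrightarrow> unitary_matrix (c *\<^sub>M A)"
  by (simp add: unitary_matrix_def conj_transpose_scale scale_simps mult_cnj_unit)

lemma unitary_scaleD:
  fixes A :: "complex^'n^'n"
  assumes "unitary_matrix A" "unitary_matrix (c *\<^sub>M A)"
  shows "cmod c = 1"
proof -
  have "mat 1 = (c * cnj c) *\<^sub>M (A ** conj_transpose A)"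
    using unitary_right[OF assms(2)] by (simp add: conj_transpose_scale scale_simps mult.commute)
  then have "(mat 1 :: complex^'n^'n) = (c * cnj c) *\<^sub>M mat 1"
    using assms(1) by (simp add: unitary_right)
  then have "(mat 1 :: complex^'n^'n) $ undefined $ undefined = ((c * cnj c) *\<^sub>M mat 1 :: complex^'n^'n) $ undefined $ undefined"
    by (rule arg_cong)
  then have "c * cnj c = 1"
    by (simp add: scale_nth mat_def)
  then show ?thesis
    by (simp add: cmod_eq_1_iff)
qed

lemma unitary_conj_matrix: "unitary_matrix A \<Longrightarrow> unitary_matrix (conj_matrix A)"
  by (simp add: unitary_matrix_def conj_transpose_conj_matrix flip: conj_matrix_mult)

lemma unitary_herm: "unitary_matrix A \<Longrightarrow> herm (A *v x) (A *v y) = herm x y"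
  by (simp add: herm_adjoint matrix_vector_mul_assoc unitary_left)

lemma unitary_norm: "unitary_matrix A \<Longrightarrow> norm (A *v x) = norm x"
  by (simp add: norm_eq_herm unitary_herm)

lemma unitary_cancel_left: "unitary_matrix A \<Longrightarrow> conj_transpose A *v (A *v x) = x"
  and unitary_cancel_right: "unitary_matrix A \<Longrightarrow> A *v (conj_transpose A *v x) = x"
  by (simp_all add: matrix_vector_mul_assoc unitary_left unitary_right)

lemma matrix_inv_unitary: "unitary_matrix A \<Longrightarrow> matrix_inv A = conj_transpose A"
proof -
  assume A: "unitary_matrix A"
  have "A ** matrix_inv A = mat 1 \<and> matrix_inv A ** A = mat 1"
    unfolding matrix_inv_def by (rule someI[of _ "conj_transpose A"]) (simp add: A unitary_left unitary_right)
  then have "conj_transpose A ** (A ** matrix_inv A) = conj_transpose A"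
    by simp
  then show ?thesis
    by (simp add: matrix_mul_assoc unitary_left[OF A])
qed

lemma cmod_det_unitary: "unitary_matrix A \<Longrightarrow> cmod (det A) = 1"
proof -
  assume "unitary_matrix A"
  then have "det (conj_transpose A ** A) = 1"
    by (simp add: unitary_left det_I)
  then have "cnj (det A) * det A = 1"
    by (simp add: det_mul conj_transpose_def det_conj_matrix)
  then show ?thesis
    by (simp add: cmod_eq_1_iff mult.commute)
qed

lemma trace_unitary_conj: "unitary_matrix T \<Longrightarrow> trace (T ** A ** conj_transpose T) = trace A"
  by (simp add: trace_mul_sym[of "T ** A"] matrix_mul_assoc unitary_left)

lemma unitary_conj_mult:
  "unitary_matrix T \<Longrightarrow> (T ** A ** conj_transpose T) ** (T ** B ** conj_transpose T) = T ** (A ** B) ** conj_transpose T"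
  by (simp add: matrix_mul_assoc) (simp add: unitary_left flip: matrix_mul_assoc)

lemma conj_transpose_unitary_conj:
  "conj_transpose (T ** A ** conj_transpose T) = T ** conj_transpose A ** conj_transpose T"
  by (simp add: conj_transpose_mult matrix_mul_assoc)

lemma outer_unitary: "T ** outer x ** conj_transpose T = outer (T *v x)"
proof (subst matrix_eq, intro allI)
  fix y
  have "(T ** outer x ** conj_transpose T) *v y = herm (conj_transpose T *v y) x *s (T *v x)"
    by (simp add: outer_mult_vec vector_scalar_commute flip: matrix_vector_mul_assoc)
  also have "herm (conj_transpose T *v y) x = herm y (T *v x)"
    by (simp add: herm_adjoint)
  finally show "(T ** outer x ** conj_transpose T) *v y = outer (T *v x) *v y"
    by (simp add: outer_mult_vec)
qed

lemma outer_mult_vec_cong: "outer x = outer y \<Longrightarrow> outer (T *v x) = outer (T *v y)"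
  by (metis outer_unitary)

text \<open>Eigenvalues at \<open>y\<close>, \<open>z\<close> and \<open>y + z\<close> are compared:
  either \<open>z\<close> is a multiple of \<open>y\<close>, or the eigenvalue at
  \<open>y + z\<close> equals that at \<open>z\<close>, and hence also that at
  \<open>y\<close>.\<close>

lemma eigenvectors_imp_scalar:
  fixes M :: "complex^'n^'n"
  assumes ev: "\<And>x. norm x = 1 \<Longrightarrow> \<exists>c. M *v x = c *s x"
  obtains c where "M = c *\<^sub>M mat 1"
proof -
  have ev': "\<exists>c. M *v x = c *s x" for x
  proof (cases "x = 0")
    case False
    then obtain d where d: "d \<noteq> 0" "norm (d *s x) = 1"
      by (rule exists_unit_multiple)
    then obtain c where "M *v (d *s x) = c *s (d *s x)"
      using ev by blast
    then have "d *s (M *v x) = d *s (c *s x)"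
      by (simp add: vector_scalar_commute vector_smult_assoc mult.commute)
    then have "M *v x = c *s x"
      using d(1) by (simp only: vector_mul_lcancel) simp
    then show ?thesis by blast
  qed (auto intro: exI[of _ 0])
  obtain y :: "complex^'n" where y: "y \<noteq> 0"
    by (metis norm_axis_cart norm_zero zero_neq_one)
  obtain b where b: "M *v y = b *s y"
    using ev' by blast
  have "M *v z = b *s z" for z
  proof -
    obtain c where c: "M *v z = c *s z" using ev' by blast
    obtain d where d: "M *v (y + z) = d *s (y + z)" using ev' by blast
    have eq: "(b - d) *s y = (d - c) *s z"
      using d b c by (simp add: matrix_vector_right_distrib vector_add_ldistrib vector_sub_rdistrib algebra_simps)
    show ?thesis
    proof (cases "d = c")
      case True
      then show ?thesis using eq y c by simp
    next
      case False
      then have "z = ((b - d) / (d - c)) *s y"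
        using eq by (metis (no_types, lifting) diff_eq_diff_eq diff_self divide_self_if eq_iff_diff_eq_0
            mult.commute times_divide_eq_right vector_smult_assoc vector_smult_lid mult_1 divide_inverse)
      then show ?thesis
        using b by (simp add: vector_scalar_commute vector_smult_assoc mult.commute)
    qed
  qed
  then show ?thesis
    using that[of b] by (simp add: matrix_eq scale_mult_vec)
qed

section \<open>Quasi-reflections\<close>

text \<open>For a unit vector \<open>x\<close> this acts as \<open>c\<close> on the line of
  \<open>x\<close> and as the identity on its orthogonal complement; \<open>c = -1\<close> gives the
  reflection in \<open>x\<close>.\<close>

definition qrefl :: "complex^'n \<Rightarrow> complex \<Rightarrow> complex^'n^'n" where
  "qrefl x c = mat 1 + (c - 1) *\<^sub>M outer x"

lemma qrefl_mult_vec: "qrefl x c *v y = y + ((c - 1) * herm y x) *s x"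
  by (simp add: qrefl_def matrix_vector_mult_add_rdistrib scale_mult_vec outer_mult_vec vector_smult_assoc)

lemma qrefl_one [simp]: "qrefl x 1 = mat 1"
  by (simp add: matrix_eq qrefl_mult_vec)

lemma qrefl_mult_orth: "herm y x = 0 \<Longrightarrow> qrefl x c *v y = y"
  by (simp add: qrefl_mult_vec)

lemma qrefl_outer_cong: "outer x = outer y \<Longrightarrow> qrefl x c = qrefl y c"
  by (simp add: qrefl_def)

lemma qrefl_mult: "norm x = 1 \<Longrightarrow> qrefl x a ** qrefl x b = qrefl x (a * b)"
  by (simp add: matrix_eq qrefl_mult_vec herm_linear vec_eq_iff algebra_simps flip: matrix_vector_mul_assoc)

lemma conj_transpose_qrefl: "conj_transpose (qrefl x c) = qrefl x (cnj c)"
  by (simp add: vec_eq_iff conj_transpose_def transpose_def conj_matrix_nth qrefl_def scale_nth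
      outer_nth mat_def mult_ac)

lemma conj_matrix_qrefl: "conj_matrix (qrefl x c) = qrefl (cnj_vec x) (cnj c)"
  by (simp add: vec_eq_iff conj_matrix_nth qrefl_def scale_nth outer_nth mat_def)

lemma unitary_qrefl: "norm x = 1 \<Longrightarrow> cmod c = 1 \<Longrightarrow> unitary_matrix (qrefl x c)"
  by (simp add: unitary_matrix_def conj_transpose_qrefl qrefl_mult mult_cnj_unit)

lemma qrefl_unitary_conj:
  "unitary_matrix T \<Longrightarrow> T ** qrefl x c ** conj_transpose T = qrefl (T *v x) c"
  by (simp add: matrix_eq qrefl_mult_vec matrix_vector_right_distrib vector_scalar_commute
      unitary_cancel_right herm_adjoint flip: matrix_vector_mul_assoc)

lemma trace_qrefl: "norm x = 1 \<Longrightarrow> trace (qrefl x c :: complex^'n^'n) = of_nat CARD('n) + (c - 1)"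
  by (simp add: qrefl_def trace_add trace_I trace_scale trace_outer)

text \<open>A unit vector orthogonal to \<open>x\<close> and \<open>y\<close> is scaled by
  \<open>s\<close> on one side and by \<open>t\<close> on the other; traces then compare
  \<open>c\<close> with \<open>d\<close>, and evaluation at \<open>x\<close> compares the lines. In
  dimension two a reflection is minus the reflection in the orthogonal line, whence the bound on the
  dimension.\<close>

lemma qrefl_scalar_eqD:
  fixes x y :: "complex^'n"
  assumes n: "CARD('n) \<ge> 3" and x: "norm x = 1" and y: "norm y = 1"
    and eq: "s *\<^sub>M qrefl x c = t *\<^sub>M qrefl y d" and nz: "t \<noteq> 0"
  shows "s = t" "c = d" "c \<noteq> 1 \<Longrightarrow> outer x = outer y"
proof -
  obtain z where z: "norm z = 1" "herm z x = 0" "herm z y = 0"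
    using exists_orthogonal_unit[OF n] by blast
  have "s *s z = t *s z"
    using arg_cong[OF eq, of "\<lambda>A. A *v z"] z by (simp add: scale_mult_vec qrefl_mult_orth)
  moreover have "z \<noteq> 0" using z by auto
  ultimately show st: "s = t" by simp
  have "(s * (of_nat CARD('n) + (c - 1))) = t * (of_nat CARD('n) + (d - 1))"
    using arg_cong[OF eq, of trace] x y by (simp add: trace_scale trace_qrefl)
  then show cd: "c = d"
    using st nz by simp
  assume c: "c \<noteq> 1"
  have "qrefl x c *v x = qrefl y d *v x"
    using arg_cong[OF eq, of "\<lambda>A. A *v x"] st nz by (simp add: scale_mult_vec)
  then have "(c - 1) *s x = (c - 1) *s (herm x y *s y)"
    using x cd by (simp add: qrefl_mult_vec vector_smult_assoc)
  then have xy: "x = herm x y *s y"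
    using c by (simp only: vector_mul_lcancel) simp
  then have "cmod (herm x y) = 1"
    by (metis norm_cscale mult.right_neutral x y)
  then show "outer x = outer y"
    using x y by (intro outer_eq_parallel) auto
qed

text \<open>Evaluating both products at \<open>x\<close> makes \<open>herm x y *s y\<close> a
  multiple of \<open>x\<close>, so a nonzero \<open>herm x y\<close> would make the lines
  equal.\<close>

lemma qrefl_commute_iff:
  assumes x: "norm x = 1" and y: "norm y = 1" and ne: "outer x \<noteq> outer y"
  shows "qrefl x (-1) ** qrefl y (-1) = qrefl y (-1) ** qrefl x (-1) \<longleftrightarrow> herm x y = 0"
proof
  assume "herm x y = 0"
  then show "qrefl x (-1) ** qrefl y (-1) = qrefl y (-1) ** qrefl x (-1)"
    by (simp add: matrix_eq qrefl_mult_vec herm_linear herm_eq_0_commute[of x y] add_ac flip: matrix_vector_mul_assoc)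
next
  assume eq: "qrefl x (-1) ** qrefl y (-1) = qrefl y (-1) ** qrefl x (-1)"
  let ?a = "herm x y"
  have "qrefl x (-1) *v (qrefl y (-1) *v x) = qrefl y (-1) *v (qrefl x (-1) *v x)"
    using eq by (simp add: matrix_vector_mul_assoc)
  then have "4 *s (?a *s y) = 4 *s ((?a * herm y x) *s x)"
    using x by (auto simp add: qrefl_mult_vec herm_linear vec_eq_iff algebra_simps)
  then have *: "?a *s y = (?a * herm y x) *s x"
    by (simp only: vector_mul_lcancel) simp
  show "?a = 0"
  proof (rule ccontr)
    assume a: "?a \<noteq> 0"
    have "y = herm y x *s x"
    proof -
      have "?a *s y = ?a *s (herm y x *s x)"
        using * by (simp add: vector_smult_assoc)
      then show ?thesis using a by (simp only: vector_mul_lcancel) simp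
    qed
    then have "cmod (herm y x) = 1"
      by (metis norm_cscale mult.right_neutral x y)
    then have "outer y = outer x"
      using x y by (intro outer_eq_parallel) auto
    with ne show False by simp
  qed
qed

section \<open>Transitivity and generation of the unitary group by quasi-reflections\<close>

text \<open>A complex Householder reflection along \<open>a - b\<close>. The eigenvalue -1 suffices
  when \<open>herm a b\<close> is real; in general it has to be another phase.\<close>

lemma unitary_move:
  fixes a b :: "complex^'n"
  assumes "norm a = norm b"
  obtains x c where "norm x = 1" "cmod c = 1" "qrefl x c *v a = b"
    "\<And>v. herm v (a - b) = 0 \<Longrightarrow> qrefl x c *v v = v"
proof (cases "a = b")
  case True
  show ?thesis
    by (rule that[of "axis undefined 1" 1]) (use True in simp_all)
next
  case False
  then obtain r where r: "r \<noteq> 0" "norm (r *s (a - b)) = 1"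
    by (metis exists_unit_multiple eq_iff_diff_eq_0)
  define z where "z = r *s (a - b)"
  define w where "w = herm a a - herm a b"
  have aa: "herm b b = herm a a" "cnj (herm a a) = herm a a"
    using assms by (simp_all add: norm_eq_herm herm_same)
  have "herm (a - b) (a - b) = w + cnj w"
    by (simp add: w_def herm_linear aa herm_commute[of a b] algebra_simps)
  then have rr: "r * cnj r * (w + cnj w) = 1"
    using r(2) by (simp only: norm_eq_1_herm herm_scale_left herm_scale_right) (simp add: mult_ac)
  then have w: "w \<noteq> 0" by auto
  \<comment> \<open>The phase for which \<open>(c - 1) * herm a z * r = -1\<close>, since the
    squared norm of \<open>a - b\<close> is \<open>w + cnj w\<close>.\<close>
  define c where "c = - cnj w / w"
  have c: "cmod c = 1"
    using w by (simp add: c_def norm_divide)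
  have "qrefl z c *v a = b"
  proof -
    have "herm a z = cnj r * w"
      by (simp add: z_def w_def herm_linear algebra_simps)
    then have "(c - 1) * herm a z * r = - (r * cnj r * (w + cnj w))"
      using w by (simp add: c_def field_simps)
    then have "(c - 1) * herm a z * r = -1"
      by (simp add: rr)
    then show ?thesis
      by (simp add: qrefl_mult_vec) (simp add: z_def vector_smult_assoc vec_eq_iff)
  qed
  moreover have "qrefl z c *v v = v" if "herm v (a - b) = 0" for v
    using that by (intro qrefl_mult_orth) (simp only: z_def herm_scale_right mult_zero_right)
  ultimately show ?thesis
    using that[of z c] r(2) c unfolding z_def by blast
qed

lemma matrix_vector_mult_axis: "A *v axis k 1 = column k A" for A :: "complex^'n^'m"
proof -
  have "(\<Sum>j\<in>UNIV. A $ i $ j * axis k 1 $ j) = (\<Sum>j\<in>UNIV. if j = k then A $ i $ j else 0)" for i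
    by (rule sum.cong) (auto simp: axis_def)
  then show ?thesis
    by (simp add: vec_eq_iff matrix_vector_mult_def column_def)
qed

lemma matrix_eq_axis: "(\<And>k. A *v axis k 1 = B *v axis k 1) \<Longrightarrow> A = B" for A B :: "complex^'n^'m"
proof -
  assume eq: "\<And>k. A *v axis k 1 = B *v axis k 1"
  have "column k A = column k B" for k
    using eq[of k] by (simp add: matrix_vector_mult_axis)
  then show ?thesis
    by (simp add: vec_eq_iff column_def)
qed

text \<open>The images of the axes are moved back one at a time by quasi-reflections that leave
  alone the axes already fixed, so every unitary matrix is a product of quasi-reflections.\<close>

lemma unitary_qrefl_induct [consumes 1, case_names one step]:
  fixes A :: "complex^'n^'n"
  assumes "unitary_matrix A"
    and one: "P (mat 1)"
    and step: "\<And>A x c. unitary_matrix A \<Longrightarrow> P A \<Longrightarrow> norm x = 1 \<Longrightarrow> cmod c = 1 \<Longrightarrow> P (qrefl x c ** A)"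
  shows "P A"
proof -
  \<comment> \<open>\<open>S\<close> contains the axes that may still be moved: the empty set forces
    the identity, and \<open>UNIV\<close> imposes no condition.\<close>
  have "\<forall>A. unitary_matrix A \<and> (\<forall>k. k \<notin> S \<longrightarrow> A *v axis k 1 = axis k 1) \<longrightarrow> P A" if "finite S" for S :: "'n set"
    using that
  proof (induction S)
    case empty
    have "A = mat 1" if "\<forall>k. A *v axis k 1 = axis k 1" for A :: "complex^'n^'n"
      using that by (intro matrix_eq_axis) simp
    then show ?case using one by auto
  next
    case (insert j S)
    show ?case
    proof (intro allI impI, elim conjE)
      fix A :: "complex^'n^'n"
      assume A: "unitary_matrix A" and fixed: "\<forall>k. k \<notin> insert j S \<longrightarrow> A *v axis k 1 = axis k 1"
      obtain x c where xc: "norm x = 1" "cmod c = 1" "qrefl x c *v (A *v axis j 1) = axis j 1"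
        "\<And>v. herm v (A *v axis j 1 - axis j 1) = 0 \<Longrightarrow> qrefl x c *v v = v"
        using unitary_move[of "A *v axis j 1" "axis j 1"] A by (auto simp: unitary_norm)
      let ?B = "qrefl x c ** A"
      have "?B *v axis k 1 = axis k 1" if "k \<notin> S" for k
      proof (cases "k = j")
        case True
        then show ?thesis using xc(3) by (simp add: matrix_vector_mul_assoc)
      next
        case False
        then have Ak: "A *v axis k 1 = axis k 1"
          using fixed that by auto
        \<comment> \<open>An axis fixed by \<open>A\<close> is orthogonal to \<open>axis j 1\<close>
          and to its image, hence to the vector along which the quasi-reflection acts.\<close>
        have "herm (axis k 1) (A *v axis j 1) = herm (A *v axis k 1) (A *v axis j 1)"
          by (simp add: Ak)
        also have "\<dots> = 0"
          using A False by (simp add: unitary_herm herm_axis_axis)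
        finally have "herm (axis k 1) (A *v axis j 1 - axis j 1) = 0"
          using False by (simp add: herm_diff_right herm_axis_axis)
        then show ?thesis
          using Ak xc(4) by (simp flip: matrix_vector_mul_assoc)
      qed
      moreover have B: "unitary_matrix ?B"
        using A xc by (intro unitary_matrix_mult unitary_qrefl)
      ultimately have "P ?B"
        using insert.IH by blast
      then have "P (qrefl x (cnj c) ** ?B)"
        using step[OF B _ xc(1), of "cnj c"] xc(2) by simp
      then show "P A"
        using xc by (simp add: matrix_mul_assoc qrefl_mult mult_cnj_unit)
    qed
  qed
  from this[of UNIV] show ?thesis
    using assms(1) by simp
qed

lemma unitary_transitive:
  fixes x y :: "complex^'n"
  assumes "norm x = norm y"
  obtains A where "unitary_matrix A" "A *v x = y"
  using unitary_move[OF assms] unitary_qrefl by metis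

text \<open>After \<open>x\<close> has been moved to \<open>x'\<close>, a phase on the second vector
  makes the inner products with \<open>x'\<close> equal. The remaining difference is orthogonal to
  \<open>x'\<close>, so the quasi-reflection that removes it fixes \<open>x'\<close>.\<close>

lemma unitary_transitive2:
  fixes x y x' y' :: "complex^'n"
  assumes n: "norm x = norm x'" "norm y = norm y'" and eq: "cmod (herm x y) = cmod (herm x' y')"
  obtains A where "unitary_matrix A" "outer (A *v x) = outer x'" "outer (A *v y) = outer y'"
proof -
  obtain M where M: "unitary_matrix M" "M *v x = x'"
    using unitary_transitive[OF n(1)] by blast
  let ?y = "M *v y"
  have "cmod (herm x' ?y) = cmod (herm x' y')"
    using M eq by (metis unitary_herm)
  then obtain c where c: "cmod c = 1" "herm x' (c *s ?y) = herm x' y'"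
  proof (cases "herm x' ?y = 0")
    case True
    then show ?thesis using that[of 1] \<open>cmod (herm x' ?y) = cmod (herm x' y')\<close> by simp
  next
    case False
    then show ?thesis
      using that[of "cnj (herm x' y' / herm x' ?y)"] \<open>cmod (herm x' ?y) = cmod (herm x' y')\<close>
      by (cases "herm x' y' = 0") (simp_all add: herm_linear norm_divide)
  qed
  have "norm (c *s ?y) = norm y'"
    using c M n by (simp add: norm_cscale unitary_norm)
  then obtain z d where zd: "norm z = 1" "cmod d = 1" "qrefl z d *v (c *s ?y) = y'"
    "\<And>v. herm v (c *s ?y - y') = 0 \<Longrightarrow> qrefl z d *v v = v"
    using unitary_move by metis
  have "qrefl z d *v x' = x'"
    using c by (intro zd(4)) (simp add: herm_diff_right)
  moreover have "outer (qrefl z d *v ?y) = outer y'"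
    using zd(3) outer_scale[OF c(1), of "qrefl z d *v ?y"] by (simp add: vector_scalar_commute)
  ultimately show ?thesis
    using that[of "qrefl z d ** M"] M zd(1,2)
    by (simp add: unitary_matrix_mult unitary_qrefl flip: matrix_vector_mul_assoc)
qed

text \<open>Unitary conjugation moves \<open>x\<close> to a coordinate axis, where the matrix is
  diagonal.\<close>

lemma det_qrefl:
  fixes x :: "complex^'n"
  assumes "norm x = 1"
  shows "det (qrefl x c) = c"
proof -
  define k :: 'n where "k = undefined"
  obtain T where T: "unitary_matrix T" "T *v axis k 1 = x"
    using unitary_transitive[of "axis k 1" x] assms by auto
  have "det (qrefl x c) = det (T ** qrefl (axis k 1) c ** conj_transpose T)"
    using T by (simp add: qrefl_unitary_conj)
  also have "\<dots> = det (qrefl (axis k 1 :: complex^'n) c) * det (conj_transpose T ** T)"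
    by (simp add: det_mul)
  also have "\<dots> = det (qrefl (axis k 1 :: complex^'n) c)"
    using T by (simp add: unitary_left)
  also have "\<dots> = (\<Prod>i\<in>UNIV. qrefl (axis k 1 :: complex^'n) c $ i $ i)"
    by (rule det_diagonal) (auto simp: qrefl_def scale_nth outer_nth mat_def axis_def)
  also have "\<dots> = (\<Prod>i\<in>UNIV. if i = k then c else 1)"
    by (rule prod.cong) (auto simp: qrefl_def scale_nth outer_nth mat_def axis_def)
  also have "\<dots> = c"
    by simp
  finally show ?thesis .
qed

section \<open>Recognizing scalar and zero matrices\<close>

text \<open>Commuting with the reflection in \<open>x\<close> forces \<open>A *v x\<close> into the
  (-1)-eigenspace of that reflection, the line of \<open>x\<close>.\<close>

lemma commutes_with_unitary_imp_scalar:
  fixes A :: "complex^'n^'n"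
  assumes "\<And>B. unitary_matrix B \<Longrightarrow> A ** B = B ** A"
  obtains c where "A = c *\<^sub>M mat 1"
proof (rule eigenvectors_imp_scalar[of A])
  fix x :: "complex^'n" assume x: "norm x = 1"
  have "A *v (qrefl x (-1) *v x) = qrefl x (-1) *v (A *v x)"
    using assms[OF unitary_qrefl[OF x, of "-1"]] by (simp add: matrix_vector_mul_assoc)
  then have "2 *s (A *v x) = 2 *s (herm (A *v x) x *s x)"
    using x by (simp add: qrefl_mult_vec vector_scalar_commute matrix_vector_right_distrib vec_eq_iff algebra_simps)
  then have "A *v x = herm (A *v x) x *s x"
    by (simp only: vector_mul_lcancel) simp
  then show "\<exists>c. A *v x = c *s x" by blast
qed blast

text \<open>Polarization: the vectors \<open>x + y\<close> and \<open>x + \<i> *s y\<close> show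
  that the sum and the difference of \<open>herm (M *v x) y\<close> and
  \<open>herm (M *v y) x\<close> vanish.\<close>

lemma quadratic_form_zero:
  fixes M :: "complex^'n^'n"
  assumes q: "\<And>x. norm x = 1 \<Longrightarrow> herm (M *v x) x = 0"
  shows "M = 0"
proof -
  have q': "herm (M *v x) x = 0" for x
  proof (cases "x = 0")
    case False
    then obtain d where d: "d \<noteq> 0" "norm (d *s x) = 1"
      by (rule exists_unit_multiple)
    then show ?thesis
      using q[OF d(2)] by (simp add: vector_scalar_commute herm_linear)
  qed simp
  have "herm (M *v x) y = 0" for x y
  proof -
    have "herm (M *v x) y + herm (M *v y) x = 0"
      using q'[of "x + y"] q'[of x] q'[of y] by (simp add: matrix_vector_right_distrib herm_linear add.commute)
    moreover have "- \<i> * herm (M *v x) y + \<i> * herm (M *v y) x = 0"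
      using q'[of "x + \<i> *s y"] q'[of x] q'[of y]
      by (simp add: matrix_vector_right_distrib vector_scalar_commute herm_linear)
    then have "\<i> * (herm (M *v y) x - herm (M *v x) y) = 0"
      by (simp add: algebra_simps)
    ultimately show ?thesis
      by (simp add: mult_eq_0_iff)
  qed
  then have "M *v x = 0" for x
    using herm_self_eq_0 by blast
  then show ?thesis
    by (simp add: matrix_eq)
qed

section \<open>A functional equation\<close>

text \<open>For \<open>w = u + v\<close> the numbers \<open>u / w\<close> and \<open>v / w\<close>
  sum to 1, so \<open>mult\<close> and \<open>refl\<close> give additivity. With nonnegativity this
  yields monotonicity, the values at fractions, and then all values by squeezing.\<close>

lemma multiplicative_reflecting_eq_id:
  fixes Q :: "real \<Rightarrow> real"
  assumes nonneg: "\<And>p. 0 \<le> p \<Longrightarrow> p \<le> 1 \<Longrightarrow> 0 \<le> Q p"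
    and mult: "\<And>p q. 0 \<le> p \<Longrightarrow> p \<le> 1 \<Longrightarrow> 0 \<le> q \<Longrightarrow> q \<le> 1 \<Longrightarrow> Q (p * q) = Q p * Q q"
    and refl: "\<And>p. 0 \<le> p \<Longrightarrow> p \<le> 1 \<Longrightarrow> Q (1 - p) = 1 - Q p"
    and p: "0 \<le> p" "p \<le> 1"
  shows "Q p = p"
proof -
  have Q0: "Q 0 = 0"
  proof (rule ccontr)
    assume "Q 0 \<noteq> 0"
    then have "Q 1 = 1" "Q 0 = 1"
      using mult[of 0 1] mult[of 0 0] by auto
    with refl[of 0] show False by simp
  qed
  have Q1: "Q 1 = 1"
    using refl[of 0] Q0 by simp
  have add: "Q (u + v) = Q u + Q v" if "0 \<le> u" "0 \<le> v" "u + v \<le> 1" for u v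
  proof (cases "u + v = 0")
    case True
    then have "u = 0" "v = 0" using that by auto
    then show ?thesis using Q0 by simp
  next
    case False
    define w where "w = u + v"
    have w: "0 < w" "w \<le> 1"
      using that False by (auto simp: w_def)
    have "Q u = Q w * Q (u / w)"
      using mult[of w "u / w"] that w by (simp add: w_def)
    moreover have "Q v = Q w * Q (1 - u / w)"
    proof -
      have "1 - u / w = v / w" "v = w * (v / w)"
        using w by (simp_all add: w_def field_simps)
      then show ?thesis
        using mult[of w "v / w"] that w by (simp add: w_def)
    qed
    moreover have "Q (1 - u / w) = 1 - Q (u / w)"
      using that w by (intro refl) (auto simp: w_def)
    ultimately have "Q u + Q v = Q w * (Q (u / w) + (1 - Q (u / w)))"
      by (simp only: distrib_left)
    then show ?thesis
      by (simp add: w_def)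
  qed
  have mono: "Q u \<le> Q v" if "0 \<le> u" "u \<le> v" "v \<le> 1" for u v
    using add[of u "v - u"] nonneg[of "v - u"] that by auto
  have nat_mult: "Q (real k * u) = real k * Q u" if "0 \<le> u" "real k * u \<le> 1" for k u
    using that(2)
  proof (induction k)
    case 0
    then show ?case by (simp add: Q0)
  next
    case (Suc k)
    then have "real k * u \<le> 1"
      using that(1) by (simp add: algebra_simps)
    then show ?case
      using Suc add[of "real k * u" u] that(1) by (simp add: algebra_simps)
  qed
  have frac: "Q (real k / real m) = real k / real m" if "k \<le> m" "m > 0" for k m
  proof -
    have "Q (1 / real m) = 1 / real m"
      using nat_mult[of "1 / real m" m] that Q1 by (simp add: field_simps)
    then show ?thesis
      using nat_mult[of "1 / real m" k] that by simp
  qed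
  \<comment> \<open>Squeezing between \<open>k / m\<close> and \<open>(k + 1) / m\<close>; the case
    \<open>p = 1\<close> is apart because \<open>k + 1\<close> has to stay at most
    \<open>m\<close>.\<close>
  have close: "\<bar>Q p - p\<bar> \<le> 1 / real m" if m: "m > 0" for m
  proof (cases "p = 1")
    case True
    then show ?thesis using Q1 by simp
  next
    case False
    define k where "k = nat \<lfloor>p * real m\<rfloor>"
    have k: "real k \<le> p * real m" "p * real m < real k + 1"
      using p by (simp_all add: k_def)
    have "p * real m < real m"
      using False p m by simp
    then have km: "k < m" using k by linarith
    have lo: "real k / real m \<le> p" and hi: "p \<le> real (Suc k) / real m"
      using k m by (simp_all add: field_simps)
    have "real k / real m \<le> Q p"
      using mono[OF _ lo] p frac[of k m] km m by simp
    moreover have "Q p \<le> real (Suc k) / real m"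
      using mono[OF p(1) hi] frac[of "Suc k" m] km m by simp
    ultimately show ?thesis
      using lo hi by (simp add: add_divide_distrib abs_le_iff)
  qed
  show ?thesis
  proof (rule ccontr)
    assume "Q p \<noteq> p"
    then obtain m where "m > 0" "1 / real m < \<bar>Q p - p\<bar>"
      by (metis nat_approx_posE zero_less_Suc zero_less_abs_iff right_minus_eq of_nat_Suc)
    with close show False by (metis linorder_not_le)
  qed
qed

section \<open>Wigner's theorem\<close>

lemma unitary_of_columns:
  fixes A :: "complex^'n^'n"
  assumes "\<And>i j. herm (A *v axis i 1) (A *v axis j 1) = (if i = j then 1 else 0)"
  shows "unitary_matrix A"
proof -
  have "(conj_transpose A ** A) *v axis i 1 = mat 1 *v axis i 1" for i
  proof -
    have "((conj_transpose A ** A) *v axis i 1) $ j = axis i 1 $ j" for j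
    proof -
      have "((conj_transpose A ** A) *v axis i 1) $ j = herm (conj_transpose A *v (A *v axis i 1)) (axis j 1)"
        by (simp only: herm_axis_right matrix_vector_mul_assoc)
      also have "\<dots> = (if i = j then 1 else 0)"
        using assms[of i j] by (simp add: herm_adjoint)
      finally show ?thesis
        by (auto simp: axis_def)
    qed
    then show ?thesis
      by (simp add: vec_eq_iff)
  qed
  then have "conj_transpose A ** A = mat 1"
    by (rule matrix_eq_axis)
  then show ?thesis
    by (simp add: unitary_matrix_def matrix_left_right_inverse)
qed

text \<open>The squared modulus of \<open>1 + a\<close> is 1 + 2 Re a plus that of \<open>a\<close>.
  Two moduli thus determine a coordinate up to conjugation.\<close>

lemma Re_eq_of_cmod_eq:
  assumes "cmod a = cmod b" "cmod (1 + a) = cmod (1 + b)"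
  shows "Re a = Re b"
proof -
  have "(cmod a)\<^sup>2 = (cmod b)\<^sup>2" "(cmod (1 + a))\<^sup>2 = (cmod (1 + b))\<^sup>2"
    using assms by simp_all
  then show ?thesis
    unfolding cmod_power2 by (simp add: power2_eq_square algebra_simps)
qed

text \<open>The normalized situation of Wigner's theorem. Fixing the axes determines the moduli of
  the coordinates; fixing the sums with the reference axis \<open>m\<close> determines their real
  parts once coordinate \<open>m\<close> is scaled to 1.\<close>

locale wigner_frame =
  fixes h :: "complex^'n \<Rightarrow> complex^'n" and m :: 'n
  assumes pres: "\<And>x y. cmod (herm (h x) (h y)) = cmod (herm x y)"
    and ax: "\<And>k. outer (h (axis k 1)) = outer (axis k 1)"
    and sm: "\<And>k. k \<noteq> m \<Longrightarrow> outer (h (axis m 1 + axis k 1)) = outer (axis m 1 + axis k 1)"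
begin

lemma norm_h: "norm (h x) = norm x"
  using pres[of x x] by (simp add: herm_same norm_power)

lemma cmod_herm_fixed: "outer (h y) = outer y \<Longrightarrow> cmod (herm (h x) y) = cmod (herm x y)"
  using outer_eq_cmod_herm[of "h y" y] pres by metis

text \<open>The image is divided by the phase of its coordinate \<open>m\<close>. Testing against
  the axes gives the moduli of the other coordinates and testing against
  \<open>axis m 1 + axis k 1\<close> their real parts, so only the signs of the imaginary parts stay
  open.\<close>

lemma normal_form:
  assumes x: "x $ m = 1"
  obtains y where "outer y = outer (h x)" "y $ m = 1" "\<And>k. Re (y $ k) = Re (x $ k)"
    "\<And>k. (Im (y $ k))\<^sup>2 = (Im (x $ k))\<^sup>2" "\<And>z. outer (h z) = outer z \<Longrightarrow> cmod (herm y z) = cmod (herm x z)"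
proof -
  have hm: "cmod (h x $ m) = 1"
    using cmod_herm_fixed[OF ax[of m], of x] x by (simp add: herm_axis_right)
  define y where "y = cnj (h x $ m) *s h x"
  have y: "outer y = outer (h x)"
    using hm by (simp add: y_def outer_scale)
  have ym: "y $ m = 1"
    using hm by (simp add: y_def mult_cnj_unit)
  have fy: "cmod (herm y z) = cmod (herm x z)" if "outer (h z) = outer z" for z
    using cmod_herm_fixed[OF that] hm by (simp add: y_def herm_linear norm_mult)
  have ck: "cmod (y $ k) = cmod (x $ k)" for k
    using fy[OF ax[of k]] by (simp add: herm_axis_right)
  have Re: "Re (y $ k) = Re (x $ k)" for k
  proof (cases "k = m")
    case False
    then have "cmod (1 + y $ k) = cmod (1 + x $ k)"
      using fy[OF sm[of k]] x ym by (simp add: herm_add_right herm_axis_right)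
    then show ?thesis
      using ck Re_eq_of_cmod_eq by blast
  qed (simp add: x ym)
  have "(Im (y $ k))\<^sup>2 = (Im (x $ k))\<^sup>2" for k
    using arg_cong[OF ck[of k], of "\<lambda>t. t\<^sup>2"] Re[of k] by (simp add: cmod_power2)
  then show ?thesis
    using that y ym fy Re by blast
qed
lemma fixes_real:
  assumes x: "x $ m = 1" and re: "\<And>k. Im (x $ k) = 0"
  shows "outer (h x) = outer x"
proof (rule normal_form[OF x])
  fix y
  assume y: "outer y = outer (h x)" "\<And>k. Re (y $ k) = Re (x $ k)" "\<And>k. (Im (y $ k))\<^sup>2 = (Im (x $ k))\<^sup>2"
  have "y = x"
    using y(2,3) re by (simp add: vec_eq_iff complex_eq_iff)
  then show ?thesis using y(1) by simp
qed
text \<open>Products of two imaginary parts are preserved, so the signs are either all kept or all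
  reversed.\<close>

lemma fixes_or_conjugates:
  assumes x: "x $ m = 1"
  shows "outer (h x) = outer x \<or> outer (h x) = outer (cnj_vec x)"
proof (rule normal_form[OF x])
  fix y
  assume y: "outer y = outer (h x)" "y $ m = 1" "\<And>k. Re (y $ k) = Re (x $ k)"
      "\<And>k. (Im (y $ k))\<^sup>2 = (Im (x $ k))\<^sup>2"
    and fy: "\<And>z. outer (h z) = outer z \<Longrightarrow> cmod (herm y z) = cmod (herm x z)"
  have prod: "Im (y $ j) * Im (y $ k) = Im (x $ j) * Im (x $ k)" for j k
  proof (cases "j = m \<or> k = m \<or> j = k")
    case True
    then show ?thesis
      using x y(2) y(4)[of j] by (auto simp: power2_eq_square)
  next
    case False
    \<comment> \<open>This real vector is fixed and may serve as a further test vector; it ties the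
      signs at \<open>j\<close> and \<open>k\<close> together.\<close>
    let ?s = "axis m 1 + axis j 1 + axis k 1 :: complex^'n"
    have "outer (h ?s) = outer ?s"
      using False by (intro fixes_real) (auto simp: axis_def)
    then have "cmod (1 + y $ j + y $ k) = cmod (1 + x $ j + x $ k)"
      using fy[of "axis m 1 + axis j 1 + axis k 1"] x y(2) by (simp only: herm_add_right herm_axis_right)
    then have "(cmod (1 + y $ j + y $ k))\<^sup>2 = (cmod (1 + x $ j + x $ k))\<^sup>2"
      by simp
    then have "(Im (y $ j) + Im (y $ k))\<^sup>2 = (Im (x $ j) + Im (x $ k))\<^sup>2"
      using y(3) by (simp add: cmod_power2)
    then show ?thesis
      using y(4)[of j] y(4)[of k] by (simp add: power2_sum)
  qed
  show ?thesis
  proof (cases "\<forall>k. Im (x $ k) = 0")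
    case True
    then show ?thesis using fixes_real[OF x] by blast
  next
    case False
    then obtain j where j: "Im (x $ j) \<noteq> 0" by blast
    have "Im (y $ j) = Im (x $ j) \<or> Im (y $ j) = - Im (x $ j)"
      using y(4)[of j] by (simp add: power2_eq_iff)
    then show ?thesis
    proof
      assume "Im (y $ j) = Im (x $ j)"
      then have "Im (y $ k) = Im (x $ k)" for k
        using prod[of j k] j by simp
      then have "y = x"
        using y(3) by (simp add: vec_eq_iff complex_eq_iff)
      then show ?thesis using y(1) by simp
    next
      assume yj: "Im (y $ j) = - Im (x $ j)"
      have "Im (y $ k) = - Im (x $ k)" for k
      proof -
        have "Im (x $ j) * (Im (y $ k) + Im (x $ k)) = 0"
          using prod[of j k] yj by (simp add: algebra_simps)
        then show ?thesis using j by simp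
      qed
      then have "y = cnj_vec x"
        using y(3) by (simp add: vec_eq_iff complex_eq_iff)
      then show ?thesis using y(1) by simp
    qed
  qed
qed

text \<open>The vector \<open>axis m 1 + \<i> *s axis p 1\<close> distinguishes the identity from
  conjugation, and its behaviour propagates to all vectors through further test vectors.\<close>

lemma fixes_all:
  assumes pm: "p \<noteq> m" and w: "outer (h (axis m 1 + \<i> *s axis p 1)) = outer (axis m 1 + \<i> *s axis p 1)"
  shows "outer (h x) = outer x"
proof -
  \<comment> \<open>If \<open>x\<close> is conjugated, both \<open>x\<close> and its conjugate have
    the same modulus of inner product with the fixed test vector, which forces this linear condition
    on imaginary parts.\<close>
  have swap: "Im (c * (x $ p) + d * x $ k) = 0"
    if "outer (h x) = outer (cnj_vec x)" "x $ m = 1" "c \<in> \<real>" "d \<in> \<real>"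
      "outer (h (axis m 1 + (c * \<i>) *s axis p 1 + (d * \<i>) *s axis k 1)) = outer (axis m 1 + (c * \<i>) *s axis p 1 + (d * \<i>) *s axis k 1)"
    for x c d k
  proof -
    let ?v = "axis m 1 + (c * \<i>) *s axis p 1 + (d * \<i>) *s axis k 1 :: complex^'n"
    have "cmod (herm (cnj_vec x) ?v) = cmod (herm x ?v)"
      using cmod_herm_fixed[OF that(5), of x] that(1) by (metis outer_eq_cmod_herm2)
    then have "cmod (1 - \<i> * cnj (c * x $ p + d * x $ k)) = cmod (1 - \<i> * (c * x $ p + d * x $ k))"
      using that(2-4) by (simp add: herm_linear herm_axis_right Reals_cnj_iff algebra_simps)
    then have "(cmod (1 - \<i> * cnj (c * x $ p + d * x $ k)))\<^sup>2 = (cmod (1 - \<i> * (c * x $ p + d * x $ k)))\<^sup>2"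
      by simp
    then show ?thesis
      unfolding cmod_power2 by (simp add: power2_eq_square algebra_simps)
  qed
  have 1: "outer (h x) = outer x" if x: "x $ m = 1" "Im (x $ p) \<noteq> 0" for x
  proof (rule ccontr)
    assume "outer (h x) \<noteq> outer x"
    then have "outer (h x) = outer (cnj_vec x)"
      using fixes_or_conjugates[OF x(1)] by blast
    from swap[OF this x(1), of 1 0] w x(2) show False by simp
  qed
  \<comment> \<open>If \<open>Im (x $ p) = 0\<close>, the test vector with \<open>\<i>\<close> at
    both \<open>p\<close> and \<open>k\<close> is fixed by the previous case and detects
    \<open>Im (x $ k)\<close>.\<close>
  have 2: "outer (h x) = outer x" if x: "x $ m = 1" for x
  proof (rule ccontr)
    assume ne: "outer (h x) \<noteq> outer x"
    then have c: "outer (h x) = outer (cnj_vec x)"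
      using fixes_or_conjugates[OF x(1)] by blast
    have p0: "Im (x $ p) = 0"
      using 1[OF x] ne by blast
    have "Im (x $ k) = 0" for k
    proof (cases "k = m \<or> k = p")
      case True
      then show ?thesis using x p0 by auto
    next
      case False
      have "outer (h (axis m 1 + (1 * \<i>) *s axis p 1 + (1 * \<i>) *s axis k 1)) = outer (axis m 1 + (1 * \<i>) *s axis p 1 + (1 * \<i>) *s axis k 1)"
        using False pm by (intro 1) (auto simp: axis_def)
      from swap[OF c x _ _ this] show ?thesis
        using p0 by simp
    qed
    with fixes_real[OF x] ne show False by blast
  qed
  \<comment> \<open>Homogeneity up to a phase reduces a nonzero coordinate \<open>m\<close> to the
    value 1.\<close>
  have par: "outer (h (c *s x)) = outer (c *s h x)" for c x
  proof (rule outer_eq_parallel)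
    show "norm (h (c *s x)) = norm (c *s h x)"
      by (simp add: norm_h norm_cscale)
    show "cmod (herm (h (c *s x)) (c *s h x)) = (norm (c *s h x))\<^sup>2"
      by (simp add: herm_linear norm_mult pres norm_cscale norm_h herm_same norm_power power_mult_distrib)
         (simp add: power2_eq_square)
  qed
  show ?thesis
  proof (cases "x $ m = 0")
    case False
    define x' where "x' = inverse (x $ m) *s x"
    have x: "x = x $ m *s x'"
      using False by (simp add: x'_def vector_smult_assoc)
    have "outer (h x') = outer x'"
      using False by (intro 2) (simp add: x'_def)
    then have "outer (x $ m *s h x') = outer (x $ m *s x')"
      by (rule outer_cscale_cong)
    then show ?thesis
      using par[of "x $ m" x'] x by simp
  next
    case True
    \<comment> \<open>Adding \<open>axis m 1\<close> gives a vector already known to be fixed; the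
      summand drops out of the inner products because \<open>h x\<close> and \<open>x\<close> are
      orthogonal to that axis.\<close>
    let ?y = "axis m 1 + x"
    have "outer (h ?y) = outer ?y"
      using True by (intro 2) (simp add: axis_def)
    then have "cmod (herm (h x) ?y) = cmod (herm x ?y)"
      using cmod_herm_fixed by blast
    moreover have "h x $ m = 0"
      using cmod_herm_fixed[OF ax[of m], of x] True by (simp add: herm_axis_right)
    ultimately have "cmod (herm (h x) x) = cmod (herm x x)"
      using True by (simp add: herm_add_right herm_axis_right)
    then show ?thesis
      by (intro outer_eq_parallel) (simp_all add: norm_h herm_same norm_power)
  qed
qed

end

text \<open>If the test vector is conjugated rather than fixed, \<open>h\<close> followed by
  conjugation is again normalized and fixes it.\<close>

lemma wigner_normalized:
  assumes "wigner_frame h m" and pm: "p \<noteq> m"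
  shows "(\<forall>x. outer (h x) = outer x) \<or> (\<forall>x. outer (h x) = outer (cnj_vec x))"
proof -
  interpret wigner_frame h m by fact
  let ?w = "axis m 1 + \<i> *s axis p 1"
  have "?w $ m = 1"
    using pm by (simp add: axis_def)
  then consider "outer (h ?w) = outer ?w" | "outer (h ?w) = outer (cnj_vec ?w)"
    using fixes_or_conjugates by blast
  then show ?thesis
  proof cases
    case 1
    then show ?thesis using fixes_all[OF pm] by blast
  next
    case w: 2
    have axc: "cnj_vec (axis k 1) = axis k 1" for k :: 'a
      by (simp add: vec_eq_iff axis_def)
    have addc: "cnj_vec (x + y) = cnj_vec x + cnj_vec y" for x y :: "complex^'a"
      by (simp add: vec_eq_iff)
    interpret c: wigner_frame "\<lambda>x. cnj_vec (h x)" m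
    proof
      show "cmod (herm (cnj_vec (h x)) (cnj_vec (h y))) = cmod (herm x y)" for x y
        by (simp add: herm_cnj_vec pres)
      show "outer (cnj_vec (h (axis k 1))) = outer (axis k 1)" for k
        using outer_cnj_vec_cong[OF ax] by (simp add: axc)
      show "outer (cnj_vec (h (axis m 1 + axis k 1))) = outer (axis m 1 + axis k 1)" if "k \<noteq> m" for k
        using outer_cnj_vec_cong[OF sm[OF that]] by (simp add: axc addc)
    qed
    have "outer (cnj_vec (h ?w)) = outer ?w"
      using outer_cnj_vec_cong[OF w] by simp
    then have "outer (cnj_vec (h x)) = outer x" for x
      by (rule c.fixes_all[OF pm])
    then have "outer (h x) = outer (cnj_vec x)" for x
      using outer_cnj_vec_cong by fastforce
    then show ?thesis by blast
  qed
qed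

lemma wigner:
  fixes h :: "complex^'n \<Rightarrow> complex^'n"
  assumes n: "CARD('n) \<ge> 2"
    and pres: "\<And>x y. cmod (herm (h x) (h y)) = cmod (herm x y)"
  obtains T where "unitary_matrix T"
    "(\<forall>x. outer (h x) = outer (T *v x)) \<or> (\<forall>x. outer (h x) = outer (T *v cnj_vec x))"
proof -
  define m :: 'n where "m = undefined"
  have "UNIV \<noteq> {m}"
    using n by (metis card.empty card.insert finite.emptyI empty_iff not_less_eq_eq numeral_2_eq_2 le_refl One_nat_def)
  then obtain p where pm: "p \<noteq> m" by auto
  \<comment> \<open>The columns are the images of the axes, so \<open>T0\<close> normalizes the
    axes; their relative phases remain to be adjusted.\<close>
  define T0 :: "complex^'n^'n" where "T0 = (\<chi> i j. h (axis j 1) $ i)"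
  have T0ax: "T0 *v axis k 1 = h (axis k 1)" for k
    by (simp add: matrix_vector_mult_axis T0_def column_def)
  have norm_h: "norm (h x) = norm x" for x
    using pres[of x x] by (simp add: herm_same norm_power)
  have T0: "unitary_matrix T0"
  proof (rule unitary_of_columns)
    fix i j
    show "herm (T0 *v axis i 1) (T0 *v axis j 1) = (if i = j then 1 else 0)"
      using pres[of "axis i 1" "axis j 1"] by (auto simp: T0ax norm_h herm_axis_axis)
  qed
  define z where "z k = conj_transpose T0 *v h (axis m 1 + axis k 1)" for k
  have cz: "cmod (z k $ j) = cmod ((axis m 1 + axis k 1) $ j)" for k j
  proof -
    have "z k $ j = herm (h (axis m 1 + axis k 1)) (h (axis j 1))"
      by (simp add: z_def herm_adjoint T0ax flip: herm_axis_right)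
    then show ?thesis
      by (simp add: pres) (simp add: herm_axis_right)
  qed
  \<comment> \<open>By \<open>cz\<close> the vector \<open>z k\<close> is supported on
    \<open>m\<close> and \<open>k\<close>, with entries of modulus one for
    \<open>k \<noteq> m\<close>. Their relative phase goes into the diagonal matrix
    \<open>D\<close>, so that the sums with \<open>axis m 1\<close> are fixed as well.\<close>
  define d where "d k = (if k = m then 1 else z k $ k / z k $ m)" for k
  have zz: "cmod (z k $ m) = 1" "cmod (z k $ k) = 1" if "k \<noteq> m" for k
    using that by (auto simp: cz axis_def)
  have d: "cmod (d k) = 1" for k
    using zz[of k] by (simp add: d_def norm_divide)
  define D :: "complex^'n^'n" where "D = (\<chi> i j. if i = j then d j else 0)"
  have Dax: "D *v axis k 1 = d k *s axis k 1" for k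
    by (simp only: matrix_vector_mult_axis) (auto simp: D_def column_def vec_eq_iff axis_def)
  have D: "unitary_matrix D"
  proof (rule unitary_of_columns)
    fix i j
    show "herm (D *v axis i 1) (D *v axis j 1) = (if i = j then 1 else 0)"
      using mult_cnj_unit[OF d[of i]] by (auto simp: Dax herm_linear herm_axis_axis mult.commute)
  qed
  define T where "T = T0 ** D"
  have T: "unitary_matrix T"
    by (simp add: T_def T0 D unitary_matrix_mult)
  have cancel: "conj_transpose T *v (T *v x) = x" for x
    by (simp add: T unitary_cancel_left)
  have "(\<forall>x. outer (conj_transpose T *v h x) = outer x) \<or> (\<forall>x. outer (conj_transpose T *v h x) = outer (cnj_vec x))"
  proof (rule wigner_normalized[OF wigner_frame.intro pm])
    show "cmod (herm (conj_transpose T *v h x) (conj_transpose T *v h y)) = cmod (herm x y)" for x y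
      by (simp add: unitary_herm unitary_conj_transpose T pres)
    show "outer (conj_transpose T *v h (axis k 1)) = outer (axis k 1)" for k
    proof -
      have "h (axis k 1) = T *v (cnj (d k) *s axis k 1)"
        by (simp add: T_def vector_scalar_commute Dax T0ax vector_smult_assoc mult_cnj_unit d
            flip: matrix_vector_mul_assoc)
      then show ?thesis
        by (simp add: cancel outer_scale d)
    qed
    show "outer (conj_transpose T *v h (axis m 1 + axis k 1)) = outer (axis m 1 + axis k 1)" if k: "k \<noteq> m" for k
    proof -
      have "z k = z k $ m *s (axis m 1 + d k *s axis k 1)"
      proof -
        have "z k $ j = (z k $ m *s (axis m 1 + d k *s axis k 1)) $ j" for j
          using cz[of k j] k zz[OF k] by (auto simp: axis_def d_def)
        then show ?thesis by (subst vec_eq_iff) blast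
      qed
      moreover have "D *v (z k $ m *s (axis m 1 + axis k 1)) = z k $ m *s (axis m 1 + d k *s axis k 1)"
        by (simp add: vector_scalar_commute matrix_vector_right_distrib Dax d_def)
      ultimately have "z k = D *v (z k $ m *s (axis m 1 + axis k 1))"
        by (simp only:)
      then have "T0 *v z k = T *v (z k $ m *s (axis m 1 + axis k 1))"
        unfolding T_def matrix_vector_mul_assoc[symmetric] by (rule arg_cong)
      moreover have "T0 *v z k = h (axis m 1 + axis k 1)"
        by (simp add: z_def unitary_cancel_right T0)
      ultimately have "conj_transpose T *v h (axis m 1 + axis k 1) = z k $ m *s (axis m 1 + axis k 1)"
        by (metis cancel)
      then show ?thesis
        using zz[OF k] by (simp only: outer_scale)
    qed
  qed
  moreover have "outer (h x) = outer (T *v y)" if "outer (conj_transpose T *v h x) = outer y" for x y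
    using outer_mult_vec_cong[OF that, of T] by (simp add: unitary_cancel_right T)
  ultimately show ?thesis
    using that T by blast
qed

lemma wigner_unit:
  fixes h :: "complex^'n \<Rightarrow> complex^'n"
  assumes n: "CARD('n) \<ge> 2"
    and pres: "\<And>x y. norm x = 1 \<Longrightarrow> norm y = 1 \<Longrightarrow> cmod (herm (h x) (h y)) = cmod (herm x y)"
  obtains T where "unitary_matrix T"
    "(\<forall>x. norm x = 1 \<longrightarrow> outer (h x) = outer (T *v x)) \<or>
     (\<forall>x. norm x = 1 \<longrightarrow> outer (h x) = outer (T *v cnj_vec x))"
proof -
  \<comment> \<open>The positively homogeneous extension from the unit sphere.\<close>
  define H where "H x = (if x = 0 then 0 else of_real (norm x) *s h (of_real (inverse (norm x)) *s x))" for x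
  have "cmod (herm (H x) (H y)) = cmod (herm x y)" for x y
  proof (cases "x = 0 \<or> y = 0")
    case True
    then show ?thesis by (auto simp: H_def)
  next
    case False
    then have "norm (of_real (inverse (norm x)) *s x) = 1" "norm (of_real (inverse (norm y)) *s y) = 1"
      by (simp_all add: norm_cscale norm_inverse)
    from pres[OF this] False show ?thesis
      by (simp add: H_def herm_linear norm_mult norm_divide field_simps)
  qed
  from wigner[OF n this] obtain T where T: "unitary_matrix T"
    "(\<forall>x. outer (H x) = outer (T *v x)) \<or> (\<forall>x. outer (H x) = outer (T *v cnj_vec x))"
    by blast
  moreover have "H x = h x" if "norm x = 1" for x
    using that by (auto simp: H_def)
  ultimately show ?thesis
    using that[of T] by metis
qed

section \<open>Automorphisms of the unitary group\<close>

lemma conj_transpose_outer: "conj_transpose (outer x) = outer x"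
  by (simp add: vec_eq_iff conj_transpose_def transpose_def conj_matrix_nth outer_nth mult.commute)

lemma involution_neg_eigenvector:
  fixes S :: "complex^'n^'n"
  assumes S: "S ** S = mat 1" "S \<noteq> mat 1"
  obtains u where "norm u = 1" "S *v u = - u"
proof -
  obtain w where w: "S *v w \<noteq> w"
    using S(2) by (auto simp: matrix_eq)
  let ?p = "w - S *v w"
  have Sp: "S *v ?p = - ?p"
    by (simp add: matrix_vector_mult_diff_distrib matrix_vector_mul_assoc S(1))
  have "?p \<noteq> 0" using w by simp
  then obtain c where "c \<noteq> 0" "norm (c *s ?p) = 1"
    by (rule exists_unit_multiple)
  then show ?thesis
    using that[of "c *s ?p"] Sp by (simp only: vector_scalar_commute vector_smult_rneg)
qed

lemma conj_transpose_involution: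
  assumes "unitary_matrix S" "S ** S = mat 1"
  shows "conj_transpose S = S"
proof -
  have "conj_transpose S ** (S ** S) = S"
    by (simp add: matrix_mul_assoc unitary_left[OF assms(1)])
  then show ?thesis by (simp add: assms(2))
qed

text \<open>Each \<open>w - S *v w\<close> lies in the (-1)-eigenspace, which \<open>only\<close>
  reduces to the line of \<open>u\<close>; the coefficient is \<open>2 * herm w u\<close> because
  \<open>S\<close> is Hermitian.\<close>

lemma involution_eq_qrefl:
  fixes S :: "complex^'n^'n"
  assumes S: "unitary_matrix S" "S ** S = mat 1" and u: "norm u = 1" "S *v u = - u"
    and only: "\<And>v. norm v = 1 \<Longrightarrow> herm v u = 0 \<Longrightarrow> S *v v \<noteq> - v"
  shows "S = qrefl u (-1)"
proof -
  have "S *v w = qrefl u (-1) *v w" for w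
  proof -
    define p where "p = w - S *v w"
    define q where "q = p - herm p u *s u"
    have Sp: "S *v p = - p"
      by (simp add: p_def matrix_vector_mult_diff_distrib matrix_vector_mul_assoc S(2))
    have Sq: "S *v q = - q"
      by (simp add: q_def matrix_vector_mult_diff_distrib vector_scalar_commute Sp u(2) vector_smult_rneg)
    have qu: "herm q u = 0"
      by (simp add: q_def herm_linear u(1))
    have "q = 0"
    proof (rule ccontr)
      assume "q \<noteq> 0"
      then obtain c where "c \<noteq> 0" "norm (c *s q) = 1"
        by (rule exists_unit_multiple)
      with only[of "c *s q"] qu Sq show False
        by (simp add: vector_scalar_commute herm_scale_left vector_smult_rneg)
    qed
    then have p: "p = herm p u *s u"
      by (simp add: q_def)
    have "herm (S *v w) u = herm w (S *v u)"
      by (simp add: herm_adjoint conj_transpose_involution[OF S])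
    then have "herm p u = 2 * herm w u"
      by (simp add: p_def herm_linear u(2))
    then have "w - S *v w = (2 * herm w u) *s u"
      using p by (simp add: p_def)
    then show ?thesis
      by (simp add: qrefl_mult_vec vector_smult_lneg algebra_simps)
  qed
  then show ?thesis by (simp add: matrix_eq)
qed

text \<open>Puts a product of commuting reflections into a form whose trace and adjoint can be read
  off.\<close>

lemma qrefl2_orthonormal:
  assumes "norm a = 1" "norm b = 1" "herm a b = 0"
  shows "qrefl a (-1) ** qrefl b (-1) = mat 1 - 2 *\<^sub>M (outer a + outer b)"
  using assms
  by (simp add: matrix_eq qrefl_mult_vec herm_linear outer_mult_vec scale_mult_vec herm_eq_0_commute[of a b]
      matrix_vector_mult_diff_rdistrib matrix_vector_mult_add_rdistrib vec_eq_iff algebra_simps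
      flip: matrix_vector_mul_assoc)

lemma qrefl4_orthonormal:
  assumes "norm a = 1" "norm b = 1" "norm c = 1" "norm d = 1" "herm a b = 0" "herm a c = 0"
    "herm a d = 0" "herm b c = 0" "herm b d = 0" "herm c d = 0"
  shows "qrefl a (-1) ** qrefl b (-1) ** (qrefl c (-1) ** qrefl d (-1)) =
    mat 1 - 2 *\<^sub>M (outer a + outer b + outer c + outer d)"
  unfolding qrefl2_orthonormal[OF assms(1,2,5)] qrefl2_orthonormal[OF assms(3,4,10)] using assms
  by (simp add: matrix_eq herm_linear outer_mult_vec scale_mult_vec
      herm_eq_0_commute[of a b] herm_eq_0_commute[of a c] herm_eq_0_commute[of a d]
      herm_eq_0_commute[of b c] herm_eq_0_commute[of b d] herm_eq_0_commute[of c d]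
      matrix_vector_mult_diff_rdistrib matrix_vector_mult_add_rdistrib vec_eq_iff algebra_simps
      flip: matrix_vector_mul_assoc)

lemma conj_transpose_minus: "conj_transpose (A - B) = conj_transpose A - conj_transpose B"
  and conj_transpose_plus: "conj_transpose (A + B) = conj_transpose A + conj_transpose B"
  by (simp_all add: vec_eq_iff conj_transpose_def transpose_def conj_matrix_nth)

lemma qrefl_not_scalar:
  fixes x :: "complex^'n"
  assumes "CARD('n) \<ge> 3" "norm x = 1" "c \<noteq> 1"
  shows "qrefl x c \<noteq> d *\<^sub>M mat 1"
  using qrefl_scalar_eqD(2)[OF assms(1,2,2), of d 1 1 c] assms(3) by auto

section \<open>Images of reflections under an automorphism\<close>

locale unitary_automorphism =
  fixes \<psi> :: "complex^'n^'n \<Rightarrow> complex^'n^'n"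
  assumes iso: "\<psi> \<in> iso unitary_group unitary_group" and card: "CARD('n) \<ge> 3"
begin

lemma unitary_image: "unitary_matrix A \<Longrightarrow> unitary_matrix (\<psi> A)"
  using iso by (auto simp: iso_def hom_def unitary_group_def)

lemma image_mult: "unitary_matrix A \<Longrightarrow> unitary_matrix B \<Longrightarrow> \<psi> (A ** B) = \<psi> A ** \<psi> B"
  using iso by (auto simp: iso_def hom_def unitary_group_def)

lemma image_inj: "unitary_matrix A \<Longrightarrow> unitary_matrix B \<Longrightarrow> \<psi> A = \<psi> B \<Longrightarrow> A = B"
  using iso by (auto simp: iso_def bij_betw_def inj_on_def unitary_group_def)

lemma image_surj:
  assumes "unitary_matrix B"
  obtains A where "unitary_matrix A" "\<psi> A = B"
proof -
  have "B \<in> \<psi> ` {A. unitary_matrix A}"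
    using iso assms by (simp add: iso_def bij_betw_def unitary_group_def)
  then show ?thesis using that by blast
qed

lemma image_one: "\<psi> (mat 1) = mat 1"
proof -
  have "\<psi> (mat 1) ** \<psi> (mat 1) = \<psi> (mat 1)"
    using image_mult[of "mat 1" "mat 1"] by simp
  then have "conj_transpose (\<psi> (mat 1)) ** (\<psi> (mat 1) ** \<psi> (mat 1)) = mat 1"
    by (simp add: unitary_left unitary_image)
  then show ?thesis
    by (simp add: matrix_mul_assoc unitary_left unitary_image)
qed

lemma image_conj_transpose: "unitary_matrix A \<Longrightarrow> \<psi> (conj_transpose A) = conj_transpose (\<psi> A)"
proof -
  assume A: "unitary_matrix A"
  then have "\<psi> A ** \<psi> (conj_transpose A) = mat 1"
    using image_mult[of A "conj_transpose A"] by (simp add: unitary_conj_transpose unitary_right image_one)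
  then have "conj_transpose (\<psi> A) ** (\<psi> A ** \<psi> (conj_transpose A)) = conj_transpose (\<psi> A)"
    by simp
  then show ?thesis
    using A by (simp add: matrix_mul_assoc unitary_left unitary_image)
qed

lemma image_conj:
  "unitary_matrix A \<Longrightarrow> unitary_matrix B \<Longrightarrow> \<psi> (B ** A ** conj_transpose B) = \<psi> B ** \<psi> A ** conj_transpose (\<psi> B)"
  by (simp add: image_mult unitary_matrix_mult unitary_conj_transpose image_conj_transpose)

text \<open>The scalar matrices are the centre, and commutation pulls back along an injective
  homomorphism.\<close>

lemma image_scalarD:
  assumes A: "unitary_matrix A" and c: "\<psi> A = c *\<^sub>M mat 1"
  obtains d where "A = d *\<^sub>M mat 1"
proof (rule commutes_with_unitary_imp_scalar[of A])
  fix B :: "complex^'n^'n" assume B: "unitary_matrix B"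
  have "\<psi> (A ** B) = \<psi> (B ** A)"
    by (simp add: image_mult A B c scale_simps)
  then show "A ** B = B ** A"
    using A B image_inj unitary_matrix_mult by blast
qed blast

lemma unitary_refl: "norm x = 1 \<Longrightarrow> unitary_matrix (qrefl x (-1))"
  by (simp add: unitary_qrefl)

text \<open>If neither the image \<open>S\<close> nor its negative is a reflection, both eigenspaces
  of \<open>S\<close> contain two orthonormal vectors. Products of \<open>S\<close> with commuting
  conjugates then have two different traces, although they are images of conjugate matrices.\<close>

lemma refl_image:
  assumes x: "norm x = 1"
  shows "\<exists>y s. norm y = 1 \<and> s \<in> {1, -1} \<and> \<psi> (qrefl x (-1)) = s *\<^sub>M qrefl y (-1)"
proof (rule ccontr)
  assume no: "\<nexists>y s. norm y = 1 \<and> s \<in> {1, -1} \<and> \<psi> (qrefl x (-1)) = s *\<^sub>M qrefl y (-1)"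
  define S where "S = \<psi> (qrefl x (-1))"
  have no1: "S \<noteq> qrefl y (-1)" "(-1) *\<^sub>M S \<noteq> qrefl y (-1)" if "norm y = 1" for y
  proof -
    show "S \<noteq> qrefl y (-1)"
      using no that unfolding S_def by (metis insertCI scale_one)
    have "S = (-1) *\<^sub>M ((-1) *\<^sub>M S)" by (simp add: scale_scale)
    then show "(-1) *\<^sub>M S \<noteq> qrefl y (-1)"
      using no that unfolding S_def by (metis insertCI)
  qed
  have S: "unitary_matrix S"
    by (simp add: S_def unitary_image unitary_refl x)
  have SS: "S ** S = mat 1"
    using image_mult[OF unitary_refl[OF x] unitary_refl[OF x]] by (simp add: S_def qrefl_mult x image_one)
  have Sct: "conj_transpose S = S"
    by (rule conj_transpose_involution[OF S SS])
  have nS: "unitary_matrix ((-1) *\<^sub>M S)" "((-1) *\<^sub>M S) ** ((-1) *\<^sub>M S) = mat 1"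
    by (simp_all add: unitary_scale S scale_simps SS)
  have not_scalar: "S \<noteq> c *\<^sub>M mat 1" for c
    using image_scalarD[OF unitary_refl[OF x]] qrefl_not_scalar[OF card x] unfolding S_def by fastforce
  have S1: "S \<noteq> mat 1" "(-1) *\<^sub>M S \<noteq> mat 1"
  proof -
    show "S \<noteq> mat 1"
      using not_scalar[of 1] by simp
    have "S = (-1) *\<^sub>M ((-1) *\<^sub>M S)"
      by (simp add: scale_scale)
    then show "(-1) *\<^sub>M S \<noteq> mat 1"
      using not_scalar[of "-1"] by metis
  qed
  obtain u1 where u1: "norm u1 = 1" "S *v u1 = - u1"
    using involution_neg_eigenvector[OF SS S1(1)] by blast
  obtain v1 where v1: "norm v1 = 1" "((-1) *\<^sub>M S) *v v1 = - v1"
    using involution_neg_eigenvector[OF nS(2) S1(2)] by blast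
  \<comment> \<open>Without a second orthogonal eigenvector \<open>S\<close> would be the reflection
    in \<open>u1\<close>; the same argument for the negative of \<open>S\<close> gives
    \<open>v2\<close>.\<close>
  obtain u2 where u2: "norm u2 = 1" "herm u2 u1 = 0" "S *v u2 = - u2"
    using involution_eq_qrefl[OF S SS u1] no1(1)[OF u1(1)] by blast
  obtain v2 where v2: "norm v2 = 1" "herm v2 v1 = 0" "((-1) *\<^sub>M S) *v v2 = - v2"
    using involution_eq_qrefl[OF nS v1] no1(2)[OF v1(1)] by blast
  have Sv: "S *v v1 = v1" "S *v v2 = v2"
    using v1(2) v2(3) by (simp_all add: scale_mult_vec vec_eq_iff)
  have perp: "herm u v = 0" if "S *v u = - u" "S *v v = v" for u v
    using unitary_herm[OF S, of u v] that by (simp add: herm_linear)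
  note perps = perp[OF u1(2) Sv(1)] perp[OF u1(2) Sv(2)] perp[OF u2(3) Sv(1)] perp[OF u2(3) Sv(2)]
  define r :: complex where "r = of_real (1 / sqrt 2)"
  have r: "r * cnj r * 2 = 1"
    by (simp add: r_def flip: of_real_mult)
  \<comment> \<open>Mixing one eigenvector of each sign makes \<open>S *v z1\<close> orthogonal to
    \<open>z1\<close>, so that the reflections in these two vectors commute; \<open>r\<close> keeps
    the norm 1.\<close>
  define z1 where "z1 = r *s (u1 - v1)"
  define z2 where "z2 = r *s (u2 - v2)"
  have Sz: "S *v z1 = r *s (- u1 - v1)" "S *v z2 = r *s (- u2 - v2)"
    by (simp_all add: z1_def z2_def vector_scalar_commute matrix_vector_mult_diff_distrib u1 u2 Sv)
  have perps2: "herm u1 u2 = 0" "herm v1 v2 = 0" "herm v1 u1 = 0" "herm v2 u1 = 0" "herm v1 u2 = 0" "herm v2 u2 = 0"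
    using perps u2(2) v2(2) herm_eq_0_commute by metis+
  have z: "norm z1 = 1" "norm z2 = 1"
    using r by (simp_all only: norm_eq_1_herm z1_def z2_def herm_linear perps perps2)
       (simp_all add: u1 u2 v1 v2 algebra_simps)
  have Szn: "norm (S *v z1) = 1" "norm (S *v z2) = 1"
    by (simp_all add: unitary_norm S z)
  have orth: "herm (S *v z1) z1 = 0" "herm (S *v z2) z2 = 0" "herm (S *v z1) z2 = 0"
     "herm (S *v z2) z1 = 0" "herm z2 z1 = 0" "herm (S *v z1) (S *v z2) = 0"
    by (simp_all only: Sz, simp_all only: z1_def z2_def herm_linear perps perps2 u2(2) v2(2))
       (simp_all add: u1 u2 v1 v2)
  have refl_conj: "S ** qrefl y (-1) ** S = qrefl (S *v y) (-1)" for y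
    using qrefl_unitary_conj[OF S, of y] by (simp add: Sct)
  have refl_ct: "conj_transpose (qrefl y (-1)) = qrefl y (-1)" for y :: "complex^'n"
    by (simp add: conj_transpose_qrefl)
  have SSx: "X ** S ** S = X" for X
    by (metis SS matrix_mul_assoc matrix_mul_rid)
  \<comment> \<open>Pulls the product \<open>K\<close> of \<open>S\<close> with a conjugate back to
    a product of reflections in \<open>x\<close> and \<open>a\<close>. Self-adjointness of
    \<open>K\<close> means that the factors commute, and a trace other than n excludes the line of
    \<open>x\<close> itself, so \<open>a\<close> is orthogonal to \<open>x\<close>.\<close>
  have key: "\<exists>a. norm a = 1 \<and> herm x a = 0 \<and> \<psi> (qrefl x (-1) ** qrefl a (-1)) = K"
    if W: "unitary_matrix W" and K: "S ** (W ** S ** conj_transpose W) = K" "conj_transpose K = K"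
      and tr: "trace K \<noteq> of_nat CARD('n)" for W K
  proof -
    obtain V where V: "unitary_matrix V" "\<psi> V = W"
      using image_surj[OF W] by blast
    define a where "a = V *v x"
    have a: "norm a = 1"
      by (simp add: a_def unitary_norm V x)
    have pa: "\<psi> (qrefl a (-1)) = W ** S ** conj_transpose W"
      using image_conj[OF unitary_refl[OF x] V(1)] by (simp add: qrefl_unitary_conj V a_def S_def)
    then have eq: "\<psi> (qrefl x (-1) ** qrefl a (-1)) = K"
      using K(1) by (simp add: image_mult unitary_refl x a S_def)
    have "conj_transpose (S ** (W ** S ** conj_transpose W)) = W ** S ** conj_transpose W ** S"
      by (simp add: conj_transpose_mult Sct matrix_mul_assoc)
    then have "\<psi> (qrefl a (-1) ** qrefl x (-1)) = K"
      using K pa by (simp add: image_mult unitary_refl x a flip: S_def)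
    with eq have comm: "qrefl x (-1) ** qrefl a (-1) = qrefl a (-1) ** qrefl x (-1)"
      using image_inj unitary_matrix_mult unitary_refl x a by metis
    have "outer x \<noteq> outer a"
    proof
      assume "outer x = outer a"
      then have "qrefl x (-1) = qrefl a (-1)"
        by (rule qrefl_outer_cong)
      then have "K = mat 1"
        using eq by (simp add: qrefl_mult a image_one)
      with tr show False by (simp add: trace_I)
    qed
    with comm have "herm x a = 0"
      using qrefl_commute_iff[OF x a] by blast
    with a eq show ?thesis by blast
  qed
  let ?K1 = "mat 1 - 2 *\<^sub>M (outer (S *v z1) + outer z1)"
  let ?K2 = "mat 1 - 2 *\<^sub>M (outer (S *v z1) + outer (S *v z2) + outer z2 + outer z1)"
  have "S ** (qrefl z1 (-1) ** S ** conj_transpose (qrefl z1 (-1))) = qrefl (S *v z1) (-1) ** qrefl z1 (-1)"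
    by (simp add: refl_ct matrix_mul_assoc flip: refl_conj)
  also have "\<dots> = ?K1"
    by (rule qrefl2_orthonormal[OF Szn(1) z(1) orth(1)])
  finally have K1: "S ** (qrefl z1 (-1) ** S ** conj_transpose (qrefl z1 (-1))) = ?K1" .
  have "S ** (qrefl z1 (-1) ** qrefl z2 (-1) ** S ** conj_transpose (qrefl z1 (-1) ** qrefl z2 (-1)))
      = qrefl (S *v z1) (-1) ** qrefl (S *v z2) (-1) ** (qrefl z2 (-1) ** qrefl z1 (-1))"
    by (simp add: refl_ct conj_transpose_mult matrix_mul_assoc SSx flip: refl_conj)
  also have "\<dots> = ?K2"
    by (rule qrefl4_orthonormal) (fact z Szn orth)+
  finally have K2: "S ** (qrefl z1 (-1) ** qrefl z2 (-1) ** S ** conj_transpose (qrefl z1 (-1) ** qrefl z2 (-1))) = ?K2" .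
  have ct: "conj_transpose ?K1 = ?K1" "conj_transpose ?K2 = ?K2"
    by (simp_all add: conj_transpose_minus conj_transpose_scale conj_transpose_plus conj_transpose_outer)
  have tr: "trace ?K1 = of_nat CARD('n) - 4" "trace ?K2 = of_nat CARD('n) - 8"
    by (simp_all add: trace_sub trace_I trace_scale trace_add trace_outer z Szn)
  obtain a where a: "norm a = 1" "herm x a = 0" "\<psi> (qrefl x (-1) ** qrefl a (-1)) = ?K1"
    using key[OF _ K1 ct(1)] tr(1) by (auto simp: unitary_refl z)
  obtain b where b: "norm b = 1" "herm x b = 0" "\<psi> (qrefl x (-1) ** qrefl b (-1)) = ?K2"
    using key[OF _ K2 ct(2)] tr(2) by (auto simp: unitary_refl unitary_matrix_mult z)
  \<comment> \<open>Pairs of orthogonal lines are unitarily equivalent, so the two preimages are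
    conjugate and their images have equal traces, against n - 4 \<noteq> n - 8.\<close>
  obtain N where N: "unitary_matrix N" "outer (N *v x) = outer x" "outer (N *v a) = outer b"
    using unitary_transitive2[of x x a b] a b x by auto
  have "N ** (qrefl x (-1) ** qrefl a (-1)) ** conj_transpose N = qrefl x (-1) ** qrefl b (-1)"
    using N by (simp add: qrefl_unitary_conj flip: unitary_conj_mult)
       (metis qrefl_outer_cong)
  then have "\<psi> N ** ?K1 ** conj_transpose (\<psi> N) = ?K2"
    using image_conj[OF unitary_matrix_mult[OF unitary_refl[OF x] unitary_refl[OF a(1)]] N(1)] a(3) b(3) by simp
  then have "trace ?K1 = trace ?K2"
    using trace_unitary_conj[OF unitary_image[OF N(1)], of ?K1] by simp
  with tr show False by simp
qed

section \<open>The induced map on lines\<close>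

text \<open>The choice depends on \<open>x\<close> only through \<open>qrefl x (-1)\<close>, so unit
  vectors on one line get literally the same representative.\<close>

definition axis_map :: "complex^'n \<Rightarrow> complex^'n" where
  "axis_map x = (SOME y. norm y = 1 \<and> (\<exists>s \<in> {1, -1}. \<psi> (qrefl x (-1)) = s *\<^sub>M qrefl y (-1)))"

lemma axis_map:
  assumes "norm x = 1"
  shows "norm (axis_map x) = 1" "\<exists>s. s \<noteq> 0 \<and> \<psi> (qrefl x (-1)) = s *\<^sub>M qrefl (axis_map x) (-1)"
proof -
  have "\<exists>y. norm y = 1 \<and> (\<exists>s \<in> {1, -1}. \<psi> (qrefl x (-1)) = s *\<^sub>M qrefl y (-1))"
    using refl_image[OF assms] by blast
  from someI_ex[OF this] have *: "norm (axis_map x) = 1" "\<exists>s \<in> {1, -1}. \<psi> (qrefl x (-1)) = s *\<^sub>M qrefl (axis_map x) (-1)"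
    unfolding axis_map_def by blast+
  show "norm (axis_map x) = 1" by fact
  have "s \<noteq> 0" if "s \<in> {1, -1 :: complex}" for s
    using that by auto
  then show "\<exists>s. s \<noteq> 0 \<and> \<psi> (qrefl x (-1)) = s *\<^sub>M qrefl (axis_map x) (-1)"
    using *(2) by blast
qed

text \<open>Conjugating the reflection in \<open>x\<close> by \<open>A\<close> gives the reflection
  in \<open>A *v x\<close>; \<open>\<psi>\<close> turns this into conjugation by
  \<open>\<psi> A\<close>, and a reflection determines its line even up to a scalar.\<close>

lemma axis_map_equivariant:
  assumes A: "unitary_matrix A" and x: "norm x = 1"
  shows "outer (axis_map (A *v x)) = outer (\<psi> A *v axis_map x)"
proof -
  obtain s where s: "s \<noteq> 0" "\<psi> (qrefl x (-1)) = s *\<^sub>M qrefl (axis_map x) (-1)"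
    using axis_map(2)[OF x] by blast
  have Ax: "norm (A *v x) = 1" by (simp add: unitary_norm A x)
  obtain t where t: "t \<noteq> 0" "\<psi> (qrefl (A *v x) (-1)) = t *\<^sub>M qrefl (axis_map (A *v x)) (-1)"
    using axis_map(2)[OF Ax] by blast
  have "t *\<^sub>M qrefl (axis_map (A *v x)) (-1) = \<psi> A ** (s *\<^sub>M qrefl (axis_map x) (-1)) ** conj_transpose (\<psi> A)"
    using image_conj[OF unitary_refl[OF x] A] by (simp add: qrefl_unitary_conj A flip: s(2) t(2))
  also have "\<dots> = s *\<^sub>M qrefl (\<psi> A *v axis_map x) (-1)"
    by (simp add: scale_simps qrefl_unitary_conj unitary_image A)
  finally show ?thesis
    using qrefl_scalar_eqD(3)[OF card axis_map(1)[OF Ax] _ _ s(1)]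
    by (simp add: unitary_norm unitary_image A axis_map(1)[OF x])
qed

text \<open>Equal image lines make the image of the product of the two reflections scalar, hence the
  product itself; the reflections are then proportional.\<close>

lemma axis_map_outer_inj:
  assumes x: "norm x = 1" and y: "norm y = 1" and eq: "outer (axis_map x) = outer (axis_map y)"
  shows "outer x = outer y"
proof -
  obtain s where s: "s \<noteq> 0" "\<psi> (qrefl x (-1)) = s *\<^sub>M qrefl (axis_map x) (-1)"
    using axis_map(2)[OF x] by blast
  obtain t where t: "t \<noteq> 0" "\<psi> (qrefl y (-1)) = t *\<^sub>M qrefl (axis_map y) (-1)"
    using axis_map(2)[OF y] by blast
  have "\<psi> (qrefl x (-1) ** qrefl y (-1)) = (s * t) *\<^sub>M mat 1"
    by (simp add: image_mult unitary_refl x y s t scale_simps qrefl_outer_cong[OF eq] qrefl_mult axis_map(1)[OF y] mult.commute)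
  then obtain d where d: "qrefl x (-1) ** qrefl y (-1) = d *\<^sub>M mat 1"
    using image_scalarD unitary_matrix_mult unitary_refl x y by metis
  have "qrefl x (-1) = qrefl x (-1) ** qrefl y (-1) ** qrefl y (-1)"
    by (simp add: qrefl_mult y flip: matrix_mul_assoc)
  also have "\<dots> = d *\<^sub>M qrefl y (-1)"
    by (simp add: d scale_simps)
  finally have "d *\<^sub>M qrefl y (-1) = 1 *\<^sub>M qrefl x (-1)" by simp
  from qrefl_scalar_eqD(3)[OF card y x this] show ?thesis by simp
qed

text \<open>For distinct lines, orthogonality is commutation of the reflections, a property that
  \<open>\<psi>\<close> preserves in both directions.\<close>

lemma axis_map_orth_iff:
  assumes x: "norm x = 1" and y: "norm y = 1"
  shows "herm (axis_map x) (axis_map y) = 0 \<longleftrightarrow> herm x y = 0"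
proof (cases "outer x = outer y")
  case True
  then have "qrefl x (-1) = qrefl y (-1)"
    by (rule qrefl_outer_cong)
  then have "axis_map x = axis_map y"
    by (simp add: axis_map_def)
  moreover have "cmod (herm x y) = 1"
    using outer_eq_cmod_herm[OF True, of x] x by simp
  ultimately show ?thesis
    using axis_map(1)[OF y] by auto
next
  case False
  then have ne: "outer (axis_map x) \<noteq> outer (axis_map y)"
    using axis_map_outer_inj[OF x y] by blast
  obtain s where s: "s \<noteq> 0" "\<psi> (qrefl x (-1)) = s *\<^sub>M qrefl (axis_map x) (-1)"
    using axis_map(2)[OF x] by blast
  obtain t where t: "t \<noteq> 0" "\<psi> (qrefl y (-1)) = t *\<^sub>M qrefl (axis_map y) (-1)"
    using axis_map(2)[OF y] by blast
  let ?R = "\<lambda>x :: complex^'n. qrefl x (-1)"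
  have "?R x ** ?R y = ?R y ** ?R x \<longleftrightarrow> \<psi> (?R x ** ?R y) = \<psi> (?R y ** ?R x)"
    using image_inj[of "?R x ** ?R y" "?R y ** ?R x"] unitary_refl x y unitary_matrix_mult by metis
  also have "\<dots> \<longleftrightarrow> (s * t) *\<^sub>M (?R (axis_map x) ** ?R (axis_map y)) = (s * t) *\<^sub>M (?R (axis_map y) ** ?R (axis_map x))"
    by (simp add: image_mult unitary_refl x y s t scale_simps mult.commute)
  also have "\<dots> \<longleftrightarrow> ?R (axis_map x) ** ?R (axis_map y) = ?R (axis_map y) ** ?R (axis_map x)"
    using s t by (simp add: vec_eq_iff scale_nth)
  finally show ?thesis
    using qrefl_commute_iff[OF x y False] qrefl_commute_iff[OF axis_map(1)[OF x] axis_map(1)[OF y] ne] by simp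
qed

lemma axis_map_surj:
  assumes y: "norm y = 1"
  obtains x where "norm x = 1" "outer (axis_map x) = outer y"
proof -
  let ?e = "axis undefined 1 :: complex^'n"
  obtain B where B: "unitary_matrix B" "B *v axis_map ?e = y"
    using unitary_transitive[of "axis_map ?e" y] y axis_map(1)[of ?e] by auto
  obtain A where A: "unitary_matrix A" "\<psi> A = B"
    using image_surj[OF B(1)] by blast
  show ?thesis
    by (rule that[of "A *v ?e"]) (use A B axis_map_equivariant[OF A(1), of ?e] in \<open>simp_all add: unitary_norm\<close>)
qed

text \<open>Pairs of lines at the same angle are unitarily equivalent, and equivariance carries the
  equivalence to the images.\<close>

lemma axis_map_cmod_herm_cong:
  assumes "norm x = 1" "norm y = 1" "norm x' = 1" "norm y' = 1" "cmod (herm x y) = cmod (herm x' y')"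
  shows "cmod (herm (axis_map x) (axis_map y)) = cmod (herm (axis_map x') (axis_map y'))"
proof -
  obtain A where A: "unitary_matrix A" "outer (A *v x) = outer x'" "outer (A *v y) = outer y'"
    using unitary_transitive2[of x x' y y'] assms by auto
  have cong: "axis_map u = axis_map v" if "outer u = outer v" for u v
    using qrefl_outer_cong[OF that] by (simp add: axis_map_def)
  have "cmod (herm (axis_map x') (axis_map y')) = cmod (herm (axis_map (A *v x)) (axis_map (A *v y)))"
    using cong[OF A(2)] cong[OF A(3)] by simp
  also have "\<dots> = cmod (herm (\<psi> A *v axis_map x) (\<psi> A *v axis_map y))"
    using axis_map_equivariant[OF A(1)] assms by (intro outer_eq_cmod_herm2) auto
  also have "\<dots> = cmod (herm (axis_map x) (axis_map y))"
    by (simp add: unitary_herm unitary_image A)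
  finally show ?thesis by simp
qed

text \<open>A nonzero residue \<open>r\<close> would span the image line of some \<open>w\<close>
  orthogonal to \<open>a\<close> and \<open>b\<close>, hence to \<open>x\<close>; then
  \<open>r\<close> is orthogonal to \<open>axis_map x\<close>, contrary to
  \<open>herm ?x r = herm r r\<close>.\<close>

lemma axis_map_span:
  assumes "norm x = 1" "norm a = 1" "norm b = 1" "herm a b = 0" "x = \<alpha> *s a + \<beta> *s b"
  shows "axis_map x = herm (axis_map x) (axis_map a) *s axis_map a + herm (axis_map x) (axis_map b) *s axis_map b"
proof -
  let ?x = "axis_map x" and ?a = "axis_map a" and ?b = "axis_map b"
  have n: "norm ?x = 1" "norm ?a = 1" "norm ?b = 1"
    using assms axis_map(1) by auto
  have ab: "herm ?a ?b = 0" "herm ?b ?a = 0"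
    using axis_map_orth_iff assms herm_eq_0_commute by metis+
  define r where "r = ?x - (herm ?x ?a *s ?a + herm ?x ?b *s ?b)"
  have ra: "herm r ?a = 0" and rb: "herm r ?b = 0"
    by (simp_all add: r_def herm_linear n ab)
  have xr: "herm ?x r = herm r r"
  proof -
    have "herm r y = herm ?x y - (herm ?x ?a * herm ?a y + herm ?x ?b * herm ?b y)" for y
      by (simp add: r_def herm_diff_left herm_add_left herm_scale_left)
    from this[of r] show ?thesis
      using ra rb by (simp add: herm_eq_0_commute[of r])
  qed
  have "r = 0"
  proof (rule ccontr)
    assume "r \<noteq> 0"
    then obtain c where c: "c \<noteq> 0" "norm (c *s r) = 1"
      by (rule exists_unit_multiple)
    obtain w where w: "norm w = 1" "outer (axis_map w) = outer (c *s r)"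
      using axis_map_surj[OF c(2)] by blast
    have "cmod (herm ?a (axis_map w)) = cmod (herm ?a (c *s r))" "cmod (herm ?b (axis_map w)) = cmod (herm ?b (c *s r))"
      "cmod (herm ?x (axis_map w)) = cmod (herm ?x (c *s r))"
      using outer_eq_cmod_herm[OF w(2)] by blast+
    then have "herm ?a (axis_map w) = 0" "herm ?b (axis_map w) = 0" and xw: "cmod (herm ?x (axis_map w)) = cmod (herm ?x (c *s r))"
      using ra[unfolded herm_eq_0_commute[of r]] rb[unfolded herm_eq_0_commute[of r]]
      by (simp_all add: herm_scale_right norm_mult)
    then have "herm a w = 0" "herm b w = 0"
      using axis_map_orth_iff assms w by auto
    then have "herm x w = 0"
      by (simp add: assms(5) herm_linear)
    then have "herm ?x (axis_map w) = 0"
      using axis_map_orth_iff assms w by auto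
    then have "herm ?x r = 0"
      using xw c(1) by (simp add: herm_scale_right norm_mult)
    with xr \<open>r \<noteq> 0\<close> show False by simp
  qed
  then show ?thesis by (simp add: r_def)
qed

lemma axis_map_cmod_herm:
  assumes x: "norm x = 1" and y: "norm y = 1"
  shows "cmod (herm (axis_map x) (axis_map y)) = cmod (herm x y)"
proof -
  obtain i j k :: 'n where ijk: "i \<noteq> j" "i \<noteq> k" "j \<noteq> k"
  proof -
    obtain T :: "'n set" where "T \<subseteq> UNIV" "card T = 3"
      using card obtain_subset_with_card_n by metis
    then show ?thesis
      using that by (auto simp: card_3_iff)
  qed
  define e1 e2 e3 :: "complex^'n" where "e1 = axis i 1" and "e2 = axis j 1" and "e3 = axis k 1"
  have e: "norm e1 = 1" "norm e2 = 1" "norm e3 = 1" "herm e1 e2 = 0" "herm e1 e3 = 0" "herm e2 e3 = 0"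
     "herm e2 e1 = 0" "herm e3 e1 = 0" "herm e3 e2 = 0"
    using ijk by (simp_all add: e1_def e2_def e3_def herm_axis_axis)
  \<comment> \<open>For orthonormal \<open>u\<close>, \<open>w\<close> and \<open>p\<close> between
    0 and 1, a unit vector whose inner product with \<open>u\<close> has square
    \<open>p\<close>.\<close>
  define v where "v p u w = of_real (sqrt p) *s u + of_real (sqrt (1 - p)) *s w" for p and u w :: "complex^'n"
  have norm_v: "norm (v p u w) = 1" if "0 \<le> p" "p \<le> 1" "norm u = 1" "norm w = 1" "herm u w = 0" for p u w
  proof -
    have "herm (v p u w) (v p u w) = of_real (sqrt p * sqrt p + sqrt (1 - p) * sqrt (1 - p))"
      using that herm_eq_0_commute[of u w] by (simp only: v_def herm_linear of_real_add of_real_mult) simp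
    also have "sqrt p * sqrt p + sqrt (1 - p) * sqrt (1 - p) = 1"
      using that by simp
    finally show ?thesis by (simp add: norm_eq_1_herm)
  qed
  have herm_v: "herm (v p u w) u = of_real (sqrt p)" "herm (v p u w) w = of_real (sqrt (1 - p))"
    if "norm u = 1" "norm w = 1" "herm u w = 0" for p u w
    using that herm_eq_0_commute[of u w] by (simp_all add: v_def herm_linear)
  \<comment> \<open>The squared modulus after the map as a function of the one before; by
    \<open>axis_map_cmod_herm_cong\<close> any other pair at the same angle gives the same
    value.\<close>
  define Q where "Q p = (cmod (herm (axis_map (v p e1 e2)) (axis_map e1)))\<^sup>2" for p
  have Q: "(cmod (herm (axis_map x) (axis_map y)))\<^sup>2 = Q p"
    if "norm x = 1" "norm y = 1" "0 \<le> p" "p \<le> 1" "cmod (herm x y) = sqrt p" for x y p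
  proof -
    have "cmod (herm (axis_map x) (axis_map y)) = cmod (herm (axis_map (v p e1 e2)) (axis_map e1))"
      by (rule axis_map_cmod_herm_cong) (use that e norm_v herm_v in simp_all)
    then show ?thesis by (simp add: Q_def)
  qed
  have "Q p = p" if "0 \<le> p" "p \<le> 1" for p
  proof (rule multiplicative_reflecting_eq_id[OF _ _ _ that])
    show "0 \<le> Q p" for p
      by (simp add: Q_def)
    show "Q (p * q) = Q p * Q q" if pq: "0 \<le> p" "p \<le> 1" "0 \<le> q" "q \<le> 1" for p q
    proof -
      \<comment> \<open>The images of \<open>x\<close> and \<open>z\<close> lie in planes that share
        only the image of \<open>e1\<close>, the images of \<open>e2\<close> and \<open>e3\<close>
        being orthogonal, so their inner product factors through it. This is where a third dimension
        enters.\<close>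
      define x where "x = v p e1 e2"
      define z where "z = v q e1 e3"
      have nx: "norm x = 1" "norm z = 1"
        using pq e by (simp_all add: x_def z_def norm_v)
      have "herm x z = of_real (sqrt p) * of_real (sqrt q)"
        using e by (simp add: x_def z_def v_def herm_linear)
      then have "cmod (herm x z) = sqrt (p * q)"
        using pq by (simp add: norm_mult real_sqrt_mult)
      then have xz: "(cmod (herm (axis_map x) (axis_map z)))\<^sup>2 = Q (p * q)"
        using nx pq by (intro Q) (auto simp: mult_le_one)
      have sx: "axis_map x = herm (axis_map x) (axis_map e1) *s axis_map e1 + herm (axis_map x) (axis_map e2) *s axis_map e2"
        by (rule axis_map_span[OF nx(1) e(1,2,4)]) (simp add: x_def v_def)
      have sz: "axis_map z = herm (axis_map z) (axis_map e1) *s axis_map e1 + herm (axis_map z) (axis_map e3) *s axis_map e3"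
        by (rule axis_map_span[OF nx(2) e(1,3,5)]) (simp add: z_def v_def)
      have o: "herm (axis_map e1) (axis_map e1) = 1" "herm (axis_map e1) (axis_map e3) = 0"
         "herm (axis_map e2) (axis_map e1) = 0" "herm (axis_map e2) (axis_map e3) = 0"
        using e axis_map_orth_iff axis_map(1) by auto
      have "herm (axis_map x) (axis_map z) = herm (axis_map x) (axis_map e1) * cnj (herm (axis_map z) (axis_map e1))"
        by (subst sx, subst sz) (simp add: herm_linear o)
      then have "(cmod (herm (axis_map x) (axis_map z)))\<^sup>2 =
          (cmod (herm (axis_map x) (axis_map e1)))\<^sup>2 * (cmod (herm (axis_map z) (axis_map e1)))\<^sup>2"
        by (simp add: norm_mult power_mult_distrib)
      also have "(cmod (herm (axis_map x) (axis_map e1)))\<^sup>2 = Q p"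
        using e nx pq by (intro Q) (simp_all add: x_def herm_v)
      also have "(cmod (herm (axis_map z) (axis_map e1)))\<^sup>2 = Q q"
        using e nx pq by (intro Q) (simp_all add: z_def herm_v)
      finally show ?thesis using xz by simp
    qed
    show "Q (1 - p) = 1 - Q p" if p: "0 \<le> p" "p \<le> 1" for p
    proof -
      define x where "x = v p e1 e2"
      have nx: "norm x = 1"
        using p e by (simp add: x_def norm_v)
      let ?a = "herm (axis_map x) (axis_map e1)" and ?b = "herm (axis_map x) (axis_map e2)"
      have sx: "axis_map x = ?a *s axis_map e1 + ?b *s axis_map e2"
        by (rule axis_map_span[OF nx e(1,2,4)]) (simp add: x_def v_def)
      \<comment> \<open>Pythagoras in the plane of the images of \<open>e1\<close> and
        \<open>e2\<close>.\<close>
      have "1 = herm (axis_map x) (axis_map x)"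
        using axis_map(1)[OF nx] by simp
      also have "\<dots> = herm (axis_map x) (?a *s axis_map e1 + ?b *s axis_map e2)"
        by (subst sx[symmetric]) simp
      also have "\<dots> = of_real ((cmod ?a)\<^sup>2 + (cmod ?b)\<^sup>2)"
        by (simp add: herm_add_right herm_scale_right mult.commute[of "cnj _"] flip: complex_norm_square)
      finally have "(cmod ?a)\<^sup>2 + (cmod ?b)\<^sup>2 = 1"
        by (metis of_real_eq_1_iff)
      moreover have "(cmod ?a)\<^sup>2 = Q p"
        using e nx p by (intro Q) (simp_all add: x_def herm_v)
      moreover have "(cmod ?b)\<^sup>2 = Q (1 - p)"
        using e nx p by (intro Q) (simp_all add: x_def herm_v)
      ultimately show ?thesis by simp
    qed
  qed
  \<comment> \<open>Cauchy-Schwarz, which places the argument of \<open>Q\<close> between 0 and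
    1.\<close>
  moreover have le: "cmod (herm x y) \<le> 1"
  proof -
    define c where "c = herm x y"
    have c: "herm x y = c" "herm y x = cnj c"
      by (simp_all add: c_def flip: herm_commute)
    have "0 \<le> (norm (x - c *s y))\<^sup>2" by simp
    also have "of_real ((norm (x - c *s y))\<^sup>2) = herm (x - c *s y) (x - c *s y)"
      by (simp add: herm_same)
    then have "of_real ((norm (x - c *s y))\<^sup>2) = complex_of_real (1 - (cmod c)\<^sup>2)"
      using x y c by (simp add: herm_linear complex_norm_square[unfolded of_real_power] algebra_simps)
    then have "(norm (x - c *s y))\<^sup>2 = 1 - (cmod c)\<^sup>2"
      using of_real_eq_iff by blast
    finally show ?thesis
      by (simp add: c_def abs_square_le_1)
  qed
  ultimately have "(cmod (herm (axis_map x) (axis_map y)))\<^sup>2 = (cmod (herm x y))\<^sup>2"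
    using Q[OF x y, of "(cmod (herm x y))\<^sup>2"] by (simp add: power_le_one)
  then show ?thesis by simp
qed

end

section \<open>Standard automorphisms and the scalar class \<open>M_u\<close>\<close>

lemma scale_unitary_cancel:
  fixes A :: "complex^'n^'n"
  assumes A: "unitary_matrix A" and eq: "c *\<^sub>M A = d *\<^sub>M A"
  shows "c = d"
proof -
  have "c *\<^sub>M mat 1 = d *\<^sub>M (mat 1 :: complex^'n^'n)"
    using arg_cong[OF eq, of "\<lambda>X. X ** conj_transpose A"] by (simp add: scale_simps unitary_right A)
  from arg_cong[OF this, of trace] show ?thesis
    by (simp add: trace_scale trace_I)
qed

lemma unitary_conj_cancel:
  assumes "unitary_matrix T"
  shows "conj_transpose T ** (T ** A ** conj_transpose T) ** T = A"
    "T ** (conj_transpose T ** A ** T) ** conj_transpose T = A"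
proof -
  show "conj_transpose T ** (T ** A ** conj_transpose T) ** T = A"
    by (simp add: matrix_mul_assoc unitary_left assms) (simp add: unitary_left assms flip: matrix_mul_assoc)
  show "T ** (conj_transpose T ** A ** T) ** conj_transpose T = A"
    by (simp add: matrix_mul_assoc unitary_right assms) (simp add: unitary_right assms flip: matrix_mul_assoc)
qed

lemma unitary_unitary_conj:
  "unitary_matrix T \<Longrightarrow> unitary_matrix A \<Longrightarrow> unitary_matrix (T ** A ** conj_transpose T)"
  by (simp add: unitary_matrix_mult unitary_conj_transpose)

lemma carrier_unitary_iff [simp]: "A \<in> carrier unitary_group \<longleftrightarrow> unitary_matrix A"
  by (simp add: unitary_group_def)

lemma carrier_circle_iff [simp]: "z \<in> carrier circle_group \<longleftrightarrow> cmod z = 1"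
  by (simp add: circle_group_def)

lemma iso_unitary_groupI:
  assumes "\<And>A. unitary_matrix A \<Longrightarrow> unitary_matrix (\<psi> A)"
    and "\<And>A B. unitary_matrix A \<Longrightarrow> unitary_matrix B \<Longrightarrow> \<psi> (A ** B) = \<psi> A ** \<psi> B"
    and "\<And>A B. unitary_matrix A \<Longrightarrow> unitary_matrix B \<Longrightarrow> \<psi> A = \<psi> B \<Longrightarrow> A = B"
    and "\<And>B. unitary_matrix B \<Longrightarrow> \<exists>A. unitary_matrix A \<and> \<psi> A = B"
  shows "\<psi> \<in> iso unitary_group unitary_group"
proof -
  have "\<psi> ` Collect unitary_matrix = Collect unitary_matrix"
    using assms(1,4) by blast
  then show ?thesis
    using assms(1-3) by (auto simp: iso_def hom_def bij_betw_def inj_on_def unitary_group_def)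
qed

lemma iso_circle_groupI:
  assumes "\<And>z. cmod z = 1 \<Longrightarrow> cmod (s z) = 1"
    and "\<And>z w. cmod z = 1 \<Longrightarrow> cmod w = 1 \<Longrightarrow> s (z * w) = s z * s w"
    and "\<And>z w. cmod z = 1 \<Longrightarrow> cmod w = 1 \<Longrightarrow> s z = s w \<Longrightarrow> z = w"
    and "\<And>w. cmod w = 1 \<Longrightarrow> \<exists>z. cmod z = 1 \<and> s z = w"
  shows "s \<in> iso circle_group circle_group"
proof -
  have "s ` {z. cmod z = 1} = {z. cmod z = 1}"
    using assms(1,4) by blast
  then show ?thesis
    using assms(1-3) by (auto simp: iso_def hom_def bij_betw_def inj_on_def circle_group_def)
qed

lemma conj_matrix_iso: "conj_matrix \<in> iso unitary_group unitary_group"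
  by (rule iso_unitary_groupI) (metis unitary_conj_matrix conj_matrix_mult conj_matrix_conj_matrix)+

lemma M_u_mult: "g \<in> M_u n \<Longrightarrow> cmod z = 1 \<Longrightarrow> cmod w = 1 \<Longrightarrow> g (z * w) = g z * g w"
  by (simp add: M_u_def hom_def circle_group_def)

lemma M_u_cmod: "g \<in> M_u n \<Longrightarrow> cmod z = 1 \<Longrightarrow> cmod (g z) = 1"
  by (auto simp: M_u_def hom_def circle_group_def)

lemma M_u_inj:
  "g \<in> M_u n \<Longrightarrow> cmod z = 1 \<Longrightarrow> cmod w = 1 \<Longrightarrow> g z ^ n * z = g w ^ n * w \<Longrightarrow> z = w"
  by (auto simp: M_u_def iso_def bij_betw_def inj_on_def circle_group_def)

lemma M_u_surj:
  assumes "g \<in> M_u n" "cmod w = 1"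
  obtains z where "cmod z = 1" "g z ^ n * z = w"
proof -
  have "w \<in> (\<lambda>z. g z ^ n * z) ` {z. cmod z = 1}"
    using assms by (simp add: M_u_def iso_def bij_betw_def circle_group_def)
  then show ?thesis using that by auto
qed

lemma mult_power:
  fixes s :: "complex \<Rightarrow> complex"
  assumes mult: "\<And>z w. cmod z = 1 \<Longrightarrow> cmod w = 1 \<Longrightarrow> s (z * w) = s z * s w"
    and nz: "s 1 \<noteq> 0" and z: "cmod z = 1"
  shows "s (z ^ n) = s z ^ n"
proof (induction n)
  case 0
  then show ?case using mult[of 1 1] nz by simp
next
  case (Suc n)
  then show ?case using mult[of z "z ^ n"] z by (simp add: norm_power)
qed

lemma M_u_power: "g \<in> M_u n \<Longrightarrow> cmod z = 1 \<Longrightarrow> g (z ^ k) = g z ^ k"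
  using M_u_cmod[of g n 1] by (intro mult_power M_u_mult) auto

lemma M_uI:
  assumes "\<And>z. cmod z = 1 \<Longrightarrow> cmod (s z) = 1"
    and "\<And>z w. cmod z = 1 \<Longrightarrow> cmod w = 1 \<Longrightarrow> s (z * w) = s z * s w"
    and "\<And>z w. cmod z = 1 \<Longrightarrow> cmod w = 1 \<Longrightarrow> s z ^ n * z = s w ^ n * w \<Longrightarrow> z = w"
    and "\<And>w. cmod w = 1 \<Longrightarrow> \<exists>z. cmod z = 1 \<and> s z ^ n * z = w"
  shows "s \<in> M_u n"
proof -
  have "(\<lambda>z. s z ^ n * z) \<in> iso circle_group circle_group"
  proof (rule iso_circle_groupI)
    show "cmod (s z ^ n * z) = 1" if "cmod z = 1" for z
      using assms(1)[OF that] that by (simp add: norm_mult norm_power)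
    show "s (z * w) ^ n * (z * w) = s z ^ n * z * (s w ^ n * w)" if "cmod z = 1" "cmod w = 1" for z w
      using assms(2)[OF that] by (simp add: power_mult_distrib)
  qed (fact assms(3,4))+
  then show ?thesis
    using assms(1,2) by (auto simp: M_u_def hom_def circle_group_def)
qed

text \<open>Passing from \<open>A\<close> to \<open>k *\<^sub>M A\<close> multiplies the determinant
  by \<open>k ^ n\<close> and therefore the image by \<open>g k ^ n * k\<close>; the bijection in
  the definition of \<open>M_u\<close> takes care of exactly these scalars.\<close>

lemma standard_iso:
  fixes T :: "complex^'n^'n"
  assumes T: "unitary_matrix T" and g: "g \<in> M_u CARD('n)"
  shows "(\<lambda>A. g (det A) *\<^sub>M (T ** A ** conj_transpose T)) \<in> iso unitary_group unitary_group"
proof (rule iso_unitary_groupI)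
  fix A B :: "complex^'n^'n" assume A: "unitary_matrix A"
  then have dA: "cmod (det A) = 1" by (rule cmod_det_unitary)
  show "unitary_matrix (g (det A) *\<^sub>M (T ** A ** conj_transpose T))"
    using A T M_u_cmod[OF g dA] by (intro unitary_scale unitary_unitary_conj)
  assume B: "unitary_matrix B"
  then have dB: "cmod (det B) = 1" by (rule cmod_det_unitary)
  show "g (det (A ** B)) *\<^sub>M (T ** (A ** B) ** conj_transpose T) =
      g (det A) *\<^sub>M (T ** A ** conj_transpose T) ** g (det B) *\<^sub>M (T ** B ** conj_transpose T)"
    using M_u_mult[OF g dA dB] by (simp add: det_mul scale_simps unitary_conj_mult T mult.commute)
  assume eq: "g (det A) *\<^sub>M (T ** A ** conj_transpose T) = g (det B) *\<^sub>M (T ** B ** conj_transpose T)"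
  define k where "k = g (det B) / g (det A)"
  have gnz: "g (det A) \<noteq> 0" using M_u_cmod[OF g dA] by auto
  have k: "cmod k = 1"
    using M_u_cmod[OF g dA] M_u_cmod[OF g dB] by (simp add: k_def norm_divide)
  have "g (det A) *\<^sub>M A = g (det B) *\<^sub>M B"
    using arg_cong[OF eq, of "\<lambda>X. conj_transpose T ** X ** T"] unitary_conj_cancel(1)[OF T]
    by (simp add: scale_simps)
  from arg_cong[OF this, of "\<lambda>X. inverse (g (det A)) *\<^sub>M X"] have AkB: "A = k *\<^sub>M B"
    using gnz by (simp add: scale_scale k_def divide_inverse mult.commute)
  \<comment> \<open>\<open>A\<close> and \<open>B\<close> are proportional; comparing determinants
    gives \<open>g k ^ n * k = 1\<close>, and injectivity leaves only \<open>k = 1\<close>.\<close>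
  have "g (det A) = g (k ^ CARD('n)) * g (det B)"
    using M_u_mult[OF g _ dB, of "k ^ CARD('n)"] k by (simp add: AkB det_scale norm_power)
  moreover have "k * g (det A) = g (det B)"
    using gnz by (simp add: k_def)
  ultimately have "g (det A) = g k ^ CARD('n) * (k * g (det A))"
    by (simp add: M_u_power[OF g k])
  then have "g k ^ CARD('n) * k = g 1 ^ CARD('n) * 1"
    using gnz M_u_mult[OF g, of 1 1] M_u_cmod[OF g, of 1] by (auto simp: mult.assoc[symmetric])
  from M_u_inj[OF g k _ this] have "k = 1" by simp
  then show "A = B" using AkB by simp
next
  fix B :: "complex^'n^'n" assume B: "unitary_matrix B"
  define Y where "Y = conj_transpose T ** B ** T"
  have Y: "unitary_matrix Y"
    using T B unitary_unitary_conj[of "conj_transpose T" B] by (simp add: Y_def unitary_conj_transpose)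
  then have dY: "cmod (det Y) = 1" by (rule cmod_det_unitary)
  have gY: "cmod (g (det Y)) = 1" by (rule M_u_cmod[OF g dY])
  \<comment> \<open>The naive preimage \<open>Y\<close> is off by the scalar
    \<open>g (det Y)\<close>, which the factor \<open>k\<close> compensates.\<close>
  then obtain k where k: "cmod k = 1" "g k ^ CARD('n) * k = inverse (g (det Y))"
    using M_u_surj[OF g, of "inverse (g (det Y))"] by (auto simp: norm_inverse)
  have "g (det (k *\<^sub>M Y)) * k = g k ^ CARD('n) * k * g (det Y)"
    using M_u_mult[OF g _ dY, of "k ^ CARD('n)"] k by (simp add: det_scale norm_power M_u_power[OF g])
  also have "\<dots> = 1"
    using gY by (subst k(2)) (metis left_inverse norm_zero zero_neq_one)
  finally have "g (det (k *\<^sub>M Y)) *\<^sub>M (T ** (k *\<^sub>M Y) ** conj_transpose T) = T ** Y ** conj_transpose T"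
    by (simp add: scale_simps)
  also have "\<dots> = B"
    by (simp add: Y_def unitary_conj_cancel(2) T)
  finally show "\<exists>A. unitary_matrix A \<and> g (det A) *\<^sub>M (T ** A ** conj_transpose T) = B"
    using unitary_scale[OF Y k(1)] by blast
qed

text \<open>The matrix \<open>conj_transpose A ** conj_transpose T ** B ** T\<close> fixes every
  line, so it is scalar.\<close>

lemma unitary_eq_scale_conj:
  fixes T A B :: "complex^'n^'n"
  assumes T: "unitary_matrix T" and A: "unitary_matrix A"
    and eq: "\<And>x. norm x = 1 \<Longrightarrow> outer (B *v (T *v x)) = outer (T *v (A *v x))"
  shows "\<exists>c. B = c *\<^sub>M (T ** A ** conj_transpose T)"
proof -
  let ?M = "conj_transpose A ** conj_transpose T ** B ** T"
  obtain c where c: "?M = c *\<^sub>M mat 1"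
  proof (rule eigenvectors_imp_scalar[of ?M])
    fix x :: "complex^'n" assume "norm x = 1"
    from outer_mult_vec_cong[OF eq[OF this], of "conj_transpose A ** conj_transpose T"]
    have "outer (?M *v x) = outer x"
      by (simp add: unitary_cancel_left T A flip: matrix_vector_mul_assoc)
    then show "\<exists>c. ?M *v x = c *s x"
      by (rule outer_eqE) blast
  qed blast
  have "T ** A ** ?M ** conj_transpose T = T ** (A ** conj_transpose A) ** conj_transpose T ** B ** (T ** conj_transpose T)"
    by (simp only: matrix_mul_assoc)
  then have "T ** A ** ?M ** conj_transpose T = B"
    using T A by (simp add: unitary_right)
  then show ?thesis
    unfolding c by (auto simp: scale_simps intro!: exI[of _ c])
qed

section \<open>Standard form of an automorphism\<close>

context unitary_automorphism
begin

text \<open>The scalar is a homomorphism into the circle that is constant on conjugacy classes. On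
  quasi-reflections it depends on the eigenvalue alone, which is the determinant, and these generate
  the group.\<close>

lemma standard_form_det:
  assumes U: "unitary_matrix U"
    and form: "\<And>A. unitary_matrix A \<Longrightarrow> \<exists>c. \<psi> A = c *\<^sub>M (U ** A ** conj_transpose U)"
  shows "\<exists>g \<in> M_u CARD('n). \<forall>A. unitary_matrix A \<longrightarrow> \<psi> A = g (det A) *\<^sub>M (U ** A ** conj_transpose U)"
proof -
  define c where "c A = (SOME c. \<psi> A = c *\<^sub>M (U ** A ** conj_transpose U))" for A
  have c: "\<psi> A = c A *\<^sub>M (U ** A ** conj_transpose U)" if "unitary_matrix A" for A
    unfolding c_def by (rule someI_ex[OF form[OF that]])
  have c_unique: "c A = d" if "unitary_matrix A" "\<psi> A = d *\<^sub>M (U ** A ** conj_transpose U)" for A d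
    by (rule scale_unitary_cancel[OF unitary_unitary_conj[OF U that(1)]]) (use c[OF that(1)] that(2) in simp)
  have c_cmod: "cmod (c A) = 1" if "unitary_matrix A" for A
    using unitary_scaleD[OF unitary_unitary_conj[OF U that], of "c A"] unitary_image[OF that] c[OF that] by simp
  have c_mult: "c (A ** B) = c A * c B" if "unitary_matrix A" "unitary_matrix B" for A B
  proof (rule c_unique)
    show "unitary_matrix (A ** B)"
      by (rule unitary_matrix_mult[OF that])
    have "\<psi> (A ** B) = \<psi> A ** \<psi> B"
      by (rule image_mult[OF that])
    also have "\<dots> = (c A * c B) *\<^sub>M (U ** (A ** B) ** conj_transpose U)"
      unfolding c[OF that(1)] c[OF that(2)] by (simp add: scale_simps unitary_conj_mult[OF U] mult.commute)
    finally show "\<psi> (A ** B) = (c A * c B) *\<^sub>M (U ** (A ** B) ** conj_transpose U)" .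
  qed
  have c_conj: "c (V ** A ** conj_transpose V) = c A" if "unitary_matrix V" "unitary_matrix A" for V A
  proof -
    have "c V * c (conj_transpose V) = c (mat 1)"
      using that by (simp add: unitary_conj_transpose unitary_right flip: c_mult)
    also have "\<dots> = 1"
      by (rule c_unique) (simp_all add: image_one unitary_right U)
    finally show ?thesis
      using that by (simp add: c_mult unitary_matrix_mult unitary_conj_transpose mult.commute mult.left_commute)
  qed
  define e :: "complex^'n" where "e = axis undefined 1"
  have e: "norm e = 1" by (simp add: e_def)
  define s where "s z = c (qrefl e z)" for z
  have c_qrefl: "c (qrefl x z) = s z" if x: "norm x = 1" "cmod z = 1" for x z
  proof -
    obtain V where V: "unitary_matrix V" "V *v e = x"
      using unitary_transitive[of e x] e x by auto
    show ?thesis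
      using c_conj[OF V(1) unitary_qrefl[OF e x(2)]] V by (simp add: qrefl_unitary_conj s_def)
  qed
  have s_cmod: "cmod (s z) = 1" if "cmod z = 1" for z
    using that by (simp add: s_def c_cmod unitary_qrefl e)
  have s_mult: "s (z * w) = s z * s w" if "cmod z = 1" "cmod w = 1" for z w
    using c_mult[OF unitary_qrefl[OF e that(1)] unitary_qrefl[OF e that(2)]] by (simp add: qrefl_mult e s_def)
  have c_det: "c A = s (det A)" if "unitary_matrix A" for A
    using that
  proof (induction A rule: unitary_qrefl_induct)
    case one
    have "c (qrefl e 1) = s 1" by (rule c_qrefl) (simp_all add: e)
    then show ?case by simp
  next
    case (step A x z)
    then show ?case
      by (simp add: c_mult unitary_qrefl c_qrefl det_mul det_qrefl s_mult cmod_det_unitary)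
  qed
  have sform: "\<psi> A = s (det A) *\<^sub>M (U ** A ** conj_transpose U)" if "unitary_matrix A" for A
    using c[OF that] c_det[OF that] by simp
  \<comment> \<open>Membership in \<open>M_u\<close> is read off the centre, which
    \<open>\<psi>\<close> maps bijectively onto itself by this formula.\<close>
  have scal: "\<psi> (z *\<^sub>M mat 1) = (s z ^ CARD('n) * z) *\<^sub>M mat 1" if "cmod z = 1" for z
  proof -
    have "s (z ^ CARD('n)) = s z ^ CARD('n)"
      using s_cmod[of 1] by (intro mult_power s_mult that) auto
    then show ?thesis
      using sform[OF unitary_scale[OF unitary_one that]] by (simp add: det_scale det_I scale_simps unitary_right U)
  qed
  have "s \<in> M_u CARD('n)"
  proof (rule M_uI)
    fix z w assume zw: "cmod z = 1" "cmod w = 1" "s z ^ CARD('n) * z = s w ^ CARD('n) * w"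
    then have "\<psi> (z *\<^sub>M mat 1) = \<psi> (w *\<^sub>M mat 1)"
      by (simp only: scal)
    then have "z *\<^sub>M mat 1 = w *\<^sub>M (mat 1 :: complex^'n^'n)"
      using image_inj zw unitary_scale unitary_one by blast
    then show "z = w"
      by (rule scale_unitary_cancel[OF unitary_one])
  next
    fix w assume w: "cmod w = 1"
    obtain A where A: "unitary_matrix A" "\<psi> A = w *\<^sub>M mat 1"
      using image_surj[OF unitary_scale[OF unitary_one w]] by blast
    obtain z where z: "A = z *\<^sub>M mat 1"
      using image_scalarD[OF A] by blast
    then have z1: "cmod z = 1"
      using A(1) unitary_scaleD unitary_one by blast
    have "(s z ^ CARD('n) * z) *\<^sub>M mat 1 = w *\<^sub>M (mat 1 :: complex^'n^'n)"
      using A(2) scal[OF z1] z by simp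
    then have "s z ^ CARD('n) * z = w"
      by (rule scale_unitary_cancel[OF unitary_one])
    with z1 show "\<exists>z. cmod z = 1 \<and> s z ^ CARD('n) * z = w" by blast
  qed (simp_all add: s_cmod s_mult)
  with sform show ?thesis by blast
qed

lemma standard_form:
  "\<exists>T. unitary_matrix T \<and> (\<exists>g \<in> M_u CARD('n).
     (\<forall>A. unitary_matrix A \<longrightarrow> \<psi> A = g (det A) *\<^sub>M (T ** A ** conj_transpose T)) \<or>
     (\<forall>A. unitary_matrix A \<longrightarrow> \<psi> A = g (det (conj_matrix A)) *\<^sub>M (T ** conj_matrix A ** conj_transpose T)))"
proof -
  have "CARD('n) \<ge> 2" using card by simp
  from wigner_unit[OF this, of axis_map] obtain T where T: "unitary_matrix T" and
    cases: "(\<forall>x. norm x = 1 \<longrightarrow> outer (axis_map x) = outer (T *v x)) \<or>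
     (\<forall>x. norm x = 1 \<longrightarrow> outer (axis_map x) = outer (T *v cnj_vec x))"
    using axis_map_cmod_herm by blast
  from cases show ?thesis
  proof
    assume lin: "\<forall>x. norm x = 1 \<longrightarrow> outer (axis_map x) = outer (T *v x)"
    have "\<exists>c. \<psi> A = c *\<^sub>M (T ** A ** conj_transpose T)" if A: "unitary_matrix A" for A
    proof (rule unitary_eq_scale_conj[OF T A])
      fix x :: "complex^'n" assume x: "norm x = 1"
      have "outer (\<psi> A *v (T *v x)) = outer (\<psi> A *v axis_map x)"
        using lin x by (intro outer_mult_vec_cong) simp
      also have "\<dots> = outer (axis_map (A *v x))"
        by (simp add: axis_map_equivariant A x)
      also have "\<dots> = outer (T *v (A *v x))"
        using lin x by (simp add: unitary_norm A)
      finally show "outer (\<psi> A *v (T *v x)) = outer (T *v (A *v x))" .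
    qed
    from standard_form_det[OF T this] T show ?thesis by blast
  next
    assume anti: "\<forall>x. norm x = 1 \<longrightarrow> outer (axis_map x) = outer (T *v cnj_vec x)"
    \<comment> \<open>Precomposing with entrywise conjugation reduces the antiunitary case to the
      unitary one.\<close>
    interpret c: unitary_automorphism "\<psi> \<circ> conj_matrix"
      by unfold_locales (rule iso_set_trans[OF conj_matrix_iso iso], rule card)
    have "\<exists>c. (\<psi> \<circ> conj_matrix) A = c *\<^sub>M (T ** A ** conj_transpose T)" if A: "unitary_matrix A" for A
    proof (rule unitary_eq_scale_conj[OF T A])
      fix x :: "complex^'n" assume x: "norm x = 1"
      have cA: "unitary_matrix (conj_matrix A)" by (rule unitary_conj_matrix[OF A])
      have "outer (\<psi> (conj_matrix A) *v (T *v x)) = outer (\<psi> (conj_matrix A) *v axis_map (cnj_vec x))"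
        using anti x by (intro outer_mult_vec_cong) simp
      also have "\<dots> = outer (axis_map (conj_matrix A *v cnj_vec x))"
        by (simp add: axis_map_equivariant cA x)
      also have "\<dots> = outer (T *v cnj_vec (conj_matrix A *v cnj_vec x))"
        using anti x by (simp add: unitary_norm cA)
      also have "\<dots> = outer (T *v (A *v x))"
        by (simp add: conj_matrix_mult_vec)
      finally show "outer ((\<psi> \<circ> conj_matrix) A *v (T *v x)) = outer (T *v (A *v x))" by simp
    qed
    from c.standard_form_det[OF T this] obtain g where g: "g \<in> M_u CARD('n)"
      "\<And>A. unitary_matrix A \<Longrightarrow> \<psi> (conj_matrix A) = g (det A) *\<^sub>M (T ** A ** conj_transpose T)"
      by auto
    have "\<psi> A = g (det (conj_matrix A)) *\<^sub>M (T ** conj_matrix A ** conj_transpose T)" if "unitary_matrix A" for A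
      using g(2)[OF unitary_conj_matrix[OF that]] by simp
    with g(1) T show ?thesis by blast
  qed
qed

end

section \<open>Local automorphisms\<close>

lemma outer_eq_quadratic: "outer x = outer y \<Longrightarrow> herm (M *v x) x = herm (M *v y) y"
proof (erule outer_eqE)
  fix c assume "cmod c = 1" "x = c *s y"
  then have "herm (M *v x) x = (c * cnj c) * herm (M *v y) y"
    by (simp add: vector_scalar_commute herm_linear)
  then show ?thesis
    by (simp add: mult_cnj_unit \<open>cmod c = 1\<close>)
qed

text \<open>Explains why an antiunitary map on lines shows up as transposition when quadratic forms
  are compared.\<close>

lemma herm_transpose: "herm (transpose A *v cnj_vec x) (cnj_vec x) = herm (A *v x) x"
proof -
  have "herm (A *v x) x = cnj (herm (conj_transpose A *v x) x)"
    by (simp add: herm_adjoint flip: herm_commute)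
  also have "\<dots> = herm (cnj_vec (conj_transpose A *v x)) (cnj_vec x)"
    by (simp add: herm_cnj_vec)
  also have "cnj_vec (conj_transpose A *v x) = transpose A *v cnj_vec x"
    by (simp add: vec_eq_iff matrix_vector_mult_def conj_transpose_def transpose_def conj_matrix_nth cnj_sum)
  finally show ?thesis by simp
qed

section \<open>Commutator traces and the detection of transposition\<close>

text \<open>For unitary matrices this is the group commutator, in which phases of the factors
  cancel.\<close>

definition ucomm :: "complex^'n^'n \<Rightarrow> complex^'n^'n \<Rightarrow> complex^'n^'n" where
  "ucomm A B = A ** B ** conj_transpose A ** conj_transpose B"

lemma ucomm_scale: "cmod s = 1 \<Longrightarrow> cmod t = 1 \<Longrightarrow> ucomm (s *\<^sub>M A) (t *\<^sub>M B) = ucomm A B"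
proof -
  assume "cmod s = 1" "cmod t = 1"
  have "s * (t * (cnj s * cnj t)) = (s * cnj s) * (t * cnj t)"
    by (simp only: mult_ac)
  also have "\<dots> = 1"
    by (simp add: mult_cnj_unit \<open>cmod s = 1\<close> \<open>cmod t = 1\<close>)
  finally have "s * (t * (cnj s * cnj t)) = 1" .
  then show ?thesis
    by (simp add: ucomm_def conj_transpose_scale scale_simps mult_ac)
qed

lemma trace_ucomm_unitary_conj:
  assumes T: "unitary_matrix T"
  shows "trace (ucomm (T ** A ** conj_transpose T) (T ** B ** conj_transpose T)) = trace (ucomm A B)"
  by (simp add: ucomm_def conj_transpose_unitary_conj unitary_conj_mult[OF T] trace_unitary_conj[OF T])

text \<open>Transposition reverses the product and the adjoint reverses it back, up to a cyclic
  permutation; the adjoint brings in the conjugate.\<close>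

lemma trace_ucomm_transpose: "trace (ucomm (transpose A) (transpose B)) = cnj (trace (ucomm A B))"
proof -
  have ct: "conj_transpose (transpose A) = transpose (conj_transpose A)" for A :: "complex^'n^'n"
    by (simp add: vec_eq_iff conj_transpose_def transpose_def conj_matrix_nth)
  have "trace (ucomm (transpose A) (transpose B)) = trace (transpose (conj_transpose B ** conj_transpose A ** B ** A))"
    by (simp add: ucomm_def ct matrix_transpose_mul matrix_mul_assoc)
  also have "\<dots> = cnj (trace (conj_transpose (conj_transpose B ** conj_transpose A ** B ** A)))"
    by (simp add: trace_transpose trace_conj_transpose)
  also have "trace (conj_transpose (conj_transpose B ** conj_transpose A ** B ** A)) =
      trace ((conj_transpose A ** conj_transpose B) ** (A ** B))"
    by (simp add: conj_transpose_mult matrix_mul_assoc)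
  also have "\<dots> = trace (ucomm A B)"
    by (subst trace_mul_sym) (simp add: ucomm_def matrix_mul_assoc)
  finally show ?thesis .
qed

lemma eq_unitary_conj_of_quadratic:
  fixes U M N :: "complex^'n^'n"
  assumes U: "unitary_matrix U"
    and q: "\<And>x. norm x = 1 \<Longrightarrow> herm (M *v (U *v x)) (U *v x) = c * herm (N *v x) x"
  shows "M = c *\<^sub>M (U ** N ** conj_transpose U)"
proof -
  have "conj_transpose U ** M ** U - c *\<^sub>M N = 0"
  proof (rule quadratic_form_zero)
    fix x :: "complex^'n" assume "norm x = 1"
    then show "herm ((conj_transpose U ** M ** U - c *\<^sub>M N) *v x) x = 0"
      using q[of x] by (simp add: matrix_vector_mult_diff_rdistrib herm_linear scale_mult_vec herm_adjoint
          flip: matrix_vector_mul_assoc)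
  qed
  then have "U ** (conj_transpose U ** M ** U) ** conj_transpose U = U ** (c *\<^sub>M N) ** conj_transpose U"
    by simp
  then show ?thesis
    by (simp add: unitary_conj_cancel(2)[OF U] scale_simps)
qed

text \<open>
  Transposition conjugates the trace of a commutator, so the first condition excludes
  \<open>A \<mapsto> A\<^sup>T\<close> when the pair is moved without entrywise conjugation. The second one excludes
  entrywise conjugation: it says that \<open>A\<close> is not similar to a unimodular multiple of its conjugate.
\<close>

lemma exists_irreversible_pair:
  assumes n: "CARD('n) \<ge> 3"
  obtains A B :: "complex^'n^'n" where "unitary_matrix A" "unitary_matrix B"
    "Im (trace (ucomm A B)) \<noteq> 0" "Im (trace (A ** A) * cnj ((trace A)\<^sup>2)) \<noteq> 0"
proof -
  obtain i j k :: 'n where ijk: "i \<noteq> j" "i \<noteq> k" "j \<noteq> k"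
  proof -
    obtain S :: "'n set" where "S \<subseteq> UNIV" "card S = 3"
      using n obtain_subset_with_card_n by metis
    then show ?thesis
      using that by (auto simp: card_3_iff)
  qed
  define e1 e2 e3 :: "complex^'n" where "e1 = axis i 1" and "e2 = axis j 1" and "e3 = axis k 1"
  have e: "norm e1 = 1" "norm e2 = 1" "norm e3 = 1" "herm e1 e2 = 0" "herm e1 e3 = 0" "herm e2 e3 = 0"
     "herm e2 e1 = 0" "herm e3 e1 = 0" "herm e3 e2 = 0"
    using ijk by (simp_all add: e1_def e2_def e3_def herm_axis_axis)
  \<comment> \<open>A non-real rational point of the unit circle, which keeps all traces
    exact.\<close>
  define l where "l = Complex (3/5) (4/5)"
  have l: "cmod l = 1"
    by (simp add: l_def cmod_def power2_eq_square)
  define A where "A = qrefl e1 l ** qrefl e2 (-1)"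
  have A: "unitary_matrix A"
    by (simp add: A_def unitary_matrix_mult unitary_qrefl e l)
  \<comment> \<open>\<open>B\<close> shifts the lines of \<open>e1\<close>, \<open>e2\<close> to
    those of \<open>e2\<close>, \<open>e3\<close>, so the commutator is diagonal;
    \<open>l - cnj l\<close> gives its trace the imaginary part 8/5.\<close>
  obtain B where B: "unitary_matrix B" "outer (B *v e1) = outer e2" "outer (B *v e2) = outer e3"
    using unitary_transitive2[of e1 e2 e2 e3] e by auto
  have "B ** A ** conj_transpose B = qrefl (B *v e1) l ** qrefl (B *v e2) (-1)"
    by (simp add: A_def qrefl_unitary_conj B(1) flip: unitary_conj_mult)
  also have "\<dots> = qrefl e2 l ** qrefl e3 (-1)"
    using qrefl_outer_cong[OF B(2)] qrefl_outer_cong[OF B(3)] by simp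
  finally have "conj_transpose (B ** A ** conj_transpose B) = qrefl e3 (-1) ** qrefl e2 (cnj l)"
    by (simp add: conj_transpose_mult conj_transpose_qrefl)
  then have "B ** conj_transpose A ** conj_transpose B = qrefl e3 (-1) ** qrefl e2 (cnj l)"
    by (simp add: conj_transpose_unitary_conj)
  then have "ucomm A B = A ** (qrefl e3 (-1) ** qrefl e2 (cnj l))"
    by (simp add: ucomm_def flip: matrix_mul_assoc)
  also have "\<dots> = mat 1 + (l - 1) *\<^sub>M outer e1 + (- cnj l - 1) *\<^sub>M outer e2 + (-2) *\<^sub>M outer e3"
    using e by (simp add: A_def matrix_eq qrefl_mult_vec herm_linear outer_mult_vec scale_mult_vec
      matrix_vector_mult_add_rdistrib vec_eq_iff algebra_simps flip: matrix_vector_mul_assoc)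
  finally have "trace (ucomm A B) = of_nat CARD('n) + (l - 1) + (- cnj l - 1) - 2"
    using e by (simp add: trace_add trace_I trace_scale trace_outer)
  then have "Im (trace (ucomm A B)) \<noteq> 0"
    by (simp add: l_def)
  moreover have "Im (trace (A ** A) * cnj ((trace A)\<^sup>2)) \<noteq> 0"
  proof -
    have "A = mat 1 + (l - 1) *\<^sub>M outer e1 + (-2) *\<^sub>M outer e2"
      using e by (simp add: A_def matrix_eq qrefl_mult_vec herm_linear outer_mult_vec scale_mult_vec
        matrix_vector_mult_add_rdistrib vec_eq_iff algebra_simps flip: matrix_vector_mul_assoc)
    then have tA: "trace A = of_nat CARD('n) + (l - 1) - 2"
      using e by (simp add: trace_add trace_I trace_scale trace_outer)
    have "A ** A = qrefl e1 (l * l)"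
      using e by (simp add: A_def matrix_eq qrefl_mult_vec herm_linear vec_eq_iff algebra_simps flip: matrix_vector_mul_assoc)
    then have tAA: "trace (A ** A) = of_nat CARD('n) + (l * l - 1)"
      using e by (simp add: trace_qrefl)
    \<comment> \<open>The real part of \<open>trace A\<close>; n \<ge> 3 makes it positive, which
      makes the imaginary part computed below negative.\<close>
    define a where "a = real CARD('n) - 12/5"
    have a: "a \<ge> 3/5"
      using n by (simp add: a_def)
    have "trace A = Complex a (4/5)" "trace (A ** A) = Complex (a + 28/25) (24/25)"
      unfolding tA tAA by (simp_all add: l_def a_def complex_eq_iff)
    then have "Im (trace (A ** A) * cnj ((trace A)\<^sup>2)) = 24/25 * (a * a - 16/25) - 8/5 * a * (a + 28/25)"
      by (simp add: power2_eq_square algebra_simps)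
    also have "\<dots> = - (16/25 * (a * a) + 224/125 * a + 384/625)"
      by (simp add: field_simps)
    also have "\<dots> < 0"
      using a zero_le_square[of a] by linarith
    finally show ?thesis by simp
  qed
  ultimately show ?thesis
    using that A B(1) by blast
qed

section \<open>Probes and the two types of local automorphisms\<close>

locale local_unitary_automorphism =
  fixes \<phi> :: "complex^'n^'n \<Rightarrow> complex^'n^'n"
  assumes loc: "local_automorphism unitary_group \<phi>" and card: "CARD('n) \<ge> 3"
begin

lemma unitary_image: "unitary_matrix A \<Longrightarrow> unitary_matrix (\<phi> A)"
  using loc by (simp add: local_automorphism_def Pi_iff)

lemma pair_form:
  assumes A: "unitary_matrix A" and B: "unitary_matrix B"
  obtains T g where "unitary_matrix T" "g \<in> M_u CARD('n)"
     "\<phi> A = g (det A) *\<^sub>M (T ** A ** conj_transpose T)" "\<phi> B = g (det B) *\<^sub>M (T ** B ** conj_transpose T)"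
  | T g where "unitary_matrix T" "g \<in> M_u CARD('n)"
     "\<phi> A = g (det (conj_matrix A)) *\<^sub>M (T ** conj_matrix A ** conj_transpose T)"
     "\<phi> B = g (det (conj_matrix B)) *\<^sub>M (T ** conj_matrix B ** conj_transpose T)"
proof -
  obtain \<psi> where psi: "\<psi> \<in> iso unitary_group unitary_group" "\<phi> A = \<psi> A" "\<phi> B = \<psi> B"
  proof -
    have "\<exists>\<psi> \<in> iso unitary_group unitary_group. \<phi> A = \<psi> A \<and> \<phi> B = \<psi> B"
      using loc A B by (simp add: local_automorphism_def)
    then show ?thesis using that by blast
  qed
  interpret unitary_automorphism \<psi>
    by unfold_locales (fact psi(1), fact card)
  from standard_form psi A B show ?thesis
    using that by metis
qed

text \<open>Conjugation turns the eigenvalue \<open>\<i>\<close> into \<open>-\<i>\<close>, and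
  \<open>qrefl_scalar_eqD\<close> tells these apart even up to scalars. The factor \<open>r\<close>
  serves to reach a prescribed determinant.\<close>

definition probe :: "complex \<Rightarrow> complex^'n \<Rightarrow> complex^'n^'n" where
  "probe r x = r *\<^sub>M qrefl x \<i>"

lemma unitary_probe: "norm x = 1 \<Longrightarrow> cmod r = 1 \<Longrightarrow> unitary_matrix (probe r x)"
  by (simp add: probe_def unitary_scale unitary_qrefl)

lemma det_probe: "norm x = 1 \<Longrightarrow> det (probe r x) = r ^ CARD('n) * \<i>"
  by (simp add: probe_def det_scale det_qrefl)

lemma probe_with_det:
  assumes "cmod d = 1"
  obtains r where "cmod r = 1" "r ^ CARD('n) * \<i> = d"
proof -
  have "cmod (d / \<i>) = 1"
    using assms by (simp add: norm_divide norm_mult)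
  then obtain t where t: "d / \<i> = cis t"
    by (metis complex_norm_eq_1_exp cis_conv_exp)
  have "cis (t / real CARD('n)) ^ CARD('n) = cis t"
    by (simp add: Complex.DeMoivre)
  also have "\<dots> * \<i> = d"
    using t by (metis complex_i_not_zero nonzero_divide_eq_eq)
  finally show ?thesis
    using that[of "cis (t / real CARD('n))"] by simp
qed

definition linear_type :: bool where
  "linear_type \<longleftrightarrow> (\<forall>x r. norm x = 1 \<longrightarrow> cmod r = 1 \<longrightarrow>
     (\<exists>s u. norm u = 1 \<and> \<phi> (probe r x) = s *\<^sub>M qrefl u \<i>))"

definition antilinear_type :: bool where
  "antilinear_type \<longleftrightarrow> (\<forall>x r. norm x = 1 \<longrightarrow> cmod r = 1 \<longrightarrow>
     (\<exists>s u. norm u = 1 \<and> \<phi> (probe r x) = s *\<^sub>M qrefl u (-\<i>)))"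

text \<open>One automorphism covers two probes at a time, so any two probe images share an
  eigenvalue, and none admits both eigenvalues.\<close>

lemma type_dichotomy: "linear_type \<or> antilinear_type"
proof -
  have "(\<exists>s u. norm u = 1 \<and> \<phi> (probe r x) = s *\<^sub>M qrefl u \<i>) \<and> (\<exists>s u. norm u = 1 \<and> \<phi> (probe r' x') = s *\<^sub>M qrefl u \<i>) \<or>
    (\<exists>s u. norm u = 1 \<and> \<phi> (probe r x) = s *\<^sub>M qrefl u (-\<i>)) \<and> (\<exists>s u. norm u = 1 \<and> \<phi> (probe r' x') = s *\<^sub>M qrefl u (-\<i>))"
    if x: "norm x = 1" "cmod r = 1" "norm x' = 1" "cmod r' = 1" for x r x' r'
  proof (rule pair_form[OF unitary_probe[OF x(1,2)] unitary_probe[OF x(3,4)]], goal_cases)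
    case (1 T g)
    then have "\<phi> (probe r x) = (g (det (probe r x)) * r) *\<^sub>M qrefl (T *v x) \<i>"
      "\<phi> (probe r' x') = (g (det (probe r' x')) * r') *\<^sub>M qrefl (T *v x') \<i>"
      by (simp_all add: probe_def scale_simps qrefl_unitary_conj)
    moreover have "norm (T *v x) = 1" "norm (T *v x') = 1"
      using 1 x by (simp_all add: unitary_norm)
    ultimately show ?case by blast
  next
    case (2 T g)
    then have "\<phi> (probe r x) = (g (det (conj_matrix (probe r x))) * cnj r) *\<^sub>M qrefl (T *v cnj_vec x) (-\<i>)"
      "\<phi> (probe r' x') = (g (det (conj_matrix (probe r' x'))) * cnj r') *\<^sub>M qrefl (T *v cnj_vec x') (-\<i>)"
      by (simp_all add: probe_def scale_simps qrefl_unitary_conj conj_matrix_scale conj_matrix_qrefl)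
    moreover have "norm (T *v cnj_vec x) = 1" "norm (T *v cnj_vec x') = 1"
      using 2 x by (simp_all add: unitary_norm)
    ultimately show ?case by blast
  qed
  moreover have "\<not> (\<exists>s u. norm u = 1 \<and> \<phi> (probe r x) = s *\<^sub>M qrefl u \<i>) \<or> \<not> (\<exists>s u. norm u = 1 \<and> \<phi> (probe r x) = s *\<^sub>M qrefl u (-\<i>))"
    if x: "norm x = 1" "cmod r = 1" for x r
  proof (rule ccontr)
    assume "\<not> ?thesis"
    then obtain s u t v where uv: "norm u = 1" "\<phi> (probe r x) = s *\<^sub>M qrefl u \<i>" "norm v = 1" "\<phi> (probe r x) = t *\<^sub>M qrefl v (-\<i>)"
      by blast
    have "unitary_matrix (\<phi> (probe r x))"
      by (rule unitary_image[OF unitary_probe[OF x]])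
    then have "cmod t = 1"
      using unitary_scaleD[of "qrefl v (-\<i>)" t] uv by (simp add: unitary_qrefl)
    then have "t \<noteq> 0" by auto
    from qrefl_scalar_eqD(2)[OF card uv(1,3) _ this, of s \<i> "-\<i>"] uv show False by simp
  qed
  ultimately show ?thesis
    unfolding linear_type_def antilinear_type_def by meson
qed

end

section \<open>Local automorphisms of linear type\<close>

locale linear_type_automorphism = local_unitary_automorphism \<phi>
  for \<phi> :: "complex^'n^'n \<Rightarrow> complex^'n^'n" +
  assumes lin_type: linear_type
begin

text \<open>The conjugated alternative would give the image of the probe the eigenvalue
  \<open>-\<i>\<close>, against the linear type.\<close>

lemma pair_form_linear:
  assumes A: "unitary_matrix A" and x: "norm x = 1" and r: "cmod r = 1"
  obtains T g where "unitary_matrix T" "g \<in> M_u CARD('n)"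
     "\<phi> A = g (det A) *\<^sub>M (T ** A ** conj_transpose T)"
     "\<phi> (probe r x) = (g (det (probe r x)) * r) *\<^sub>M qrefl (T *v x) \<i>"
proof (rule pair_form[OF A unitary_probe[OF x r]])
  fix T :: "complex^'n^'n" and g
  assume "unitary_matrix T" "g \<in> M_u CARD('n)" "\<phi> A = g (det A) *\<^sub>M (T ** A ** conj_transpose T)"
    "\<phi> (probe r x) = g (det (probe r x)) *\<^sub>M (T ** probe r x ** conj_transpose T)"
  then show thesis
    using that[of T g] by (simp add: probe_def scale_simps qrefl_unitary_conj)
next
  fix T :: "complex^'n^'n" and g
  assume T: "unitary_matrix T" and g: "g \<in> M_u CARD('n)"
    and eq: "\<phi> (probe r x) = g (det (conj_matrix (probe r x))) *\<^sub>M (T ** conj_matrix (probe r x) ** conj_transpose T)"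
  have nz: "g (det (conj_matrix (probe r x))) * cnj r \<noteq> 0"
    using M_u_cmod[OF g cmod_det_unitary[OF unitary_conj_matrix[OF unitary_probe[OF x r]]]] r by auto
  have eq': "\<phi> (probe r x) = (g (det (conj_matrix (probe r x))) * cnj r) *\<^sub>M qrefl (T *v cnj_vec x) (-\<i>)"
    unfolding eq using T by (simp add: probe_def scale_simps qrefl_unitary_conj conj_matrix_scale conj_matrix_qrefl)
  obtain s u where su: "norm u = 1" "\<phi> (probe r x) = s *\<^sub>M qrefl u \<i>"
    using lin_type x r unfolding linear_type_def by blast
  have "norm (T *v cnj_vec x) = 1"
    using T x by (simp add: unitary_norm)
  from qrefl_scalar_eqD(2)[OF card su(1) this _ nz, of s \<i> "-\<i>"] su(2) eq' show thesis by simp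
qed

text \<open>The function f of the final form, read off some probe of determinant \<open>d\<close>;
  \<open>probe_images_det_eq\<close> makes the value independent of the probe.\<close>

definition factor :: "complex \<Rightarrow> complex" where
  "factor d = (SOME s. \<exists>x r u. norm x = 1 \<and> cmod r = 1 \<and> norm u = 1 \<and> r ^ CARD('n) * \<i> = d \<and>
     \<phi> (probe r x) = (s * r) *\<^sub>M qrefl u \<i>)"

text \<open>The image line is read off the probe with \<open>r = 1\<close>; agreement with the other
  probes on \<open>x\<close> is part of \<open>image_form\<close>.\<close>

definition axis_image :: "complex^'n \<Rightarrow> complex^'n" where
  "axis_image x = (SOME u. norm u = 1 \<and> (\<exists>s. s \<noteq> 0 \<and> \<phi> (probe 1 x) = s *\<^sub>M qrefl u \<i>))"

lemma axis_image:
  assumes x: "norm x = 1"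
  shows "norm (axis_image x) = 1" "\<exists>s. s \<noteq> 0 \<and> \<phi> (probe 1 x) = s *\<^sub>M qrefl (axis_image x) \<i>"
proof -
  obtain T g where T: "unitary_matrix T" "g \<in> M_u CARD('n)"
     "\<phi> (probe 1 x) = (g (det (probe 1 x)) * 1) *\<^sub>M qrefl (T *v x) \<i>"
    using pair_form_linear[OF unitary_one x norm_one] by metis
  have "g (det (probe 1 x)) * 1 \<noteq> 0"
    using M_u_cmod[OF T(2) cmod_det_unitary[OF unitary_probe[OF x, of 1]]] by auto
  moreover have "norm (T *v x) = 1"
    using T x by (simp add: unitary_norm)
  ultimately have "\<exists>u. norm u = 1 \<and> (\<exists>s. s \<noteq> 0 \<and> \<phi> (probe 1 x) = s *\<^sub>M qrefl u \<i>)"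
    using T(3) by blast
  from someI_ex[OF this] show "norm (axis_image x) = 1" "\<exists>s. s \<noteq> 0 \<and> \<phi> (probe 1 x) = s *\<^sub>M qrefl (axis_image x) \<i>"
    unfolding axis_image_def by blast+
qed

lemma axis_image_unique:
  assumes x: "norm x = 1" and u: "norm u = 1" and eq: "\<phi> (probe 1 x) = s *\<^sub>M qrefl u \<i>"
  shows "outer u = outer (axis_image x)"
proof -
  obtain t where t: "t \<noteq> 0" "\<phi> (probe 1 x) = t *\<^sub>M qrefl (axis_image x) \<i>"
    using axis_image(2)[OF x] by blast
  from qrefl_scalar_eqD(3)[OF card u axis_image(1)[OF x] _ t(1), of s \<i> \<i>] eq t(2) show ?thesis
    by (simp add: complex_eq_iff)
qed

text \<open>A single automorphism realizes both images, so both scalars are the value of one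
  \<open>g\<close> at the common determinant.\<close>

lemma probe_images_det_eq:
  assumes x: "norm x = 1" "cmod r = 1" "norm u = 1" "\<phi> (probe r x) = (s * r) *\<^sub>M qrefl u \<i>"
    and y: "norm y = 1" "cmod q = 1" "norm v = 1" "\<phi> (probe q y) = (t * q) *\<^sub>M qrefl v \<i>"
    and d: "r ^ CARD('n) = q ^ CARD('n)"
  shows "s = t"
proof -
  obtain T g where T: "unitary_matrix T" "g \<in> M_u CARD('n)"
     "\<phi> (probe r x) = g (det (probe r x)) *\<^sub>M (T ** probe r x ** conj_transpose T)"
     "\<phi> (probe q y) = (g (det (probe q y)) * q) *\<^sub>M qrefl (T *v y) \<i>"
    using pair_form_linear[OF unitary_probe[OF x(1,2)] y(1,2)] by metis
  have gr: "cmod (g (det (probe r x))) = 1" "cmod (g (det (probe q y))) = 1"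
    using M_u_cmod[OF T(2) cmod_det_unitary[OF unitary_probe]] x y by blast+
  have "\<phi> (probe r x) = (g (det (probe r x)) * r) *\<^sub>M qrefl (T *v x) \<i>"
    using T(1,3) by (simp add: probe_def scale_simps qrefl_unitary_conj)
  then have "s * r = g (det (probe r x)) * r"
    using qrefl_scalar_eqD(1)[OF card x(3), of "T *v x" "s * r" \<i> "g (det (probe r x)) * r" \<i>] x gr T(1)
    by (force simp: unitary_norm)
  moreover have "t * q = g (det (probe q y)) * q"
    using qrefl_scalar_eqD(1)[OF card y(3), of "T *v y" "t * q" \<i> "g (det (probe q y)) * q" \<i>] y gr T(1,4)
    by (force simp: unitary_norm)
  moreover have "r \<noteq> 0" "q \<noteq> 0" using x y by auto
  ultimately show ?thesis
    using x y d by (simp add: det_probe)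
qed

lemma factor_eq:
  assumes x: "norm x = 1" "cmod r = 1" "norm u = 1" "\<phi> (probe r x) = (s * r) *\<^sub>M qrefl u \<i>"
  shows "factor (r ^ CARD('n) * \<i>) = s"
proof -
  let ?P = "\<lambda>s. \<exists>y q u. norm y = 1 \<and> cmod q = 1 \<and> norm u = 1 \<and> q ^ CARD('n) * \<i> = r ^ CARD('n) * \<i> \<and>
     \<phi> (probe q y) = (s * q) *\<^sub>M qrefl u \<i>"
  have "?P s" using x by blast
  then have "?P (factor (r ^ CARD('n) * \<i>))"
    unfolding factor_def by (rule someI)
  then obtain y q v where y: "norm y = 1" "cmod q = 1" "norm v = 1" "q ^ CARD('n) = r ^ CARD('n)"
     "\<phi> (probe q y) = (factor (r ^ CARD('n) * \<i>) * q) *\<^sub>M qrefl v \<i>"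
    by auto
  show ?thesis
    by (rule probe_images_det_eq[OF y(1-3) y(5) x y(4)])
qed

text \<open>Pairing \<open>A\<close> with a probe on \<open>x\<close> of the same determinant
  identifies the scalar. The matrix \<open>T\<close> still varies with \<open>A\<close> and
  \<open>x\<close>.\<close>

lemma image_form:
  assumes A: "unitary_matrix A" and x: "norm x = 1"
  obtains T where "unitary_matrix T" "\<phi> A = factor (det A) *\<^sub>M (T ** A ** conj_transpose T)"
    "outer (T *v x) = outer (axis_image x)"
proof -
  obtain r where r: "cmod r = 1" "r ^ CARD('n) * \<i> = det A"
    using probe_with_det[OF cmod_det_unitary[OF A]] by blast
  obtain T g where T: "unitary_matrix T" "g \<in> M_u CARD('n)"
     "\<phi> A = g (det A) *\<^sub>M (T ** A ** conj_transpose T)"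
     "\<phi> (probe r x) = (g (det (probe r x)) * r) *\<^sub>M qrefl (T *v x) \<i>"
    using pair_form_linear[OF A x r(1)] by metis
  have Tx: "norm (T *v x) = 1" using T x by (simp add: unitary_norm)
  have "factor (det A) = g (det A)"
    using factor_eq[OF x r(1) Tx T(4)] r(2) x by (simp add: det_probe)
  moreover have "outer (T *v x) = outer (axis_image x)"
  proof -
    \<comment> \<open>\<open>axis_image\<close> refers to \<open>probe 1 x\<close>, so a second pair
      links \<open>probe r x\<close> to it.\<close>
    obtain T' g' where T': "unitary_matrix T'" "g' \<in> M_u CARD('n)"
       "\<phi> (probe r x) = g' (det (probe r x)) *\<^sub>M (T' ** probe r x ** conj_transpose T')"
       "\<phi> (probe 1 x) = (g' (det (probe 1 x)) * 1) *\<^sub>M qrefl (T' *v x) \<i>"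
      using pair_form_linear[OF unitary_probe[OF x r(1)] x, of 1] by (metis norm_one)
    have T'x: "norm (T' *v x) = 1" using T' x by (simp add: unitary_norm)
    have "(g (det (probe r x)) * r) *\<^sub>M qrefl (T *v x) \<i> = (g' (det (probe r x)) * r) *\<^sub>M qrefl (T' *v x) \<i>"
      using T(4) T'(1,3) by (simp add: probe_def scale_simps qrefl_unitary_conj)
    moreover have "g' (det (probe r x)) * r \<noteq> 0"
      using M_u_cmod[OF T'(2) cmod_det_unitary[OF unitary_probe[OF x r(1)]]] r by auto
    ultimately have "outer (T *v x) = outer (T' *v x)"
      using qrefl_scalar_eqD(3)[OF card Tx T'x] by (simp add: complex_eq_iff)
    also have "\<dots> = outer (axis_image x)"
      by (rule axis_image_unique[OF x T'x T'(4)])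
    finally show ?thesis .
  qed
  ultimately show ?thesis
    using that T by metis
qed

text \<open>Two probes on one line with determinants \<open>z\<close> and \<open>w\<close> yield one
  \<open>g\<close> for both.\<close>

lemma factor_LM_u: "factor \<in> LM_u CARD('n)"
proof -
  define e :: "complex^'n" where "e = axis undefined 1"
  have e: "norm e = 1" by (simp add: e_def)
  have pair: "\<exists>g \<in> M_u CARD('n). factor z = g z \<and> factor w = g w" if z: "cmod z = 1" and w: "cmod w = 1" for z w
  proof -
    obtain r where r: "cmod r = 1" "r ^ CARD('n) * \<i> = z"
      using probe_with_det[OF z] by blast
    obtain q where q: "cmod q = 1" "q ^ CARD('n) * \<i> = w"
      using probe_with_det[OF w] by blast
    obtain T g where T: "unitary_matrix T" "g \<in> M_u CARD('n)"
       "\<phi> (probe r e) = g (det (probe r e)) *\<^sub>M (T ** probe r e ** conj_transpose T)"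
       "\<phi> (probe q e) = (g (det (probe q e)) * q) *\<^sub>M qrefl (T *v e) \<i>"
      using pair_form_linear[OF unitary_probe[OF e r(1)] e q(1)] by metis
    have Te: "norm (T *v e) = 1" using T e by (simp add: unitary_norm)
    have "\<phi> (probe r e) = (g (det (probe r e)) * r) *\<^sub>M qrefl (T *v e) \<i>"
      using T(1,3) by (simp add: probe_def scale_simps qrefl_unitary_conj)
    from factor_eq[OF e r(1) Te this] have "factor z = g z"
      using r e by (simp add: det_probe)
    moreover from factor_eq[OF e q(1) Te T(4)] have "factor w = g w"
      using q e by (simp add: det_probe)
    ultimately show ?thesis using T(2) by blast
  qed
  moreover have "cmod (factor z) = 1" if "cmod z = 1" for z
    using pair[OF that that] M_u_cmod that by metis
  ultimately show ?thesis
    by (auto simp: LM_u_def)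
qed

lemma cmod_factor: "cmod z = 1 \<Longrightarrow> cmod (factor z) = 1"
  using factor_LM_u by (auto simp: LM_u_def)

text \<open>A common unitary matrix moves the probes on \<open>x\<close> and
  \<open>y\<close>.\<close>

lemma axis_image_cmod_herm:
  assumes x: "norm x = 1" and y: "norm y = 1"
  shows "cmod (herm (axis_image x) (axis_image y)) = cmod (herm x y)"
proof -
  obtain T g where T: "unitary_matrix T" "g \<in> M_u CARD('n)"
     "\<phi> (probe 1 x) = g (det (probe 1 x)) *\<^sub>M (T ** probe 1 x ** conj_transpose T)"
     "\<phi> (probe 1 y) = (g (det (probe 1 y)) * 1) *\<^sub>M qrefl (T *v y) \<i>"
    using pair_form_linear[OF unitary_probe[OF x, of 1] y, of 1] by (metis norm_one)
  have n: "norm (T *v x) = 1" "norm (T *v y) = 1" using T x y by (simp_all add: unitary_norm)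
  have "\<phi> (probe 1 x) = g (det (probe 1 x)) *\<^sub>M qrefl (T *v x) \<i>"
    using T(1,3) by (simp add: probe_def scale_simps qrefl_unitary_conj)
  then have "outer (T *v x) = outer (axis_image x)"
    by (rule axis_image_unique[OF x n(1)])
  moreover have "outer (T *v y) = outer (axis_image y)"
    by (rule axis_image_unique[OF y n(2) T(4)])
  ultimately have "cmod (herm (axis_image x) (axis_image y)) = cmod (herm (T *v x) (T *v y))"
    by (metis outer_eq_cmod_herm2)
  then show ?thesis by (simp add: unitary_herm T)
qed

text \<open>The matrix \<open>T\<close> of \<open>image_form\<close> drops out of the quadratic form
  on the image line, which turns the pairwise data into a global identity.\<close>

lemma quadratic_form_image:
  assumes A: "unitary_matrix A" and x: "norm x = 1" and u: "outer (axis_image x) = outer u"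
  shows "herm (\<phi> A *v u) u = factor (det A) * herm (A *v x) x"
proof -
  obtain T where T: "unitary_matrix T" "\<phi> A = factor (det A) *\<^sub>M (T ** A ** conj_transpose T)"
    "outer (T *v x) = outer (axis_image x)"
    using image_form[OF A x] by metis
  have "herm (\<phi> A *v u) u = herm (\<phi> A *v (T *v x)) (T *v x)"
    by (rule outer_eq_quadratic) (simp add: T u)
  also have "\<dots> = factor (det A) * herm (T *v (A *v x)) (T *v x)"
    by (simp add: T(2) scale_mult_vec herm_linear unitary_cancel_left T(1) flip: matrix_vector_mul_assoc)
  also have "\<dots> = factor (det A) * herm (A *v x) x"
    by (simp add: unitary_herm T)
  finally show ?thesis .
qed

text \<open>For the pair of \<open>exists_irreversible_pair\<close>, a standard form without
  conjugation keeps the commutator trace, which transposition conjugates; one with conjugation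
  conjugates an expression in the traces of \<open>A\<close> and its square that transposition
  keeps.\<close>

lemma not_transpose_form:
  assumes U: "unitary_matrix U"
    and form: "\<And>A. unitary_matrix A \<Longrightarrow> \<phi> A = factor (det A) *\<^sub>M (U ** transpose A ** conj_transpose U)"
  shows False
proof -
  obtain A B :: "complex^'n^'n" where A: "unitary_matrix A" and B: "unitary_matrix B"
    and comm: "Im (trace (ucomm A B)) \<noteq> 0" and sq: "Im (trace (A ** A) * cnj ((trace A)\<^sup>2)) \<noteq> 0"
    using exists_irreversible_pair[OF card] by blast
  have f: "cmod (factor (det A)) = 1" "cmod (factor (det B)) = 1"
    by (simp_all add: cmod_factor cmod_det_unitary A B)
  have c1: "trace (ucomm (\<phi> A) (\<phi> B)) = cnj (trace (ucomm A B))"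
    by (simp add: form A B ucomm_scale f trace_ucomm_unitary_conj U trace_ucomm_transpose)
  have t1: "trace (\<phi> A) = factor (det A) * trace A"
    by (simp add: form A trace_scale trace_unitary_conj U trace_transpose)
  have t2: "trace (\<phi> A ** \<phi> A) = (factor (det A))\<^sup>2 * trace (A ** A)"
    by (simp add: form A scale_simps unitary_conj_mult U trace_scale trace_unitary_conj power2_eq_square
        trace_transpose flip: matrix_transpose_mul)
  show False
  proof (rule pair_form[OF A B])
    fix T :: "complex^'n^'n" and g
    assume T: "unitary_matrix T" and g: "g \<in> M_u CARD('n)"
      and eq: "\<phi> A = g (det A) *\<^sub>M (T ** A ** conj_transpose T)" "\<phi> B = g (det B) *\<^sub>M (T ** B ** conj_transpose T)"
    have "trace (ucomm (\<phi> A) (\<phi> B)) = trace (ucomm A B)"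
      unfolding eq by (simp add: ucomm_scale M_u_cmod[OF g] cmod_det_unitary A B trace_ucomm_unitary_conj T)
    with c1 comm show False
      by (simp add: complex_eq_iff)
  next
    fix T :: "complex^'n^'n" and g
    assume T: "unitary_matrix T" and g: "g \<in> M_u CARD('n)"
      and eq: "\<phi> A = g (det (conj_matrix A)) *\<^sub>M (T ** conj_matrix A ** conj_transpose T)"
    let ?g = "g (det (conj_matrix A))" and ?f = "factor (det A)"
    have s1: "trace (\<phi> A) = ?g * cnj (trace A)"
      unfolding eq by (simp add: trace_scale trace_unitary_conj T trace_conj_matrix)
    have s2: "trace (\<phi> A ** \<phi> A) = ?g\<^sup>2 * cnj (trace (A ** A))"
      unfolding eq by (simp add: scale_simps unitary_conj_mult T trace_scale trace_unitary_conj power2_eq_square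
        trace_conj_matrix flip: conj_matrix_mult)
    have gn: "?g \<noteq> 0" "?f \<noteq> 0"
      using M_u_cmod[OF g cmod_det_unitary[OF unitary_conj_matrix[OF A]]] f by auto
    \<comment> \<open>Scalars enter \<open>trace (A ** A)\<close> and
      \<open>(trace A)\<^sup>2\<close> alike, so unimodular factors cancel in this product.\<close>
    let ?z = "trace (A ** A) * cnj ((trace A)\<^sup>2)"
    have "?f\<^sup>2 * ?g\<^sup>2 * ?z = (?f\<^sup>2 * trace (A ** A)) * (?g * cnj (trace A))\<^sup>2"
      by (simp add: power_mult_distrib)
    also have "\<dots> = (?g\<^sup>2 * cnj (trace (A ** A))) * (?f * trace A)\<^sup>2"
      using s1 s2 t1 t2 by simp
    also have "\<dots> = ?f\<^sup>2 * ?g\<^sup>2 * cnj ?z"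
      by (simp add: power_mult_distrib)
    finally have "?z = cnj ?z"
      using gn by simp
    with sq show False
      by (metis Im_complex_of_real complex_cnj_cancel_iff Reals_cnj_iff complex_is_Real_iff)
  qed
qed

text \<open>In the unitary case of Wigner's theorem the quadratic form determines
  \<open>\<phi> A\<close> as wanted; the antiunitary case would give the transpose.\<close>

lemma linear_type_form:
  "\<exists>T. unitary_matrix T \<and> (\<exists>f \<in> LM_u CARD('n). \<forall>A. unitary_matrix A \<longrightarrow>
     \<phi> A = f (det A) *\<^sub>M (T ** A ** conj_transpose T))"
proof -
  have "CARD('n) \<ge> 2" using card by simp
  from wigner_unit[OF this, of axis_image] obtain U where U: "unitary_matrix U" and
    cases: "(\<forall>x. norm x = 1 \<longrightarrow> outer (axis_image x) = outer (U *v x)) \<or>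
     (\<forall>x. norm x = 1 \<longrightarrow> outer (axis_image x) = outer (U *v cnj_vec x))"
    using axis_image_cmod_herm by blast
  from cases show ?thesis
  proof
    assume lin: "\<forall>x. norm x = 1 \<longrightarrow> outer (axis_image x) = outer (U *v x)"
    have "\<phi> A = factor (det A) *\<^sub>M (U ** A ** conj_transpose U)" if A: "unitary_matrix A" for A
      by (rule eq_unitary_conj_of_quadratic[OF U]) (simp add: quadratic_form_image[OF A] lin)
    then show ?thesis using U factor_LM_u by blast
  next
    assume anti: "\<forall>x. norm x = 1 \<longrightarrow> outer (axis_image x) = outer (U *v cnj_vec x)"
    have "\<phi> A = factor (det A) *\<^sub>M (U ** transpose A ** conj_transpose U)" if A: "unitary_matrix A" for A
    proof (rule eq_unitary_conj_of_quadratic[OF U])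
      fix x :: "complex^'n" assume x: "norm x = 1"
      then have "herm (\<phi> A *v (U *v x)) (U *v x) = factor (det A) * herm (A *v cnj_vec x) (cnj_vec x)"
        using anti by (intro quadratic_form_image[OF A]) auto
      also have "herm (A *v cnj_vec x) (cnj_vec x) = herm (transpose A *v x) x"
        using herm_transpose[of A "cnj_vec x"] by simp
      finally show "herm (\<phi> A *v (U *v x)) (U *v x) = factor (det A) * herm (transpose A *v x) x" .
    qed
    from not_transpose_form[OF U this] show ?thesis by blast
  qed
qed

end

section \<open>Reduction of the antilinear type by conjugation\<close>

text \<open>Conjugation is an automorphism of the circle group, and \<open>g\<close> is transported
  along it.\<close>

lemma M_u_cnj:
  assumes g: "g \<in> M_u n"
  shows "(\<lambda>z. cnj (g (cnj z))) \<in> M_u n"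
proof (rule M_uI)
  fix z w assume z: "cmod z = 1"
  then show "cmod (cnj (g (cnj z))) = 1"
    by (simp add: M_u_cmod[OF g])
  assume w: "cmod w = 1"
  then show "cnj (g (cnj (z * w))) = cnj (g (cnj z)) * cnj (g (cnj w))"
    using z by (simp add: M_u_mult[OF g])
  assume "cnj (g (cnj z)) ^ n * z = cnj (g (cnj w)) ^ n * w"
  then have "g (cnj z) ^ n * cnj z = g (cnj w) ^ n * cnj w"
    by (metis complex_cnj_cnj complex_cnj_mult complex_cnj_power)
  with M_u_inj[OF g, of "cnj z" "cnj w"] z w show "z = w"
    by simp
next
  fix w assume "cmod w = 1"
  then obtain z where "cmod z = 1" "g z ^ n * z = cnj w"
    using M_u_surj[OF g, of "cnj w"] by auto
  then show "\<exists>z. cmod z = 1 \<and> cnj (g (cnj z)) ^ n * z = w"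
    by (intro exI[of _ "cnj z"]) (metis complex_cnj_cnj complex_cnj_mult complex_cnj_power complex_mod_cnj)
qed

lemma LM_u_cnj:
  assumes f: "f \<in> LM_u n"
  shows "(\<lambda>z. cnj (f (cnj z))) \<in> LM_u n"
proof -
  have "\<exists>g \<in> M_u n. cnj (f (cnj z)) = g z \<and> cnj (f (cnj w)) = g w" if "cmod z = 1" "cmod w = 1" for z w
  proof -
    have "\<exists>g \<in> M_u n. f (cnj z) = g (cnj z) \<and> f (cnj w) = g (cnj w)"
      using f that by (simp add: LM_u_def)
    then obtain g where g: "g \<in> M_u n" "f (cnj z) = g (cnj z)" "f (cnj w) = g (cnj w)"
      by blast
    then show ?thesis
      by (intro bexI[OF _ M_u_cnj[OF g(1)]]) simp
  qed
  then show ?thesis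
    using f by (auto simp: LM_u_def Pi_iff)
qed

lemma (in local_unitary_automorphism) local_form:
  "\<exists>T. unitary_matrix T \<and> (\<exists>f \<in> LM_u CARD('n).
     (\<forall>A. unitary_matrix A \<longrightarrow> \<phi> A = f (det A) *\<^sub>M (T ** A ** conj_transpose T)) \<or>
     (\<forall>A. unitary_matrix A \<longrightarrow> \<phi> A = f (det (conj_matrix A)) *\<^sub>M (T ** conj_matrix A ** conj_transpose T)))"
  using type_dichotomy
proof
  assume linear_type
  then interpret linear_type_automorphism \<phi>
    by unfold_locales
  show ?thesis using linear_type_form by blast
next
  assume anti: antilinear_type
  \<comment> \<open>Conjugation after \<open>\<phi>\<close> turns the probe eigenvalue
    \<open>-\<i>\<close> into \<open>\<i>\<close>, so the composite is of linear type.\<close>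
  interpret c: local_unitary_automorphism "conj_matrix \<circ> \<phi>"
  proof
    show "local_automorphism unitary_group (conj_matrix \<circ> \<phi>)"
      unfolding local_automorphism_def
    proof (intro conjI ballI Pi_I)
      fix A B :: "complex^'n^'n" assume AB: "A \<in> carrier unitary_group" "B \<in> carrier unitary_group"
      then show "(conj_matrix \<circ> \<phi>) A \<in> carrier unitary_group"
        by (simp add: unitary_image unitary_conj_matrix)
      obtain \<psi> where psi: "\<psi> \<in> iso unitary_group unitary_group" "\<phi> A = \<psi> A" "\<phi> B = \<psi> B"
        using loc AB unfolding local_automorphism_def by blast
      then show "\<exists>\<psi>\<in>iso unitary_group unitary_group. (conj_matrix \<circ> \<phi>) A = \<psi> A \<and> (conj_matrix \<circ> \<phi>) B = \<psi> B"
        by (intro bexI[OF _ iso_set_trans[OF psi(1) conj_matrix_iso]]) simp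
    qed
  qed (rule card)
  interpret c: linear_type_automorphism "conj_matrix \<circ> \<phi>"
  proof
    show c.linear_type
      unfolding c.linear_type_def
    proof (intro allI impI)
      fix x :: "complex^'n" and r assume x: "norm x = 1" "cmod r = 1"
      then obtain s u where u: "norm u = 1" "\<phi> (probe r x) = s *\<^sub>M qrefl u (-\<i>)"
        using anti unfolding antilinear_type_def by blast
      show "\<exists>s u. norm u = 1 \<and> (conj_matrix \<circ> \<phi>) (c.probe r x) = s *\<^sub>M qrefl u \<i>"
        by (rule exI[of _ "cnj s"], rule exI[of _ "cnj_vec u"])
           (use u in \<open>simp add: conj_matrix_scale conj_matrix_qrefl\<close>)
    qed
  qed
  obtain T f where T: "unitary_matrix T" and f: "f \<in> LM_u CARD('n)"
    and eq: "\<And>A. unitary_matrix A \<Longrightarrow> conj_matrix (\<phi> A) = f (det A) *\<^sub>M (T ** A ** conj_transpose T)"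
    using c.linear_type_form by auto
  \<comment> \<open>The conjugate of \<open>f (det A)\<close> is \<open>F\<close> at the conjugate
    determinant, as the second alternative requires.\<close>
  define F where "F z = cnj (f (cnj z))" for z
  have "F = (\<lambda>z. cnj (f (cnj z)))"
    by (simp add: fun_eq_iff F_def)
  then have F: "F \<in> LM_u CARD('n)"
    using LM_u_cnj[OF f] by simp
  have "\<phi> A = F (det (conj_matrix A)) *\<^sub>M (conj_matrix T ** conj_matrix A ** conj_transpose (conj_matrix T))"
    if "unitary_matrix A" for A
    using arg_cong[OF eq[OF that], of conj_matrix]
    by (simp add: conj_matrix_scale conj_matrix_mult det_conj_matrix conj_transpose_conj_matrix F_def)
  with unitary_conj_matrix[OF T] F show ?thesis by blast
qed

section \<open>Characterization of the local automorphisms of the unitary group\<close>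

theorem theorem3p11:
  fixes \<phi> :: "complex^'n^'n \<Rightarrow> complex^'n^'n"
  assumes "CARD('n) \<ge> 3"
    and "\<phi> \<in> carrier unitary_group \<rightarrow> carrier unitary_group"
  shows "local_automorphism unitary_group \<phi> \<longleftrightarrow>
    (\<exists>T \<in> carrier unitary_group. \<exists>f \<in> LM_u CARD('n).
       (\<forall>A \<in> carrier unitary_group. \<phi> A = f (det A) *\<^sub>M (T ** A ** matrix_inv T)) \<or>
       (\<forall>A \<in> carrier unitary_group.
          \<phi> A = f (det (conj_matrix A)) *\<^sub>M (T ** conj_matrix A ** matrix_inv T)))"
    (is "_ \<longleftrightarrow> ?form")
proof
  assume "local_automorphism unitary_group \<phi>"
  then interpret local_unitary_automorphism \<phi>
    using assms(1) by unfold_locales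
  obtain T f where "unitary_matrix T" "f \<in> LM_u CARD('n)"
     "(\<forall>A. unitary_matrix A \<longrightarrow> \<phi> A = f (det A) *\<^sub>M (T ** A ** conj_transpose T)) \<or>
     (\<forall>A. unitary_matrix A \<longrightarrow> \<phi> A = f (det (conj_matrix A)) *\<^sub>M (T ** conj_matrix A ** conj_transpose T))"
    using local_form by blast
  then show ?form
    by (intro bexI[of _ T] bexI[of _ f]) (auto simp: matrix_inv_unitary)
next
  assume ?form
  then obtain T f where T: "unitary_matrix T" and f: "f \<in> LM_u CARD('n)"
    and form: "(\<forall>A \<in> carrier unitary_group. \<phi> A = f (det A) *\<^sub>M (T ** A ** conj_transpose T)) \<or>
       (\<forall>A \<in> carrier unitary_group. \<phi> A = f (det (conj_matrix A)) *\<^sub>M (T ** conj_matrix A ** conj_transpose T))"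
    by (auto simp: matrix_inv_unitary)
  \<comment> \<open>At the two determinants \<open>f\<close> agrees with one \<open>g\<close> in
    \<open>M_u\<close>, and this \<open>g\<close> defines the automorphism that matches
    \<open>\<phi>\<close> at \<open>A\<close> and \<open>B\<close>.\<close>
  have g: "\<exists>g \<in> M_u CARD('n). f (det A) = g (det A) \<and> f (det B) = g (det B)"
    if "unitary_matrix A" "unitary_matrix B" for A B :: "complex^'n^'n"
    using f cmod_det_unitary[OF that(1)] cmod_det_unitary[OF that(2)] by (simp add: LM_u_def)
  have "\<exists>\<psi> \<in> iso unitary_group unitary_group. \<phi> A = \<psi> A \<and> \<phi> B = \<psi> B"
    if A: "unitary_matrix A" and B: "unitary_matrix B" for A B
    using form
  proof
    assume eq: "\<forall>A \<in> carrier unitary_group. \<phi> A = f (det A) *\<^sub>M (T ** A ** conj_transpose T)"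
    obtain g where "g \<in> M_u CARD('n)" "f (det A) = g (det A)" "f (det B) = g (det B)"
      using g[OF A B] by blast
    then show ?thesis
      using eq A B by (intro bexI[OF _ standard_iso[OF T]]) auto
  next
    assume eq: "\<forall>A \<in> carrier unitary_group. \<phi> A = f (det (conj_matrix A)) *\<^sub>M (T ** conj_matrix A ** conj_transpose T)"
    obtain g where g: "g \<in> M_u CARD('n)" "f (det (conj_matrix A)) = g (det (conj_matrix A))"
        "f (det (conj_matrix B)) = g (det (conj_matrix B))"
      using g[OF unitary_conj_matrix[OF A] unitary_conj_matrix[OF B]] by blast
    then show ?thesis
      using eq A B by (intro bexI[OF _ iso_set_trans[OF conj_matrix_iso standard_iso[OF T g(1)]]]) auto
  qed
  then show "local_automorphism unitary_group \<phi>"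
    using assms(2) by (simp add: local_automorphism_def)
qed

end
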